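(* For $0<|q|<1$, \begin{align*} \overline{r}_0(2)&=\frac{2J_{6}^{12}}{3J_{1,6}^6J_{2}^4J_{3,6}^3}-\frac{4J^3_{6}}{3J_{2}J_{3,6}}+\frac{2J_{1,6}^6J_2^2J_{3,6}}{3J_{6}^6}-\frac{4}{J_{3,6}}\sum_{n=-\infty}^\infty\frac{(-1)^nq^{3n^2+3n}}{(1+q^{3n+1})^2}+\frac{4}{J_{3,6}}\sum_{n=-\infty}^\infty\frac{(-1)^n q^{3n^2+3n}}{1+q^{3n+1}},\\ \overline{r}_1(2)&=\frac{2J_{6}^{12}}{3J_{1,6}^6J_{2}^4J_{3,6}^3}+\frac{2J_{6}^3}{J_{2}J_{3,6}}-\frac{2J_{1,6}^6J_2^2J_{3,6}}{3J_{6}^6}+\frac{4}{J_{3,6}}\sum_{n=-\infty}^\infty\frac{(-1)^nq^{3n^2+3n}}{(1+q^{3n+1})^2}-\frac{4}{J_{3,6}}\sum_{n=-\infty}^\infty\frac{(-1)^n q^{3n^2+3n}}{1+q^{3n+1}},\\ \overline{r}_2(2)&=\frac{2J_{6}^{12}}{3J_{1,6}^6J_{2}^4J_{3,6}^3}+\frac{2J^3_{6}}{3J_{2}J_{3,6}}+\frac{2J_{1,6}^6J_2^2J_{3,6}}{3J_{6}^6}-\frac{4}{J_{3,6}}\sum_{n=-\infty}^\infty\frac{(-1)^nq^{3n^2+3n}}{(1+q^{3n+1})^2}+\frac{2}{J_{3,6}}\sum_{n=-\infty}^\infty\frac{(-1)^n q^{3n^2+3n}}{1+q^{3n+1}},\\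 \overline{r}_3(2)&=\frac{2J_{6}^{12}}{3J_{1,6}^6J_{2}^4J_{3,6}^3}-\frac{4J_{6}^3}{J_2J_{3,6}}-\frac{2J_{1,6}^6J_2^2J_{3,6}}{3J_{6}^6}+\frac{4}{J_{3,6}}\sum_{n=-\infty}^\infty\frac{(-1)^nq^{3n^2+3n}}{(1+q^{3n+1})^2}. \end{align*}
   Context: An overpartition of a non-negative integer $n$ is a partition of $n$ in which the first occurrence of each distinct part may be overlined; the empty overpartition of $0$ is counted and has rank $0$. The rank of an overpartition is its largest part minus its number of parts. $\overline N(s,6,n)$ is the number of overpartitions of $n$ with rank congruent to $s$ modulo $6$, and $\overline r_s(d)=\sum_{n\ge0}\overline N(s,6,3n+d)q^n$. Notation: $(a;q)_\infty=\prod_{n\ge0}(1-aq^n)$, $j(z;q)=(z;q)_\infty(q/z;q)_\infty(q;q)_\infty$, $J_{a,m}=j(q^a;q^m)$, $J_m=(q^m;q^m)_\infty$. *)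

theory Defs
  imports
    "HOL-Analysis.Analysis"
    "HOL-Library.Multiset"
    "HOL-Number_Theory.Cong"
begin

text \<open>
  Only the first occurrence of a part may be overlined, so an overpartition is determined by
  the multiset of its parts (overlined or not) together with the set of those part sizes
  whose first occurrence is overlined.
\<close>

definition overpartitions :: "nat \<Rightarrow> (nat multiset \<times> nat set) set" where
  "overpartitions n =
     {(M, S). 0 \<notin># M \<and> sum_mset M = n \<and> S \<subseteq> set_mset M}"

fun overpartition_rank :: "nat multiset \<times> nat set \<Rightarrow> int" where
  "overpartition_rank (M, S) =
     (if M = {#} then 0 else int (Max (set_mset M)) - int (size M))"

definition Nbar :: "int \<Rightarrow> nat \<Rightarrow> nat \<Rightarrow> nat" where
  "Nbar s m n = card {p \<in> overpartitions n. [overpartition_rank p = s] (mod (int m))}"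

definition rbar :: "int \<Rightarrow> nat \<Rightarrow> complex \<Rightarrow> complex" where
  "rbar s d q = (\<Sum>n. of_nat (Nbar s 6 (3 * n + d)) * q ^ n)"

definition qpoch_inf :: "complex \<Rightarrow> complex \<Rightarrow> complex" where
  "qpoch_inf a q = (\<Prod>n. 1 - a * q ^ n)"

definition theta_j :: "complex \<Rightarrow> complex \<Rightarrow> complex" where
  "theta_j z q = qpoch_inf z q * qpoch_inf (q / z) q * qpoch_inf q q"

text \<open>The nome \<open>q\<close>, implicit in the usual notation \<open>J\<^sub>a\<^sub>,\<^sub>m\<close> and \<open>J\<^sub>m\<close>, is the last argument.\<close>

definition J2 :: "nat \<Rightarrow> nat \<Rightarrow> complex \<Rightarrow> complex" where
  "J2 a m q = theta_j (q ^ a) (q ^ m)"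

definition J1 :: "nat \<Rightarrow> complex \<Rightarrow> complex" where
  "J1 m q = qpoch_inf (q ^ m) (q ^ m)"

end

theory Submission
  imports Defs "HOL-Complex_Analysis.Complex_Analysis"
begin

text \<open>
  Removing the largest part and applying Fine's functional equation and Bailey's lemma turns the
  generating function of the rank, for \<open>\<bar>z\<bar> = 1\<close>, into
  \<open>(1 - z)/(1 + z) (1 + 2 z f(z;Q)/\<phi>(-Q))\<close>, where \<open>f(z;Q) = \<Sum> (-1)\<^sup>n Q\<^bsup>n\<^sup>2+n\<^esup>/(1 - z Q\<^sup>n)\<close> and
  \<open>\<phi>(-Q) = \<Sum> (-1)\<^sup>n Q\<^bsup>n\<^sup>2\<^esup>\<close>. With \<open>q = Q\<^sup>3\<close>, \<open>a = \<phi>(-q\<^sup>3)\<close> and \<open>f\<^sub>3(z) = f(z;q\<^sup>3)\<close>, the component \<open>W(z)\<close> of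
  \<open>1 + 2 z f(z;Q)/\<phi>(-Q)\<close> with exponents \<open>2\<close> modulo \<open>3\<close> and the function
  \<open>V(z) = (2/a) (f\<^sub>3(q/z\<^sup>3)/z - z f\<^sub>3(q z\<^sup>3))\<close> satisfy the same inhomogeneous equation under
  \<open>z \<mapsto> q z\<close>. Comparing poles and zeros, \<open>W - V\<close> is the theta quotient
  \<open>4 J\<^sub>6\<^sup>3 j(-z;q) / (j(z;q) j(q z\<^sup>3;q\<^sup>3) j(q\<^sup>2 z\<^sup>3;q\<^sup>3))\<close>. Its values at the sixth roots of unity (at \<open>z = -1\<close>
  its derivative) give the four identities by a discrete Fourier inversion.
\<close>

section \<open>Infinite products and theta functions\<close>

text \<open>The functions f(z; \<omega>^i Q) inside W have poles depending on i, whereas V lives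
  over the base q^3. The denominator of the theta quotient, \<open>theta_triple\<close>, depends on
  Q only through q = Q^3 and vanishes at all these poles. So K = (W - V) *
  \<open>theta_triple\<close> extends holomorphically to the punctured plane and no residues have to
  be matched. The inhomogeneous terms cancel in W - V, which leaves K(q z) = K(z) / z, the rule of
  j(-z;q). The constant is read off at z = 1, where V contributes nothing and W reduces to the
  component of 1/\<phi>(-Q) with exponents 2 modulo 3. Two sixth roots of unity are exceptional. At
  z = 1 the Appell sum has a vanishing denominator, but the rank series telescopes. At z = -1 the
  factor 1/(1 + z) meets a zero of W, so the value is a derivative; this is where the squared
  denominators of the theorem come from. Exponents such as n^2/2 and N(N+1)/2 occur on the way to
  the Appell sum, which is why that part works with r and q = r^2.\<close>

definition qpoch :: "complex \<Rightarrow> complex \<Rightarrow> nat \<Rightarrow> complex" where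
  "qpoch a q n = (\<Prod>k<n. 1 - a * q ^ k)"

lemma qpoch_0 [simp]: "qpoch a q 0 = 1"
  and qpoch_Suc: "qpoch a q (Suc n) = qpoch a q n * (1 - a * q ^ n)"
  by (simp_all add: qpoch_def)

lemma qpoch_Suc': "qpoch a q (Suc n) = (1 - a) * qpoch (a * q) q n"
  unfolding qpoch_def by (subst prod.lessThan_Suc_shift) (simp add: mult_ac)

lemma norm_mult_power_less_one:
  fixes a q :: complex
  assumes "norm a < 1" "norm q < 1" shows "norm (a * q ^ n) < 1"
proof -
  have "norm q ^ n \<le> 1" using assms by (intro power_le_one) auto
  then have "norm a * norm q ^ n \<le> norm a * 1" by (intro mult_left_mono) auto
  then show ?thesis using assms by (simp add: norm_mult norm_power)
qed

lemma mult_power_neq_one: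
  fixes a q :: complex
  assumes "norm a < 1" "norm q < 1" shows "a * q ^ n \<noteq> 1"
  using norm_mult_power_less_one[OF assms, of n] by auto

lemma power_neq_one:
  fixes q :: complex
  assumes "norm q < 1" "n > 0" shows "q ^ n \<noteq> 1"
proof -
  have "norm q ^ n < 1" using assms by (simp add: power_less_one_iff)
  then show ?thesis by (metis less_irrefl norm_one norm_power)
qed

lemma qpoch_nonzero: "norm a < 1 \<Longrightarrow> norm q < 1 \<Longrightarrow> qpoch a q n \<noteq> 0"
  using mult_power_neq_one[of a q] by (auto simp: qpoch_def)

lemma convergent_prod_qpoch:
  fixes a q :: complex
  assumes "norm q < 1" shows "convergent_prod (\<lambda>n. 1 - a * q ^ n)"
proof -
  have "summable (\<lambda>n. norm a * norm q ^ n)"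
    using assms by (intro summable_mult summable_geometric) simp
  moreover have "norm (1 - a * q ^ n - 1) = norm a * norm q ^ n" for n
    by (simp add: norm_mult norm_power)
  ultimately have "abs_convergent_prod (\<lambda>n. 1 - a * q ^ n)"
    by (simp only: abs_convergent_prod_conv_summable)
  then show ?thesis by (rule abs_convergent_prod_imp_convergent_prod)
qed

lemma qpoch_tendsto:
  assumes "norm q < 1" shows "qpoch a q \<longlonglongrightarrow> qpoch_inf a q"
proof -
  have "(\<lambda>n. \<Prod>i\<le>n. 1 - a * q ^ i) \<longlonglongrightarrow> qpoch_inf a q"
    unfolding qpoch_inf_def by (rule convergent_prod_LIMSEQ[OF convergent_prod_qpoch[OF assms]])
  then show ?thesis
    by (subst filterlim_sequentially_Suc[symmetric]) (simp add: qpoch_def lessThan_Suc_atMost)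
qed

lemma qpoch_inf_0 [simp]: "qpoch_inf 0 q = 1"
  by (simp add: qpoch_inf_def)

lemma qpoch_inf_eq_0_iff:
  assumes "norm q < 1" shows "qpoch_inf a q = 0 \<longleftrightarrow> (\<exists>n. a * q ^ n = 1)"
proof -
  have "(\<lambda>n. 1 - a * q ^ n) has_prod qpoch_inf a q"
    unfolding qpoch_inf_def by (rule convergent_prod_has_prod[OF convergent_prod_qpoch[OF assms]])
  from has_prod_eq_0_iff[OF this] show ?thesis by (auto simp: image_iff)
qed

lemma qpoch_inf_nonzero: "norm a < 1 \<Longrightarrow> norm q < 1 \<Longrightarrow> qpoch_inf a q \<noteq> 0"
  using mult_power_neq_one[of a q] by (auto simp: qpoch_inf_eq_0_iff)

lemma qpoch_inf_rec:
  assumes "norm q < 1" shows "qpoch_inf a q = (1 - a) * qpoch_inf (a * q) q"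
proof (rule LIMSEQ_unique)
  show "(\<lambda>n. qpoch a q (Suc n)) \<longlonglongrightarrow> qpoch_inf a q"
    using qpoch_tendsto[OF assms] by (simp add: filterlim_sequentially_Suc)
  show "(\<lambda>n. qpoch a q (Suc n)) \<longlonglongrightarrow> (1 - a) * qpoch_inf (a * q) q"
    unfolding qpoch_Suc' by (intro tendsto_intros qpoch_tendsto assms)
qed

lemma qpoch_inf_split:
  assumes "norm q < 1" shows "qpoch_inf a q = qpoch a q n * qpoch_inf (a * q ^ n) q"
proof (induction n)
  case (Suc n)
  then show ?case
    using qpoch_inf_rec[OF assms, of "a * q ^ n"] by (simp add: qpoch_Suc mult_ac)
qed simp

text \<open>The first N * m factors are grouped into N blocks of length m; collecting the j-th
  factor of every block gives a product in base q^m. Only then N tends to infinity.\<close>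

lemma qpoch_inf_multisect:
  assumes q: "norm q < 1" and m: "m > 0"
  shows "qpoch_inf a q = (\<Prod>j<m. qpoch_inf (a * q ^ j) (q ^ m))"
proof (rule LIMSEQ_unique)
  have qm: "norm (q ^ m) < 1" using assms by (simp add: norm_power power_less_one_iff)
  have eq: "qpoch a q (N * m) = (\<Prod>j<m. qpoch (a * q ^ j) (q ^ m) N)" for N
  proof -
    have "qpoch a q (N * m) = (\<Prod>i<N. \<Prod>k\<in>{i*m..<i*m+m}. 1 - a * q ^ k)"
      unfolding qpoch_def by (rule prod.nat_group[symmetric])
    also have "\<dots> = (\<Prod>i<N. \<Prod>j<m. 1 - a * q ^ j * (q ^ m) ^ i)"
    proof (rule prod.cong[OF refl])
      fix i
      have "(\<Prod>k\<in>{i*m..<i*m+m}. 1 - a * q ^ k) = (\<Prod>j\<in>{0..<m}. 1 - a * q ^ (j + i * m))"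
        using prod.shift_bounds_nat_ivl[of "\<lambda>k. 1 - a * q ^ k" 0 "i * m" m] by (simp add: add.commute)
      then show "(\<Prod>k\<in>{i*m..<i*m+m}. 1 - a * q ^ k) = (\<Prod>j<m. 1 - a * q ^ j * (q ^ m) ^ i)"
        by (simp add: power_add power_mult mult_ac atLeast0LessThan flip: power_mult)
    qed
    finally show ?thesis unfolding qpoch_def by (subst (asm) prod.swap)
  qed
  have "filterlim (\<lambda>N. N * m) at_top sequentially"
    using m by (simp add: mult_nat_right_at_top)
  from filterlim_compose[OF qpoch_tendsto[OF q, of a] this]
  show "(\<lambda>N. \<Prod>j<m. qpoch (a * q ^ j) (q ^ m) N) \<longlonglongrightarrow> qpoch_inf a q" by (simp add: eq)
  show "(\<lambda>N. \<Prod>j<m. qpoch (a * q ^ j) (q ^ m) N) \<longlonglongrightarrow> (\<Prod>j<m. qpoch_inf (a * q ^ j) (q ^ m))"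
    by (intro tendsto_prod qpoch_tendsto qm)
qed

lemma qpoch_inf_bisect:
  assumes "norm q < 1"
  shows "qpoch_inf a q = qpoch_inf a (q^2) * qpoch_inf (a * q) (q^2)"
  using qpoch_inf_multisect[OF assms, of 2 a] by (simp add: numeral_2_eq_2)

lemma qpoch_inf_trisect:
  assumes "norm q < 1"
  shows "qpoch_inf a q = qpoch_inf a (q^3) * qpoch_inf (a * q) (q^3) * qpoch_inf (a * q^2) (q^3)"
  using qpoch_inf_multisect[OF assms, of 3 a] by (simp add: numeral_3_eq_3 numeral_2_eq_2)

lemma qpoch_inf_uminus:
  assumes q: "norm q < 1"
  shows "qpoch_inf a q * qpoch_inf (- a) q = qpoch_inf (a^2) (q^2)"
proof (rule LIMSEQ_unique)
  have q2: "norm (q^2) < 1" using assms by (simp add: norm_power power_less_one_iff)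
  have "qpoch a q n * qpoch (- a) q n = qpoch (a^2) (q^2) n" for n
    unfolding qpoch_def prod.distrib[symmetric]
    by (intro prod.cong refl) (simp add: algebra_simps power2_eq_square flip: power_mult_distrib)
  then show "(\<lambda>n. qpoch (a^2) (q^2) n) \<longlonglongrightarrow> qpoch_inf a q * qpoch_inf (- a) q"
    using tendsto_mult[OF qpoch_tendsto[OF q, of a] qpoch_tendsto[OF q, of "- a"]] by simp
  show "(\<lambda>n. qpoch (a^2) (q^2) n) \<longlonglongrightarrow> qpoch_inf (a^2) (q^2)"
    by (rule qpoch_tendsto[OF q2])
qed

definition \<omega>\<^sub>3 :: complex where "\<omega>\<^sub>3 = cis (2 * pi / 3)"

lemma omega3_eq: "\<omega>\<^sub>3 = Complex (- 1 / 2) (sqrt 3 / 2)"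
  by (simp add: \<omega>\<^sub>3_def cis.code cos_120 sin_120)

lemma omega3_square: "\<omega>\<^sub>3 ^ 2 = - 1 - \<omega>\<^sub>3"
  by (simp add: omega3_eq complex_eq_iff power2_eq_square)

lemma omega3_cube [simp]: "\<omega>\<^sub>3 ^ 3 = 1"
  using omega3_square by (simp add: power3_eq_cube power2_eq_square) algebra

lemma norm_omega3 [simp]: "norm \<omega>\<^sub>3 = 1"
  by (simp add: \<omega>\<^sub>3_def)

lemma omega3_nonzero [simp]: "\<omega>\<^sub>3 \<noteq> 0"
  by (simp add: omega3_eq complex_eq_iff)

lemma qpoch_inf_cubic:
  assumes q: "norm q < 1"
  shows "qpoch_inf a q * qpoch_inf (\<omega>\<^sub>3 * a) q * qpoch_inf (\<omega>\<^sub>3^2 * a) q = qpoch_inf (a^3) (q^3)"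
proof (rule LIMSEQ_unique)
  have q3: "norm (q^3) < 1" using assms by (simp add: norm_power power_less_one_iff)
  have fac: "(1 - x) * (1 - \<omega>\<^sub>3 * x) * (1 - \<omega>\<^sub>3^2 * x) = 1 - x^3" for x
    using omega3_square omega3_cube by algebra
  have "qpoch a q n * qpoch (\<omega>\<^sub>3 * a) q n * qpoch (\<omega>\<^sub>3^2 * a) q n = qpoch (a^3) (q^3) n" for n
    unfolding qpoch_def prod.distrib[symmetric]
  proof (intro prod.cong refl)
    fix k
    show "(1 - a * q ^ k) * (1 - \<omega>\<^sub>3 * a * q ^ k) * (1 - \<omega>\<^sub>3^2 * a * q ^ k) = 1 - a^3 * (q^3) ^ k"
      using fac[of "a * q ^ k"] by (simp add: power_mult_distrib mult_ac flip: power_mult)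
  qed
  then show "(\<lambda>n. qpoch (a^3) (q^3) n) \<longlonglongrightarrow> qpoch_inf a q * qpoch_inf (\<omega>\<^sub>3 * a) q * qpoch_inf (\<omega>\<^sub>3^2 * a) q"
    using tendsto_mult[OF tendsto_mult[OF qpoch_tendsto[OF q, of a] qpoch_tendsto[OF q, of "\<omega>\<^sub>3 * a"]]
        qpoch_tendsto[OF q, of "\<omega>\<^sub>3^2 * a"]] by simp
  show "(\<lambda>n. qpoch (a^3) (q^3) n) \<longlonglongrightarrow> qpoch_inf (a^3) (q^3)"
    by (rule qpoch_tendsto[OF q3])
qed

text \<open>The partial products converge uniformly on every closed disc of radius 1, because there
  the factors differ from 1 by at most a geometric sequence; holomorphy is local.\<close>

lemma holomorphic_qpoch_inf:
  assumes q: "norm q < 1"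
  shows "(\<lambda>a. qpoch_inf a q) holomorphic_on A"
proof -
  have *: "(\<lambda>a. qpoch_inf a q) holomorphic_on ball z 1" for z
  proof -
    have "uniformly_convergent_on (cball z 1) (\<lambda>N a. \<Sum>n<N. norm (- a * q ^ n))"
    proof (rule Weierstrass_m_test'[where M = "\<lambda>n. (norm z + 1) * norm q ^ n"])
      fix n a assume "a \<in> cball z 1"
      then have "norm a \<le> norm z + 1"
        using norm_triangle_ineq2[of a z] by (simp add: dist_norm norm_minus_commute)
      then show "norm (norm (- a * q ^ n)) \<le> (norm z + 1) * norm q ^ n"
        by (simp add: norm_mult norm_power mult_right_mono)
    next
      show "summable (\<lambda>n. (norm z + 1) * norm q ^ n)"
        using q by (intro summable_mult summable_geometric) simp
    qed
    then have "uniformly_convergent_on (cball z 1) (\<lambda>N a. \<Prod>n<N. 1 + - a * q ^ n)"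
      by (intro uniformly_convergent_on_prod continuous_intros) auto
    then obtain l where l: "uniform_limit (cball z 1) (\<lambda>N a. qpoch a q N) l sequentially"
      by (auto simp: uniformly_convergent_on_def qpoch_def)
    have "l a = qpoch_inf a q" if "a \<in> cball z 1" for a
      using tendsto_uniform_limitI[OF l that] qpoch_tendsto[OF q, of a] LIMSEQ_unique by blast
    then have ul: "uniform_limit (cball z 1) (\<lambda>N a. qpoch a q N) (\<lambda>a. qpoch_inf a q) sequentially"
      using l uniform_limit_cong'[of "cball z 1" "\<lambda>N a. qpoch a q N" "\<lambda>N a. qpoch a q N" l "\<lambda>a. qpoch_inf a q"]
      by simp
    show ?thesis
    proof (rule holomorphic_uniform_limit[OF _ ul])
      show "\<forall>\<^sub>F n in sequentially. continuous_on (cball z 1) (\<lambda>a. qpoch a q n) \<and>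
              (\<lambda>a. qpoch a q n) holomorphic_on ball z 1"
        unfolding qpoch_def by (intro always_eventually allI conjI continuous_intros holomorphic_intros)
    qed auto
  qed
  have "(\<lambda>a. qpoch_inf a q) holomorphic_on UNIV"
  proof (subst holomorphic_on_open, simp, intro ballI)
    fix z
    show "\<exists>f'. ((\<lambda>a. qpoch_inf a q) has_field_derivative f') (at z)"
      using *[of z] by (subst (asm) holomorphic_on_open) auto
  qed
  then show ?thesis by (rule holomorphic_on_subset) auto
qed

lemma holomorphic_qpoch_inf' [holomorphic_intros]:
  assumes "norm q < 1" "f holomorphic_on A"
  shows "(\<lambda>z. qpoch_inf (f z) q) holomorphic_on A"
  using holomorphic_on_compose[OF assms(2) holomorphic_qpoch_inf[OF assms(1)]] by (simp add: o_def)

text \<open>\<open>theta_j\<close> with its factor 1 - z removed, so that theta quotients with a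
  zero at z = 1 (or, through \<open>theta0 (- z) q\<close>, at z = -1) can still be evaluated
  there.\<close>

definition theta0 :: "complex \<Rightarrow> complex \<Rightarrow> complex" where
  "theta0 z q = qpoch_inf (z * q) q * qpoch_inf (q / z) q * qpoch_inf q q"

lemma theta_j_eq_theta0: "norm q < 1 \<Longrightarrow> theta_j z q = (1 - z) * theta0 z q"
  unfolding theta_j_def theta0_def by (subst qpoch_inf_rec) (auto simp: mult_ac)

lemma theta0_1: "theta0 1 q = qpoch_inf q q ^ 3"
  by (simp add: theta0_def power3_eq_cube)

lemma theta_j_1 [simp]: "norm q < 1 \<Longrightarrow> theta_j 1 q = 0"
  by (simp add: theta_j_eq_theta0)

lemma theta_j_reflect: "z \<noteq> 0 \<Longrightarrow> q \<noteq> 0 \<Longrightarrow> theta_j (q / z) q = theta_j z q"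
  by (simp add: theta_j_def mult_ac)

lemma theta_j_shift:
  assumes "norm q < 1" "q \<noteq> 0" "z \<noteq> 0"
  shows "theta_j (q * z) q = - theta_j z q / z"
proof -
  have "theta_j (q * z) q = qpoch_inf (z * q) q * qpoch_inf (1 / z) q * qpoch_inf q q"
    using assms by (simp add: theta_j_def mult_ac)
  also have "qpoch_inf (1 / z) q = (1 - 1 / z) * qpoch_inf (q / z) q"
    using qpoch_inf_rec[OF assms(1), of "1 / z"] by simp
  finally show ?thesis
    using assms by (simp add: theta_j_eq_theta0 theta0_def field_simps)
qed

lemma theta_j_inverse:
  assumes "norm q < 1" "q \<noteq> 0" "z \<noteq> 0"
  shows "theta_j (1 / z) q = - theta_j z q / z"
  using theta_j_shift[OF assms] theta_j_reflect[of "1/z" q] assms by (simp add: mult_ac)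

text \<open>The factor \<open>qpoch_inf z q\<close> contributes the zeros q^(-n) with n \<ge> 0, the
  factor \<open>qpoch_inf (q / z) q\<close> the zeros q^(n+1), and \<open>qpoch_inf q q\<close>
  never vanishes. The integer power merges the two families.\<close>

lemma theta_j_eq_0_iff:
  assumes "norm q < 1" "q \<noteq> 0" "z \<noteq> 0"
  shows "theta_j z q = 0 \<longleftrightarrow> (\<exists>n::int. z * q powi n = 1)"
proof
  assume "theta_j z q = 0"
  then consider n where "z * q ^ n = 1" | n where "q / z * q ^ n = 1" | n where "q * q ^ n = 1"
    using assms(1) by (auto simp: theta_j_def qpoch_inf_eq_0_iff)
  then show "\<exists>n::int. z * q powi n = 1"
  proof cases
    case 1 then show ?thesis by (intro exI[of _ "int n"]) simp
  next
    case 2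
    then have "z = q ^ Suc n" using assms by (simp add: field_simps)
    then have "z * q powi (- int (Suc n)) = 1"
      using assms unfolding power_int_minus power_int_of_nat by (simp add: field_simps)
    then show ?thesis by blast
  next
    case 3 then show ?thesis using mult_power_neq_one[of q q n] assms by simp
  qed
next
  assume "\<exists>n::int. z * q powi n = 1"
  then obtain n :: int where n: "z * q powi n = 1" by blast
  show "theta_j z q = 0"
  proof (cases "n \<ge> 0")
    case True
    then have "z * q ^ nat n = 1" using n by (simp add: power_int_nonneg_exp)
    then have "qpoch_inf z q = 0" using assms(1) by (auto simp: qpoch_inf_eq_0_iff)
    then show ?thesis by (simp add: theta_j_def)
  next
    case False
    \<comment> \<open>The zeros of the second factor start at z = q rather than z = 1, hence the
      shift by one.\<close>
    define m where "m = nat (- n - 1)"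
    have "n = - int (Suc m)" using False by (simp add: m_def)
    then have "z * inverse (q ^ Suc m) = 1"
      using n by (simp only: power_int_minus power_int_of_nat)
    then have "q / z * q ^ m = 1" using assms by (simp add: field_simps)
    then have "qpoch_inf (q / z) q = 0" using assms(1) by (auto simp: qpoch_inf_eq_0_iff)
    then show ?thesis by (simp add: theta_j_def)
  qed
qed

lemma holomorphic_theta_j [holomorphic_intros]:
  assumes "norm q < 1" "f holomorphic_on A" "\<And>z. z \<in> A \<Longrightarrow> f z \<noteq> 0"
  shows "(\<lambda>z. theta_j (f z) q) holomorphic_on A"
  unfolding theta_j_def by (intro holomorphic_intros assms) (use assms in auto)

lemma holomorphic_theta0 [holomorphic_intros]:
  assumes "norm q < 1" "f holomorphic_on A" "\<And>z. z \<in> A \<Longrightarrow> f z \<noteq> 0"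
  shows "(\<lambda>z. theta0 (f z) q) holomorphic_on A"
  unfolding theta0_def by (intro holomorphic_intros assms) (use assms in auto)

section \<open>Sums over the integers and the Jacobi triple product\<close>

lemma has_sum_int_shift:
  fixes f :: "int \<Rightarrow> 'a :: {topological_comm_monoid_add, t2_space}"
  shows "((\<lambda>n. f (n + k)) has_sum S) UNIV \<longleftrightarrow> (f has_sum S) UNIV"
  by (rule has_sum_reindex_bij_witness[where i = "\<lambda>n. n - k" and j = "\<lambda>n. n + k"]) auto

lemma has_sum_int_uminus:
  fixes f :: "int \<Rightarrow> 'a :: {topological_comm_monoid_add, t2_space}"
  shows "((\<lambda>n. f (- n)) has_sum S) UNIV \<longleftrightarrow> (f has_sum S) UNIV"
  by (rule has_sum_reindex_bij_witness[where i = uminus and j = uminus]) auto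

lemma summable_on_intI:
  fixes f :: "int \<Rightarrow> real"
  assumes "summable (\<lambda>k. f (int k))" "summable (\<lambda>k. f (- int k))" "\<And>n. f n \<ge> 0"
  shows "f summable_on UNIV"
proof -
  have "f \<circ> int summable_on UNIV" "f \<circ> (\<lambda>k. - int k) summable_on UNIV"
    using assms by (auto simp: o_def summable_on_UNIV_nonneg_real_iff)
  then have "f summable_on range int" "f summable_on range (\<lambda>k. - int k)"
    by (auto simp: summable_on_reindex inj_on_def)
  then have "f summable_on (range int \<union> range (\<lambda>k. - int k))"
    by (rule summable_on_union)
  moreover have "range int \<union> range (\<lambda>k. - int k) = UNIV"
    by (auto simp: image_iff) (metis int_cases2)
  ultimately show ?thesis by simp
qed

lemma summable_power_square:
  fixes s t :: real
  assumes "0 \<le> s" "s < 1" "0 \<le> t"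
  shows "summable (\<lambda>k. s ^ (k^2) * t ^ k)"
proof -
  have "(\<lambda>k. s ^ k * t) \<longlonglongrightarrow> 0 * t"
    by (intro tendsto_intros LIMSEQ_power_zero) (use assms in auto)
  then have "\<forall>\<^sub>F k in sequentially. s ^ k * t < 1/2"
    by (rule order_tendstoD) simp
  then have "\<forall>\<^sub>F k in sequentially. norm (s ^ (k^2) * t ^ k) \<le> (1/2) ^ k"
  proof eventually_elim
    case (elim k)
    have "s ^ (k^2) * t ^ k = (s ^ k * t) ^ k"
      by (simp add: power_mult_distrib power2_eq_square flip: power_mult)
    also have "\<dots> \<le> (1/2) ^ k"
      using elim assms by (intro power_mono) auto
    finally show ?case using assms by simp
  qed
  then show ?thesis by (rule summable_comparison_test_ev) simp
qed

lemma gauss_summable: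
  fixes r z :: complex
  assumes "0 < norm r" "norm r < 1" "z \<noteq> 0"
  shows "(\<lambda>n::int. norm (r powi n\<^sup>2 * z powi n)) summable_on UNIV"
proof (rule summable_on_intI)
  have 1: "norm (r powi (int k)\<^sup>2 * z powi int k) = norm r ^ (k^2) * norm z ^ k" for k
    using assms by (simp add: norm_mult norm_power power_int_nonneg_exp nat_power_eq)
  have 2: "norm (r powi (- int k)\<^sup>2 * z powi (- int k)) = norm r ^ (k^2) * (1 / norm z) ^ k" for k
    using assms by (simp add: norm_mult norm_power power_int_nonneg_exp nat_power_eq power_int_minus
        norm_inverse divide_inverse power_inverse)
  show "summable (\<lambda>k. norm (r powi (int k)\<^sup>2 * z powi int k))"
    unfolding 1 by (rule summable_power_square) (use assms in auto)
  show "summable (\<lambda>k. norm (r powi (- int k)\<^sup>2 * z powi (- int k)))"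
    unfolding 2 by (rule summable_power_square) (use assms in auto)
qed auto

text \<open>Tannery's theorem for series over the naturals, transported along the bijection
  \<open>int_decode\<close>; the majorant makes the unordered and the ordered sums agree.\<close>

lemma infsum_dominated_convergence:
  fixes f :: "nat \<Rightarrow> int \<Rightarrow> complex"
  assumes lim: "\<And>n. (\<lambda>N. f N n) \<longlonglongrightarrow> g n"
    and bound: "\<And>N n. norm (f N n) \<le> M n"
    and M: "M summable_on UNIV"
  shows "(\<lambda>N. \<Sum>\<^sub>\<infinity>n. f N n) \<longlonglongrightarrow> (\<Sum>\<^sub>\<infinity>n. g n)"
proof -
  have Mpos: "M n \<ge> 0" for n using bound[of 0 n] by (meson norm_ge_zero order_trans)
  have gb: "norm (g n) \<le> M n" for n
    by (rule Lim_bounded[OF tendsto_norm[OF lim]]) (use bound in auto)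
  have eq: "(\<Sum>\<^sub>\<infinity>n. h n) = (\<Sum>k. h (int_decode k))" if "\<And>n. norm (h n) \<le> M n" for h :: "int \<Rightarrow> complex"
  proof -
    have "(\<lambda>n. norm (h n)) summable_on UNIV"
      by (rule Infinite_Sum.abs_summable_on_comparison_test'[OF M]) (use that in auto)
    then have "h summable_on UNIV" by (rule abs_summable_summable)
    then have "(\<lambda>k. h (int_decode k)) summable_on UNIV"
      using summable_on_reindex_bij_betw[OF bij_int_decode, of h] by simp
    then have "(\<lambda>k. h (int_decode k)) sums (\<Sum>\<^sub>\<infinity>k. h (int_decode k))"
      by (intro has_sum_imp_sums has_sum_infsum)
    then show ?thesis
      using infsum_reindex_bij_betw[OF bij_int_decode, of h] by (simp add: sums_iff)
  qed
  have "(\<lambda>k. M (int_decode k)) summable_on UNIV"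
    using summable_on_reindex_bij_betw[OF bij_int_decode, of M] M by simp
  then have "summable (\<lambda>k. M (int_decode k))" by (rule summable_on_imp_summable)
  then have "(\<lambda>N. \<Sum>k. f N (int_decode k)) \<longlonglongrightarrow> (\<Sum>k. g (int_decode k))"
    by (intro tannerys_theorem[where M = "\<lambda>k. M (int_decode k)", THEN conjunct2, THEN conjunct2])
       (use lim bound in \<open>auto simp: case_prod_unfold\<close>)
  then show ?thesis
    by (simp add: eq[OF bound] eq[OF gb])
qed

text \<open>The convention \<open>1/(q;q)\<^sub>k = 0\<close> for \<open>k < 0\<close> makes the recurrence below hold for all integers,
  so that finite sums can be treated as sums over \<open>\<int>\<close>.\<close>

definition inv_qfact :: "complex \<Rightarrow> int \<Rightarrow> complex" where
  "inv_qfact q k = (if k < 0 then 0 else 1 / qpoch q q (nat k))"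

lemma inv_qfact_rec:
  assumes "norm q < 1" "q \<noteq> 0"
  shows "inv_qfact q (k - 1) = (1 - q powi k) * inv_qfact q k"
proof -
  consider "k < 0" | "k = 0" | "k > 0" by linarith
  then show ?thesis
  proof cases
    case 3
    define m where "m = nat (k - 1)"
    have k: "k = int (Suc m)" using 3 by (simp add: m_def)
    have nz: "qpoch q q m \<noteq> 0" "qpoch q q (Suc m) \<noteq> 0" using qpoch_nonzero[OF assms(1) assms(1)] by blast+
    have "1 - q powi k = 1 - q * q ^ m" unfolding k power_int_of_nat by simp
    moreover have "inv_qfact q (k - 1) = 1 / qpoch q q m" "inv_qfact q k = 1 / qpoch q q (Suc m)"
      by (simp_all add: inv_qfact_def k nat_add_distrib)
    ultimately show ?thesis using nz by (simp add: qpoch_Suc)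
  qed (auto simp: inv_qfact_def)
qed

lemma inv_qfact_bounded:
  assumes "norm q < 1"
  obtains B where "B > 0" "\<And>k. norm (inv_qfact q k) \<le> B"
proof -
  have "(\<lambda>n. 1 / qpoch q q n) \<longlonglongrightarrow> 1 / qpoch_inf q q"
    by (intro tendsto_intros qpoch_tendsto qpoch_inf_nonzero assms)
  then have "Bseq (\<lambda>n. 1 / qpoch q q n)" by (intro convergent_imp_Bseq) (auto simp: convergent_def)
  then obtain B where "B > 0" "\<And>n. norm (1 / qpoch q q n) \<le> B" by (auto elim: BseqE)
  then show ?thesis by (intro that[of B]) (auto simp: inv_qfact_def)
qed

lemma inv_qfact_tendsto:
  assumes "norm q < 1"
  shows "(\<lambda>N. inv_qfact q (int N + k)) \<longlonglongrightarrow> 1 / qpoch_inf q q"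
proof -
  have "filterlim (\<lambda>N. nat (int N + k)) at_top sequentially"
    unfolding filterlim_at_top
  proof
    fix Z :: nat
    show "\<forall>\<^sub>F N in sequentially. Z \<le> nat (int N + k)"
      using eventually_ge_at_top[of "Z + nat \<bar>k\<bar>"] by eventually_elim linarith
  qed
  from filterlim_compose[OF qpoch_tendsto[OF assms] this]
  have "(\<lambda>N. 1 / qpoch q q (nat (int N + k))) \<longlonglongrightarrow> 1 / qpoch_inf q q"
    by (intro tendsto_intros qpoch_inf_nonzero assms)
  moreover have "\<forall>\<^sub>F N in sequentially. inv_qfact q (int N + k) = 1 / qpoch q q (nat (int N + k))"
    using eventually_ge_at_top[of "nat \<bar>k\<bar>"] by eventually_elim (auto simp: inv_qfact_def)
  ultimately show ?thesis by (simp add: filterlim_cong)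
qed

text \<open>With q = r^2 this is the coefficient of z^n in the finite triple product (r z;q)_N
  (r/z;q)_N / (q;q)_{2N}; it vanishes for |n| > N. The same numbers return in the partial fractions
  behind the Appell sum.\<close>

definition jtp_coeff :: "complex \<Rightarrow> nat \<Rightarrow> int \<Rightarrow> complex" where
  "jtp_coeff r N n = (-1) powi n * r powi n\<^sup>2 * inv_qfact (r^2) (int N - n) * inv_qfact (r^2) (int N + n)"

lemma power_int_square_succ:
  fixes r :: complex
  assumes "r \<noteq> 0"
  shows "r powi (n + 1)\<^sup>2 = r powi n\<^sup>2 * (r^2) powi n * r"
    and "r powi (n - 1)\<^sup>2 = r powi n\<^sup>2 / (r^2) powi n * r"
proof -
  have "(n + 1)\<^sup>2 = n\<^sup>2 + 2 * n + 1" "(n - 1)\<^sup>2 = n\<^sup>2 + - (2 * n) + 1" by (simp_all add: power2_eq_square algebra_simps)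
  note e = this
  show "r powi (n + 1)\<^sup>2 = r powi n\<^sup>2 * (r^2) powi n * r"
    unfolding e(1) using assms by (simp add: power_int_add power_int_power mult_ac)
  show "r powi (n - 1)\<^sup>2 = r powi n\<^sup>2 / (r^2) powi n * r"
    unfolding e(2) using assms
    by (simp only: power_int_add simp_thms power_int_minus power_int_power) (simp add: divide_inverse)
qed

text \<open>Every reciprocal factorial is expressed by those of level N + 1 through
  \<open>inv_qfact_rec\<close>, which reduces both claims to rational identities in x = q^n and A =
  q^(N+1). The first relation serves \<open>partial_fractions\<close>; the second is the coefficient
  form of multiplying by (1 - r z q^N)(1 - r q^N / z) and drives \<open>finite_jtp\<close>.\<close>

lemma jtp_coeff_Suc:
  fixes r :: complex
  assumes r: "r \<noteq> 0" "norm r < 1"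
  defines "q \<equiv> r^2"
  shows "jtp_coeff r N n = (1 - q ^ (N + 1) / q powi n) * (1 - q ^ (N + 1) * q powi n) * jtp_coeff r (Suc N) n"
    and "(1 - q ^ (2 * N + 1)) * (1 - q ^ (2 * N + 2)) * jtp_coeff r (Suc N) n =
      (1 + q ^ (2 * N + 1)) * jtp_coeff r N n - r * q ^ N * jtp_coeff r N (n - 1) - r * q ^ N * jtp_coeff r N (n + 1)"
proof -
  have q: "q \<noteq> 0" "norm q < 1" using r by (auto simp: q_def norm_power power_less_one_iff)
  define X Y x A s where "X = inv_qfact q (int N + 1 - n)" and "Y = inv_qfact q (int N + 1 + n)"
    and "x = q powi n" and "A = q ^ (N + 1)" and "s = (-1) powi n * r powi n\<^sup>2"
  have x: "x \<noteq> 0" using q by (simp add: x_def)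
  have A': "q powi (int N + 1) = A" by (simp add: A_def power_int_add q)
  have p: "q powi (int N + 1 - n) = A / x" "q powi (int N + 1 + n) = A * x"
    "q powi (int N - n) = A / (q * x)" "q powi (int N + n) = A * x / q"
    using q by (simp_all add: power_int_add power_int_diff A_def x_def field_simps)
  have e: "int N + 1 - n - 1 = int N - n" "int N + 1 + n - 1 = int N + n" by simp_all
  have i1: "inv_qfact q (int N - n) = (1 - A / x) * X"
    using inv_qfact_rec[OF q(2,1), of "int N + 1 - n"] by (simp only: e X_def p)
  have i2: "inv_qfact q (int N + n) = (1 - A * x) * Y"
    using inv_qfact_rec[OF q(2,1), of "int N + 1 + n"] by (simp only: e Y_def p)
  have i3: "inv_qfact q (int N - n - 1) = (1 - A / (q * x)) * (1 - A / x) * X"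
    using inv_qfact_rec[OF q(2,1), of "int N - n"] by (simp only: i1 p mult.assoc)
  have i4: "inv_qfact q (int N + n - 1) = (1 - A * x / q) * (1 - A * x) * Y"
    using inv_qfact_rec[OF q(2,1), of "int N + n"] by (simp only: i2 p mult.assoc)
  have c0: "jtp_coeff r (Suc N) n = s * X * Y"
    by (simp add: jtp_coeff_def s_def X_def Y_def q_def algebra_simps)
  have c1: "jtp_coeff r N n = s * ((1 - A / x) * X) * ((1 - A * x) * Y)"
    by (simp add: jtp_coeff_def s_def i1 i2 flip: q_def)
  have c2: "jtp_coeff r N (n - 1) = - (s * r / x) * X * ((1 - A * x / q) * (1 - A * x) * Y)"
  proof -
    have "jtp_coeff r N (n - 1) = (-1) powi (n - 1) * r powi (n - 1)\<^sup>2 * X * inv_qfact q (int N + n - 1)"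
      by (simp add: jtp_coeff_def X_def q_def algebra_simps)
    also have "(-1) powi (n - 1) * r powi (n - 1)\<^sup>2 = - (s * r / x)"
      using r by (simp add: power_int_square_succ s_def x_def q_def power_int_diff)
    finally show ?thesis unfolding i4 by simp
  qed
  have c3: "jtp_coeff r N (n + 1) = - (s * r * x) * ((1 - A / (q * x)) * (1 - A / x) * X) * Y"
  proof -
    have "jtp_coeff r N (n + 1) = (-1) powi (n + 1) * r powi (n + 1)\<^sup>2 * inv_qfact q (int N - n - 1) * Y"
      by (simp add: jtp_coeff_def Y_def q_def algebra_simps)
    also have "(-1) powi (n + 1) * r powi (n + 1)\<^sup>2 = - (s * r * x)"
      using r by (simp add: power_int_square_succ s_def x_def q_def power_int_add)
    finally show ?thesis unfolding i3 by simp
  qed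
  show "jtp_coeff r N n = (1 - q ^ (N + 1) / q powi n) * (1 - q ^ (N + 1) * q powi n) * jtp_coeff r (Suc N) n"
    unfolding c0 c1 by (simp add: A_def x_def)
  have pw: "q ^ (2 * N + 1) = A^2 / q" "q ^ (2 * N + 2) = A^2" "r * q ^ N = r * A / q"
  proof -
    have "q ^ (2 * N) = q ^ N * q ^ N" by (simp add: mult_2 power_add)
    then show "q ^ (2 * N + 1) = A^2 / q" "q ^ (2 * N + 2) = A^2" "r * q ^ N = r * A / q"
      using q by (simp_all add: A_def power2_eq_square)
  qed
  have rr: "r * r = q" by (simp add: q_def power2_eq_square)
  have "(1 - A^2 / q) * (1 - A^2) = (1 + A^2 / q) * (1 - A / x) * (1 - A * x)
     + (A / x) * (1 - A * x / q) * (1 - A * x) + A * x * (1 - A / (q * x)) * (1 - A / x)"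
    using q x by (simp add: field_simps) algebra
  \<comment> \<open>The factor r * r / q = 1 is inserted because each neighbouring coefficient
    carries one r and the recurrence supplies the other.\<close>
  also have "\<dots> = (1 + A^2 / q) * (1 - A / x) * (1 - A * x)
     + (r * r / q) * (A / x) * (1 - A * x / q) * (1 - A * x) + (r * r / q) * A * x * (1 - A / (q * x)) * (1 - A / x)"
    using q by (simp add: rr)
  also have "\<dots> * (s * X * Y) = (1 + A^2 / q) * (s * ((1 - A / x) * X) * ((1 - A * x) * Y))
      - r * A / q * (- (s * r / x) * X * ((1 - A * x / q) * (1 - A * x) * Y))
      - r * A / q * (- (s * r * x) * ((1 - A / (q * x)) * (1 - A / x) * X) * Y)"
    by (simp only: divide_inverse inverse_mult_distrib) algebra
  finally have "(1 - A^2 / q) * (1 - A^2) * (s * X * Y) = (1 + A^2 / q) * (s * ((1 - A / x) * X) * ((1 - A * x) * Y))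
      - r * A / q * (- (s * r / x) * X * ((1 - A * x / q) * (1 - A * x) * Y))
      - r * A / q * (- (s * r * x) * ((1 - A / (q * x)) * (1 - A / x) * X) * Y)" .
  then show "(1 - q ^ (2 * N + 1)) * (1 - q ^ (2 * N + 2)) * jtp_coeff r (Suc N) n =
      (1 + q ^ (2 * N + 1)) * jtp_coeff r N n - r * q ^ N * jtp_coeff r N (n - 1) - r * q ^ N * jtp_coeff r N (n + 1)"
    unfolding pw c0 c1 c2 c3 .
qed

text \<open>Induction on N: the two new factors multiply to 1 + q^(2N+1) - r q^N (z + 1/z), whose
  terms shift the summation index by 0, 1 and -1. The sum has finite support but runs over all
  integers, so that these shifts are mere reindexings.\<close>

lemma finite_jtp:
  fixes r z :: complex
  assumes r: "r \<noteq> 0" "norm r < 1" and z: "z \<noteq> 0"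
  shows "((\<lambda>n. jtp_coeff r N n * z powi n) has_sum
           qpoch (r * z) (r^2) N * qpoch (r / z) (r^2) N / qpoch (r^2) (r^2) (2 * N)) UNIV"
proof (induction N)
  case 0
  show ?case
  proof (rule has_sum_finite_neutralI[of "{0}"])
    fix n :: int assume "n \<in> UNIV - {0}"
    then show "jtp_coeff r 0 n * z powi n = 0" by (auto simp: jtp_coeff_def inv_qfact_def)
  qed (auto simp: jtp_coeff_def inv_qfact_def)
next
  case (Suc N)
  define q where "q = r^2"
  have q: "q \<noteq> 0" "norm q < 1" using r by (auto simp: q_def norm_power power_less_one_iff)
  define S where "S = qpoch (r * z) q N * qpoch (r / z) q N / qpoch q q (2 * N)"
  define E where "E = (1 - q ^ (2 * N + 1)) * (1 - q ^ (2 * N + 2))"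
  have E: "E \<noteq> 0" using power_neq_one[OF q(2), of "2*N+1"] power_neq_one[OF q(2), of "2*N+2"] unfolding E_def by auto
  have IH: "((\<lambda>n. jtp_coeff r N n * z powi n) has_sum S) UNIV"
    using Suc.IH by (simp add: S_def q_def)
  have s1: "((\<lambda>n. jtp_coeff r N (n - 1) * z powi (n - 1)) has_sum S) UNIV"
    using IH has_sum_int_shift[of "\<lambda>n. jtp_coeff r N n * z powi n" "-1" S] by simp
  have s2: "((\<lambda>n. jtp_coeff r N (n + 1) * z powi (n + 1)) has_sum S) UNIV"
    using IH has_sum_int_shift[of "\<lambda>n. jtp_coeff r N n * z powi n" "1" S] by simp
  have "((\<lambda>n. (1 + q ^ (2 * N + 1)) / E * (jtp_coeff r N n * z powi n)
          + (- (r * q ^ N * z / E) * (jtp_coeff r N (n - 1) * z powi (n - 1))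
          + - (r * q ^ N / (z * E)) * (jtp_coeff r N (n + 1) * z powi (n + 1)))) has_sum
         ((1 + q ^ (2 * N + 1)) / E * S + (- (r * q ^ N * z / E) * S + - (r * q ^ N / (z * E)) * S))) UNIV"
    by (intro has_sum_add has_sum_cmult_right IH s1 s2)
  also have "(\<lambda>n. (1 + q ^ (2 * N + 1)) / E * (jtp_coeff r N n * z powi n)
          + (- (r * q ^ N * z / E) * (jtp_coeff r N (n - 1) * z powi (n - 1))
          + - (r * q ^ N / (z * E)) * (jtp_coeff r N (n + 1) * z powi (n + 1))))
      = (\<lambda>n. jtp_coeff r (Suc N) n * z powi n)"
  proof
    fix n :: int
    have "(1 + q ^ (2 * N + 1)) / E * (jtp_coeff r N n * z powi n)
          + (- (r * q ^ N * z / E) * (jtp_coeff r N (n - 1) * z powi (n - 1))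
          + - (r * q ^ N / (z * E)) * (jtp_coeff r N (n + 1) * z powi (n + 1)))
       = ((1 + q ^ (2 * N + 1)) * jtp_coeff r N n - r * q ^ N * jtp_coeff r N (n - 1) - r * q ^ N * jtp_coeff r N (n + 1))
          * z powi n / E"
      using z E by (simp add: power_int_add power_int_diff field_simps)
    also have "\<dots> = (E * jtp_coeff r (Suc N) n) * z powi n / E"
      unfolding E_def q_def by (subst jtp_coeff_Suc(2)[OF r, symmetric]) simp
    finally show "(1 + q ^ (2 * N + 1)) / E * (jtp_coeff r N n * z powi n)
          + (- (r * q ^ N * z / E) * (jtp_coeff r N (n - 1) * z powi (n - 1))
          + - (r * q ^ N / (z * E)) * (jtp_coeff r N (n + 1) * z powi (n + 1))) = jtp_coeff r (Suc N) n * z powi n"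
      using E by simp
  qed
  also have "(1 + q ^ (2 * N + 1)) / E * S + (- (r * q ^ N * z / E) * S + - (r * q ^ N / (z * E)) * S)
      = (1 + q ^ (2 * N + 1) - r * q ^ N * z - r * q ^ N / z) * S / E"
    using z E by (simp add: field_simps)
  also have "1 + q ^ (2 * N + 1) - r * q ^ N * z - r * q ^ N / z = (1 - r * z * q ^ N) * (1 - r / z * q ^ N)"
  proof -
    have "q ^ (2 * N + 1) = r * q ^ N * (r * q ^ N)"
      by (simp add: q_def power2_eq_square power_add mult_2 power_mult_distrib)
    then show ?thesis using z by (simp add: field_simps)
  qed
  also have "(1 - r * z * q ^ N) * (1 - r / z * q ^ N) * S / E =
      qpoch (r * z) q (Suc N) * qpoch (r / z) q (Suc N) / qpoch q q (2 * Suc N)"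
  proof -
    have "2 * Suc N = Suc (Suc (2 * N))" by simp
    then have "qpoch q q (2 * Suc N) = qpoch q q (2 * N) * E"
      by (simp only: qpoch_Suc E_def) simp
    then show ?thesis unfolding S_def qpoch_Suc by (simp only: times_divide_eq_left times_divide_eq_right divide_divide_eq_left mult_ac)
  qed
  finally show ?case by (simp add: q_def)
qed

lemma jtp_coeff_bound:
  fixes r :: complex
  assumes "r \<noteq> 0" "norm r < 1"
  obtains B where "B > 0" "\<And>N n. norm (jtp_coeff r N n) \<le> B * norm (r powi n\<^sup>2)"
proof -
  have q: "norm (r^2) < 1" using assms by (auto simp: norm_power power_less_one_iff)
  obtain B where B: "B > 0" "\<And>k. norm (inv_qfact (r^2) k) \<le> B" using inv_qfact_bounded[OF q] by blast
  show ?thesis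
  proof (rule that[of "B * B"])
    fix N n
    have "norm (inv_qfact (r^2) (int N - n)) * norm (inv_qfact (r^2) (int N + n)) \<le> B * B"
      using B by (intro mult_mono) auto
    then have "norm (r powi n\<^sup>2) * (norm (inv_qfact (r^2) (int N - n)) * norm (inv_qfact (r^2) (int N + n)))
        \<le> norm (r powi n\<^sup>2) * (B * B)" by (intro mult_left_mono) auto
    then show "norm (jtp_coeff r N n) \<le> B * B * norm (r powi n\<^sup>2)"
      by (simp add: jtp_coeff_def norm_mult norm_power_int mult_ac)
  qed (use B in auto)
qed

text \<open>\<open>finite_jtp\<close> as N tends to infinity: with q = r^2 each coefficient tends to
  (-1)^n r^(n^2) / (q;q)_\<infinity>^2, and a constant multiple of |r|^(n^2) dominates it for all
  N.\<close>

theorem jacobi_triple_product: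
  fixes r z :: complex
  assumes r: "r \<noteq> 0" "norm r < 1" and z: "z \<noteq> 0"
  shows "((\<lambda>n. (-1) powi n * r powi n\<^sup>2 * z powi n) has_sum theta_j (r * z) (r^2)) UNIV"
proof -
  define q where "q = r^2"
  have q: "q \<noteq> 0" "norm q < 1" using r by (auto simp: q_def norm_power power_less_one_iff)
  obtain B where B: "B > 0" "\<And>N n. norm (jtp_coeff r N n) \<le> B * norm (r powi n\<^sup>2)"
    using jtp_coeff_bound[OF r] by blast
  have gs: "(\<lambda>n::int. norm (r powi n\<^sup>2 * z powi n)) summable_on UNIV"
    using gauss_summable[of r z] r z by simp
  have lim: "(\<lambda>N. jtp_coeff r N n * z powi n) \<longlonglongrightarrow> (-1) powi n * r powi n\<^sup>2 * z powi n / qpoch_inf q q ^ 2" for n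
  proof -
    have "(\<lambda>N. (-1) powi n * r powi n\<^sup>2 * inv_qfact q (int N + - n) * inv_qfact q (int N + n) * z powi n)
      \<longlonglongrightarrow> (-1) powi n * r powi n\<^sup>2 * (1 / qpoch_inf q q) * (1 / qpoch_inf q q) * z powi n"
      by (intro tendsto_intros inv_qfact_tendsto q)
    then show ?thesis by (simp add: jtp_coeff_def q_def power2_eq_square)
  qed
  have "(\<lambda>N. \<Sum>\<^sub>\<infinity>n. jtp_coeff r N n * z powi n) \<longlonglongrightarrow> (\<Sum>\<^sub>\<infinity>n. (-1) powi n * r powi n\<^sup>2 * z powi n / qpoch_inf q q ^ 2)"
  proof (rule infsum_dominated_convergence[OF lim])
    show "norm (jtp_coeff r N n * z powi n) \<le> B * norm (r powi n\<^sup>2 * z powi n)" for N n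
      using mult_right_mono[OF B(2)[of N n], of "norm (z powi n)"] by (simp add: norm_mult mult_ac)
    show "(\<lambda>n. B * norm (r powi n\<^sup>2 * z powi n)) summable_on UNIV"
      by (intro summable_on_cmult_right gs)
  qed
  moreover have "(\<lambda>N. \<Sum>\<^sub>\<infinity>n. jtp_coeff r N n * z powi n) \<longlonglongrightarrow>
      qpoch_inf (r * z) q * qpoch_inf (r / z) q / qpoch_inf q q"
  proof -
    have "filterlim (\<lambda>N. 2 * N) at_top sequentially" by (rule mult_nat_left_at_top) simp
    from filterlim_compose[OF qpoch_tendsto[OF q(2)] this]
    have "(\<lambda>N. qpoch (r * z) q N * qpoch (r / z) q N / qpoch q q (2 * N)) \<longlonglongrightarrow>
        qpoch_inf (r * z) q * qpoch_inf (r / z) q / qpoch_inf q q"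
      by (intro tendsto_intros qpoch_tendsto qpoch_inf_nonzero q)
    then show ?thesis using infsumI[OF finite_jtp[OF r z]] by (simp add: q_def)
  qed
  ultimately have eq: "(\<Sum>\<^sub>\<infinity>n. (-1) powi n * r powi n\<^sup>2 * z powi n / qpoch_inf q q ^ 2) =
      qpoch_inf (r * z) q * qpoch_inf (r / z) q / qpoch_inf q q"
    by (rule LIMSEQ_unique)
  have Q: "qpoch_inf q q \<noteq> 0" using q by (intro qpoch_inf_nonzero)
  have "(\<lambda>n::int. norm ((-1) powi n * r powi n\<^sup>2 * z powi n)) summable_on UNIV"
    using gs by (simp add: norm_mult norm_power_int)
  then have sm: "(\<lambda>n::int. (-1) powi n * r powi n\<^sup>2 * z powi n) summable_on UNIV"
    by (rule abs_summable_summable)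
  have "(\<Sum>\<^sub>\<infinity>n. (-1) powi n * r powi n\<^sup>2 * z powi n * (1 / qpoch_inf q q ^ 2)) =
     (\<Sum>\<^sub>\<infinity>n. (-1) powi n * r powi n\<^sup>2 * z powi n) * (1 / qpoch_inf q q ^ 2)"
    by (rule infsum_cmult_left) (use sm in auto)
  then have "(\<Sum>\<^sub>\<infinity>n. (-1) powi n * r powi n\<^sup>2 * z powi n) = qpoch_inf (r * z) q * qpoch_inf (r / z) q * qpoch_inf q q"
    using eq Q by (simp add: field_simps power2_eq_square)
  also have "\<dots> = theta_j (r * z) q"
    using r z by (simp add: theta_j_def q_def power2_eq_square)
  finally show ?thesis using sm by (simp add: has_sum_iff q_def)
qed

section \<open>The rank generating function as an Appell sum\<close>

lemma power_int_neq_one: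
  fixes q :: complex
  assumes "norm q < 1" "q \<noteq> 0" "k \<noteq> 0" shows "q powi k \<noteq> 1"
proof (cases "k > 0")
  case True
  then show ?thesis using power_neq_one[of q "nat k"] assms by (simp add: power_int_nonneg_exp)
next
  case False
  then have "q ^ nat (- k) \<noteq> 1" using assms by (intro power_neq_one) auto
  moreover have "q powi k = inverse (q ^ nat (- k))"
    using power_int_minus[of q "- k"] False by (simp add: power_int_nonneg_exp)
  ultimately show ?thesis by (metis inverse_1 inverse_inverse_eq)
qed

text \<open>For k > 0 the point z q^k has modulus at most |q|, for k < 0 at least 1/|q|; since 1/|q|
  \<ge> 2 - |q|, both cases give the same distance from 1.\<close>

lemma norm_one_minus_power_int_ge:
  fixes q z :: complex
  assumes q: "norm q < 1" "q \<noteq> 0" and z: "norm z = 1" and k: "k \<noteq> 0"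
  shows "norm (1 - z * q powi k) \<ge> 1 - norm q"
proof (cases "k > 0")
  case True
  have "norm (z * q powi k) = norm q ^ nat k"
    using True z by (simp add: norm_mult power_int_nonneg_exp norm_power)
  also have "\<dots> \<le> norm q ^ 1" using True q by (intro power_decreasing) auto
  finally show ?thesis using norm_triangle_ineq2[of 1 "z * q powi k"] by simp
next
  case False
  have "norm (z * q powi k) = inverse (norm q ^ nat (- k))"
    using False z power_int_minus[of q "- k"] by (simp add: norm_mult power_int_nonneg_exp norm_power norm_inverse)
  moreover have "norm q ^ nat (- k) \<le> norm q ^ 1" using False k q by (intro power_decreasing) auto
  then have "inverse (norm q ^ 1) \<le> inverse (norm q ^ nat (- k))"
    using q by (intro le_imp_inverse_le) auto
  moreover have "inverse (norm q ^ 1) \<ge> 2 - norm q"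
    using q sum_squares_ge_zero[of "norm q - 1" 0] by (simp add: field_simps)
  ultimately have "norm (z * q powi k) \<ge> 2 - norm q" by linarith
  then show ?thesis using norm_triangle_ineq2[of "z * q powi k" 1] by (simp add: norm_minus_commute)
qed

lemma norm_one_minus_power_int_bound:
  fixes q z :: complex
  assumes q: "norm q < 1" "q \<noteq> 0" and z: "norm z = 1" "z \<noteq> 1"
  obtains \<delta> where "\<delta> > 0" "\<And>k. norm (1 - z * q powi k) \<ge> \<delta>"
proof (rule that[of "min (norm (1 - z)) (1 - norm q)"])
  show "min (norm (1 - z)) (1 - norm q) \<le> norm (1 - z * q powi k)" for k
    using norm_one_minus_power_int_ge[OF q z(1), of k] by (cases "k = 0") auto
qed (use assms in auto)

text \<open>In z the right-hand side has simple poles at q^(-k) for |k| \<le> N. Induction on N: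
  dividing by the product E of the two new factors changes each term only by multiples of
  \<open>c k\<close> and \<open>c k / q powi k\<close>, and the sums of these vanish.\<close>

lemma partial_fractions:
  fixes r z :: complex
  assumes r: "r \<noteq> 0" "norm r < 1" and z: "z \<noteq> 0" "\<And>k::int. z * (r^2) powi k \<noteq> 1"
  shows "((\<lambda>k. jtp_coeff r N k * r powi k / (1 - z * (r^2) powi k)) has_sum
           1 / (qpoch z (r^2) (Suc N) * qpoch (r^2 / z) (r^2) N)) UNIV"
proof (induction N)
  case 0
  show ?case
  proof (rule has_sum_finite_neutralI[of "{0}"])
    fix k :: int assume "k \<in> UNIV - {0}"
    then show "jtp_coeff r 0 k * r powi k / (1 - z * (r^2) powi k) = 0" by (auto simp: jtp_coeff_def inv_qfact_def)
  qed (auto simp: jtp_coeff_def inv_qfact_def qpoch_Suc)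
next
  case (Suc N)
  define q where "q = r^2"
  have q: "q \<noteq> 0" "norm q < 1" using r by (auto simp: q_def norm_power power_less_one_iff)
  have zq: "z * q powi k \<noteq> 1" for k using z(2) by (simp add: q_def)
  define A where "A = q ^ (N + 1)"
  define E where "E = (1 - z * A) * (1 - A / z)"
  have "1 - z * A \<noteq> 0" using zq[of "int (N + 1)"] unfolding A_def power_int_of_nat by simp
  moreover have "1 - A / z \<noteq> 0"
  proof
    assume "1 - A / z = 0"
    then have "z = A" using z by (simp add: field_simps)
    then have "z * q powi (- int (N + 1)) = 1"
      using q unfolding A_def power_int_minus power_int_of_nat by (simp add: field_simps)
    then show False using zq by blast
  qed
  ultimately have E: "E \<noteq> 0" by (simp add: E_def)
  define c where "c = (\<lambda>k. jtp_coeff r (Suc N) k * r powi k)"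
  \<comment> \<open>\<open>finite_jtp\<close> at z = r, where the second product starts with the
    factor 1 - 1; \<open>zero2\<close> uses z = 1/r, where the first product does.\<close>
  have zero1: "(c has_sum 0) UNIV"
    using finite_jtp[OF r r(1), of "Suc N"] r by (simp add: c_def qpoch_Suc')
  have zero2: "((\<lambda>k. c k / q powi k) has_sum 0) UNIV"
  proof -
    have "((\<lambda>k. jtp_coeff r (Suc N) k * (1 / r) powi k) has_sum 0) UNIV"
      using finite_jtp[OF r, of "1 / r" "Suc N"] r by (simp add: qpoch_Suc')
    moreover have "(1 / r) powi k = r powi k / q powi k" for k
      using r by (simp add: q_def power2_eq_square power_int_mult_distrib power_int_divide_distrib)
    ultimately show ?thesis by (simp add: c_def)
  qed
  have "((\<lambda>k. 1 / E * (jtp_coeff r N k * r powi k / (1 - z * q powi k))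
      + (A / E * (c k / q powi k) + - (A / (E * z)) * c k)) has_sum
      (1 / E * (1 / (qpoch z q (Suc N) * qpoch (q / z) q N)) + (A / E * 0 + - (A / (E * z)) * 0))) UNIV"
    using Suc.IH unfolding q_def[symmetric]
    by (intro has_sum_add has_sum_cmult_right zero1 zero2)
  also have "(\<lambda>k. 1 / E * (jtp_coeff r N k * r powi k / (1 - z * q powi k))
      + (A / E * (c k / q powi k) + - (A / (E * z)) * c k)) = (\<lambda>k. c k / (1 - z * q powi k))"
  proof
    fix k
    define x where "x = q powi k"
    have x: "x \<noteq> 0" "1 - z * x \<noteq> 0" using q zq[of k] by (auto simp: x_def)
    have j: "jtp_coeff r N k * r powi k = (1 - A / x) * (1 - A * x) * c k"
      using jtp_coeff_Suc(1)[OF r, of N k] by (simp add: c_def x_def A_def q_def)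
    have "(1 - A / x) * (1 - A * x) / (1 - z * x) + (A / x - A / z) = E / (1 - z * x)"
      using x z by (simp add: E_def divide_simps) (simp add: algebra_simps)
    then have "((1 - A / x) * (1 - A * x) / (1 - z * x) + (A / x - A / z)) * c k / E = c k / (1 - z * x)"
      using E by simp
    then show "1 / E * (jtp_coeff r N k * r powi k / (1 - z * q powi k))
      + (A / E * (c k / q powi k) + - (A / (E * z)) * c k) = c k / (1 - z * q powi k)"
      unfolding j unfolding x_def[symmetric] by (simp add: algebra_simps add_divide_distrib diff_divide_distrib)
  qed
  also have "1 / E * (1 / (qpoch z q (Suc N) * qpoch (q / z) q N)) + (A / E * 0 + - (A / (E * z)) * 0)
      = 1 / (qpoch z q (Suc (Suc N)) * qpoch (q / z) q (Suc N))"
  proof -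
    have "qpoch z q (Suc (Suc N)) * qpoch (q / z) q (Suc N) = E * (qpoch z q (Suc N) * qpoch (q / z) q N)"
      unfolding qpoch_Suc[of z q "Suc N"] qpoch_Suc[of "q / z"] by (simp add: E_def A_def mult_ac)
    then show ?thesis by simp
  qed
  finally show ?case by (simp add: c_def q_def)
qed

section \<open>Uniform bounds, a limiting q-Gauss sum and the Bailey transform\<close>

lemma qpoch_bounded:
  assumes "norm q < 1"
  obtains B where "B > 0" "\<And>n. norm (qpoch a q n) \<le> B"
proof -
  have "Bseq (qpoch a q)" using qpoch_tendsto[OF assms, of a] by (intro convergent_imp_Bseq) (auto simp: convergent_def)
  then show ?thesis using that by (auto elim: BseqE)
qed

lemma inverse_qpoch_bounded:
  assumes "norm q < 1" "norm a < 1"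
  obtains B where "B > 0" "\<And>n. norm (inverse (qpoch a q n)) \<le> B"
proof -
  have "(\<lambda>n. inverse (qpoch a q n)) \<longlonglongrightarrow> inverse (qpoch_inf a q)"
    by (intro tendsto_intros qpoch_tendsto qpoch_inf_nonzero assms)
  then have "Bseq (\<lambda>n. inverse (qpoch a q n))" by (intro convergent_imp_Bseq) (auto simp: convergent_def)
  then show ?thesis using that by (auto elim: BseqE)
qed

lemma qpoch_add: "qpoch a q (m + n) = qpoch a q m * qpoch (a * q ^ m) q n"
  by (induction n) (simp_all add: qpoch_Suc power_add mult_ac)

text \<open>Writing the shifted product as a quotient of two unshifted ones gives a bound that is
  uniform in the shift m as well.\<close>

lemma inverse_qpoch_shift_bounded:
  assumes "norm q < 1" "norm a < 1"
  obtains B where "B > 0" "\<And>m n. norm (inverse (qpoch (a * q ^ m) q n)) \<le> B"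
proof -
  obtain B1 where B1: "B1 > 0" "\<And>n. norm (qpoch a q n) \<le> B1" using qpoch_bounded[OF assms(1)] by blast
  obtain B2 where B2: "B2 > 0" "\<And>n. norm (inverse (qpoch a q n)) \<le> B2" using inverse_qpoch_bounded[OF assms] by blast
  show ?thesis
  proof (rule that[of "B1 * B2"])
    fix m n
    have "inverse (qpoch (a * q ^ m) q n) = qpoch a q m * inverse (qpoch a q (m + n))"
      using qpoch_nonzero[OF assms(2,1)] by (simp add: qpoch_add)
    then show "norm (inverse (qpoch (a * q ^ m) q n)) \<le> B1 * B2"
      using B1 B2 by (simp add: norm_mult mult_mono del: norm_inverse)
  qed (use B1 B2 in auto)
qed

lemma summable_theta_term:
  fixes s t :: real
  assumes "0 < s" "s < 1" "0 \<le> t"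
  shows "summable (\<lambda>k. s ^ (k * (k - 1)) * t ^ k)"
proof -
  have "s ^ (k * (k - 1)) * t ^ k = s ^ (k^2) * (t / s) ^ k" for k
  proof (cases k)
    case (Suc m)
    have "s ^ (k^2) = s ^ (k * (k - 1)) * s ^ k"
      by (simp add: Suc power2_eq_square algebra_simps flip: power_add)
    then show ?thesis using assms by (simp add: power_divide)
  qed auto
  then show ?thesis using summable_power_square[of s "t / s"] assms by simp
qed

text \<open>The limiting case \<open>b \<rightarrow> \<infinity>\<close> of the \<open>q\<close>-Gauss sum. The two sides satisfy the same first-order
  recurrence under \<open>d \<mapsto> d q\<close>, the difference of the two series being telescoping.\<close>

lemma one_phi_one_sum:
  fixes r a d :: complex
  assumes r: "r \<noteq> 0" "norm r < 1" and ad: "norm (a * d) < 1"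
  defines "q \<equiv> r^2"
  shows "(\<lambda>m. qpoch a q m * (- d) ^ m * r ^ (m * (m - 1)) / (qpoch q q m * qpoch (a * d) q m))
           sums (qpoch_inf d q / qpoch_inf (a * d) q)"
proof -
  have q: "q \<noteq> 0" "norm q < 1" using r by (auto simp: q_def norm_power power_less_one_iff)
  define t where "t = (\<lambda>N m. qpoch a q m * (- (d * q ^ N)) ^ m * r ^ (m * (m - 1)) / (qpoch q q m * qpoch (a * (d * q ^ N)) q m))"
  obtain B1 where B1: "B1 > 0" "\<And>n. norm (qpoch a q n) \<le> B1" using qpoch_bounded[OF q(2)] by blast
  obtain B2 where B2: "B2 > 0" "\<And>n. norm (inverse (qpoch q q n)) \<le> B2" using inverse_qpoch_bounded[OF q(2,2)] by blast
  obtain B3 where B3: "B3 > 0" "\<And>m n. norm (inverse (qpoch (a * d * q ^ m) q n)) \<le> B3"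
    using inverse_qpoch_shift_bounded[OF q(2) ad] by blast
  define M where "M = (\<lambda>m. B1 * B2 * B3 * (norm r ^ (m * (m - 1)) * norm d ^ m))"
  have M: "summable M" unfolding M_def
    by (intro summable_mult summable_theta_term) (use r in auto)
  have bound: "norm (t N m) \<le> M m * (norm q ^ N) ^ m" for N m
  proof -
    have "norm (t N m) = (norm (qpoch a q m) * norm (inverse (qpoch q q m)) * norm (inverse (qpoch (a * d * q ^ N) q m)))
       * ((norm r ^ (m * (m - 1)) * norm d ^ m) * (norm q ^ N) ^ m)"
      by (simp add: t_def divide_inverse norm_mult norm_power norm_inverse power_mult_distrib mult_ac)
    also have "\<dots> \<le> (B1 * B2 * B3) * ((norm r ^ (m * (m - 1)) * norm d ^ m) * (norm q ^ N) ^ m)"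
      by (intro mult_right_mono mult_mono) (use B1 B2 B3 in \<open>auto intro: less_imp_le\<close>)
    finally show ?thesis by (simp add: M_def mult_ac)
  qed
  have qN: "norm q ^ N \<le> 1" for N using q by (intro power_le_one) auto
  have Mpos: "M m \<ge> 0" for m using B1 B2 B3 by (simp add: M_def)
  have bound': "norm (t N m) \<le> M m" for N m
  proof -
    have "M m * (norm q ^ N) ^ m \<le> M m * 1" using Mpos q by (intro mult_left_mono power_le_one) auto
    then show ?thesis using bound[of N m] by linarith
  qed
  have summ: "summable (t N)" for N
    using M by (rule summable_comparison_test'[where N = 0]) (use bound' in auto)
  define S where "S = (\<lambda>N. suminf (t N))"
  have adN: "norm (a * (d * q ^ N)) < 1" for N
    using norm_mult_power_less_one[OF ad q(2), of N] by (simp add: mult_ac)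
  have rec: "(1 - a * (d * q ^ N)) * S N = (1 - d * q ^ N) * S (Suc N)" for N
  proof -
    define D where "D = d * q ^ N"
    have aD: "norm (a * D) < 1" using adN by (simp add: D_def)
    have aDq: "norm (a * D * q) < 1" using norm_mult_power_less_one[OF aD q(2), of 1] by simp
    \<comment> \<open>Both \<open>(1 - a * D) * t N m\<close> and \<open>t (Suc N) m\<close> are
      \<open>e m\<close> times a simple factor. The sequence \<open>g\<close> below is the
      certificate that makes (1 - a D) t_N - (1 - D) t_{N+1} telescope; it is 0 at m = 0 and tends
      to 0.\<close>
    define e where "e = (\<lambda>m. qpoch a q m * (- D) ^ m * r ^ (m * (m - 1)) / (qpoch q q m * qpoch (a * D * q) q m))"
    define g where "g = (\<lambda>m. - (e m * (1 - q ^ m) * (1 - a * D * q ^ m)))"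
    have nz: "qpoch q q m \<noteq> 0" "qpoch (a * D) q m \<noteq> 0" "qpoch (a * D * q) q m \<noteq> 0" for m
      using q aD aDq by (auto simp: qpoch_nonzero)
    have t1: "(1 - a * D) * t N m = e m * (1 - a * D * q ^ m)" for m
    proof -
      have "(1 - a * D) * qpoch (a * D * q) q m = qpoch (a * D) q m * (1 - a * D * q ^ m)"
        using qpoch_Suc[of "a * D" q m] qpoch_Suc'[of "a * D" q m] by simp
      then show ?thesis using nz by (simp add: t_def e_def D_def[symmetric] divide_simps)
    qed
    have t2: "t (Suc N) m = q ^ m * e m" for m
      using power_mult_distrib[of "- D" q m] by (simp add: t_def e_def D_def power_mult_distrib[symmetric] mult_ac)
    have g_Suc: "g (Suc m) = e m * D * q ^ m * (1 - a * q ^ m)" for m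
    proof -
      have r2: "r ^ (Suc m * (Suc m - 1)) = r ^ (m * (m - 1)) * q ^ m"
      proof -
        have "r ^ (m * (m - 1)) * q ^ m = r ^ (m * (m - 1) + 2 * m)" by (simp only: q_def power_add power_mult)
        also have "m * (m - 1) + 2 * m = Suc m * (Suc m - 1)" by (cases m) auto
        finally show ?thesis by simp
      qed
      have f: "1 - q ^ Suc m \<noteq> 0" "1 - a * D * q * q ^ m \<noteq> 0"
        using nz(1,3)[of "Suc m"] by (auto simp: qpoch_Suc)
      have f': "e (Suc m) * (1 - q ^ Suc m) * (1 - a * D * q ^ Suc m) =
         qpoch a q (Suc m) * (- D) ^ Suc m * r ^ (Suc m * (Suc m - 1)) / (qpoch q q m * qpoch (a * D * q) q m)"
      proof -
        have cancel: "X / ((P * x) * (R * y)) * x * y = X / (P * R)" if "x \<noteq> 0" "y \<noteq> 0" for X P R x y :: complex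
          using that by simp
        have 1: "1 - a * D * q ^ Suc m = 1 - a * D * q * q ^ m" by (simp add: mult_ac)
        have 2: "e (Suc m) = qpoch a q (Suc m) * (- D) ^ Suc m * r ^ (Suc m * (Suc m - 1))
            / ((qpoch q q m * (1 - q ^ Suc m)) * (qpoch (a * D * q) q m * (1 - a * D * q * q ^ m)))"
          by (simp only: e_def qpoch_Suc[of q] qpoch_Suc[of "a * D * q"] power_Suc)
        show ?thesis unfolding 1 2 by (rule cancel[OF f])
      qed
      have cancel2: "- (A * X * (- D) ^ Suc m * (R * Q) / P) = A * (- D) ^ m * R / P * D * Q * X" for A X R Q P
        by simp
      show ?thesis unfolding g_def f' r2 unfolding qpoch_Suc[of a] e_def by (rule cancel2)
    qed
    have tele: "g (Suc m) - g m = (1 - a * D) * t N m - (1 - D) * t (Suc N) m" for m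
      unfolding g_Suc t1 t2 by (simp add: g_def algebra_simps)
    have "e \<longlonglongrightarrow> 0"
    proof -
      have "(\<lambda>m. (1 - a * D) * t N m) \<longlonglongrightarrow> (1 - a * D) * 0"
        by (intro tendsto_intros summable_LIMSEQ_zero summ)
      moreover have "(\<lambda>m. 1 - a * D * q ^ m) \<longlonglongrightarrow> 1 - a * D * 0"
        by (intro tendsto_intros LIMSEQ_power_zero q)
      ultimately have "(\<lambda>m. (1 - a * D) * t N m / (1 - a * D * q ^ m)) \<longlonglongrightarrow> (1 - a * D) * 0 / (1 - a * D * 0)"
        by (intro tendsto_divide) auto
      moreover have "(1 - a * D) * t N m / (1 - a * D * q ^ m) = e m" for m
        using t1[of m] mult_power_neq_one[OF aD q(2), of m] by simp
      ultimately show ?thesis by simp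
    qed
    then have "g \<longlonglongrightarrow> - (0 * (1 - 0) * (1 - a * D * 0))"
      unfolding g_def by (intro tendsto_intros LIMSEQ_power_zero q)
    then have "(\<lambda>m. g (Suc m) - g m) sums (0 - g 0)" by (intro telescope_sums) simp
    moreover have "(\<lambda>m. g (Suc m) - g m) sums ((1 - a * D) * S N - (1 - D) * S (Suc N))"
      unfolding tele S_def by (intro sums_diff sums_mult summable_sums summ)
    ultimately have "0 - g 0 = (1 - a * D) * S N - (1 - D) * S (Suc N)" by (rule sums_unique2)
    then show ?thesis by (simp add: g_def D_def)
  qed
  have iter: "qpoch (a * d) q N * S 0 = qpoch d q N * S N" for N
  proof (induction N)
    case (Suc N)
    have "qpoch (a * d) q (Suc N) * S 0 = (1 - a * (d * q ^ N)) * (qpoch (a * d) q N * S 0)"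
      by (simp add: qpoch_Suc mult_ac)
    also have "\<dots> = qpoch d q N * ((1 - a * (d * q ^ N)) * S N)" by (simp add: Suc.IH)
    also have "\<dots> = qpoch d q (Suc N) * S (Suc N)" unfolding rec by (simp add: qpoch_Suc)
    finally show ?case .
  qed simp
  \<comment> \<open>As N grows, d q^N tends to 0 and the terms after the first die at the rate
    |q|^N; hence S tends to 1 and the iterated recurrence can be taken to its limit.\<close>
  have Sb: "norm (S N - 1) \<le> suminf M * norm q ^ N" for N
  proof -
      have "t N 0 = 1" by (simp add: t_def)
      then have "S N - 1 = (\<Sum>m. t N (Suc m))" unfolding S_def using suminf_split_head[OF summ, of N] by simp
      also have "norm \<dots> \<le> (\<Sum>m. M (Suc m) * norm q ^ N)"
      proof (rule norm_suminf_le)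
        fix m
        have "(norm q ^ N) ^ Suc m \<le> (norm q ^ N) ^ 1" using qN by (intro power_decreasing) auto
        then have "M (Suc m) * (norm q ^ N) ^ Suc m \<le> M (Suc m) * norm q ^ N"
          using Mpos by (intro mult_left_mono) auto
        then show "norm (t N (Suc m)) \<le> M (Suc m) * norm q ^ N" using bound[of N "Suc m"] by linarith
        show "summable (\<lambda>m. M (Suc m) * norm q ^ N)" using M by (intro summable_mult2) (simp add: summable_Suc_iff)
      qed
      also have "\<dots> = (\<Sum>m. M (Suc m)) * norm q ^ N" by (rule suminf_mult2[symmetric]) (use M in \<open>simp add: summable_Suc_iff\<close>)
      also have "\<dots> \<le> suminf M * norm q ^ N"
        by (intro mult_right_mono) (use suminf_split_head[OF M] Mpos[of 0] in auto)
      finally show ?thesis .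
  qed
  have "(\<lambda>N. suminf M * norm q ^ N) \<longlonglongrightarrow> suminf M * 0"
    by (intro tendsto_intros LIMSEQ_power_zero) (use q in auto)
  then have "(\<lambda>N. S N - 1) \<longlonglongrightarrow> 0"
    by (intro Lim_null_comparison[OF always_eventually, of "\<lambda>N. S N - 1" "\<lambda>N. suminf M * norm q ^ N"]) (use Sb in auto)
  then have S: "S \<longlonglongrightarrow> 1" by (simp add: LIM_zero_iff)
  have "(\<lambda>N. qpoch (a * d) q N * S 0) \<longlonglongrightarrow> qpoch_inf (a * d) q * S 0"
    by (intro tendsto_intros qpoch_tendsto q)
  moreover have "(\<lambda>N. qpoch (a * d) q N * S 0) \<longlonglongrightarrow> qpoch_inf d q * 1"
    unfolding iter by (intro tendsto_intros qpoch_tendsto q S)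
  ultimately have "qpoch_inf (a * d) q * S 0 = qpoch_inf d q * 1" by (rule LIMSEQ_unique)
  then have "S 0 = qpoch_inf d q / qpoch_inf (a * d) q"
    using qpoch_inf_nonzero[OF ad q(2)] by (simp add: field_simps)
  then show ?thesis using summable_sums[OF summ[of 0]] by (simp add: S_def t_def)
qed

text \<open>A conjugate Bailey pair. The factor 1/(q;q)_{N-k} kills the terms with N < k, and N = m
  + k turns the rest into the preceding sum with a = -q^k and d = -q^(k+1). Negative k follows by
  symmetry: the summands and q^(k(k+1)/2) / (1 + q^k) are invariant under the change of sign of
  k.\<close>

lemma bailey_sum:
  fixes r :: complex
  assumes r: "r \<noteq> 0" "norm r < 1"
  defines "q \<equiv> r^2"
  shows "(\<lambda>N. qpoch (-1) q N * r ^ (N * (N + 1)) * inv_qfact q (int N - k) * inv_qfact q (int N + k))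
           sums (qpoch_inf (-q) q / qpoch_inf q q * (2 * r powi (k * (k + 1)) / (1 + q powi k)))"
proof -
  have q: "q \<noteq> 0" "norm q < 1" using r by (auto simp: q_def norm_power power_less_one_iff)
  have nonneg: "(\<lambda>N. qpoch (-1) q N * r ^ (N * (N + 1)) * inv_qfact q (int N - int k) * inv_qfact q (int N + int k))
           sums (qpoch_inf (-q) q / qpoch_inf q q * (2 * r ^ (k * (k + 1)) / (1 + q ^ k)))" for k :: nat
  proof -
    define a d where "a = - (q ^ k)" and "d = - (q ^ (k + 1))"
    have ad: "a * d = q * q ^ (2 * k)" by (simp add: a_def d_def mult_2 power_add)
    have ad1: "norm (a * d) < 1" unfolding ad by (rule norm_mult_power_less_one) (use q in auto)
    have qk: "1 + q ^ k \<noteq> 0" "1 + q \<noteq> 0"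
    proof -
      have "norm (q ^ k) < 1" if "k > 0" using q that by (simp add: norm_power power_less_one_iff)
      then show "1 + q ^ k \<noteq> 0" by (cases "k = 0") (auto simp: add_eq_0_iff norm_minus_commute)
      show "1 + q \<noteq> 0" using q by (auto simp: add_eq_0_iff)
    qed
    have nz: "qpoch q q m \<noteq> 0" "qpoch (a * d) q m \<noteq> 0" for m
      using q ad1 by (auto simp: qpoch_nonzero)
    define C where "C = qpoch (-1) q k * r ^ (k * (k + 1)) / qpoch q q (2 * k)"
    have "(\<lambda>m. C * (qpoch a q m * (- d) ^ m * r ^ (m * (m - 1)) / (qpoch q q m * qpoch (a * d) q m)))
       sums (C * (qpoch_inf d q / qpoch_inf (a * d) q))"
      unfolding q_def by (intro sums_mult one_phi_one_sum r) (use ad1 in \<open>simp add: q_def\<close>)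
    also have "(\<lambda>m. C * (qpoch a q m * (- d) ^ m * r ^ (m * (m - 1)) / (qpoch q q m * qpoch (a * d) q m)))
      = (\<lambda>m. qpoch (-1) q (m + k) * r ^ ((m + k) * (m + k + 1)) * inv_qfact q (int (m + k) - int k) * inv_qfact q (int (m + k) + int k))"
    proof
      fix m
      have 1: "qpoch (-1) q (m + k) = qpoch (-1) q k * qpoch a q m"
        using qpoch_add[of "-1" q k m] by (simp add: a_def add.commute)
      have 2: "r ^ ((m + k) * (m + k + 1)) = r ^ (k * (k + 1)) * ((- d) ^ m * r ^ (m * (m - 1)))"
      proof -
        have "(- d) ^ m = r ^ (2 * (k + 1) * m)" by (simp add: d_def q_def flip: power_mult power_Suc)
        then have "r ^ (k * (k + 1)) * ((- d) ^ m * r ^ (m * (m - 1))) = r ^ (k * (k + 1) + 2 * (k + 1) * m + m * (m - 1))"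
          by (simp only: power_add mult.assoc)
        also have "k * (k + 1) + 2 * (k + 1) * m + m * (m - 1) = (m + k) * (m + k + 1)"
          by (cases m) (simp_all add: algebra_simps)
        finally show ?thesis by simp
      qed
      have 3: "inv_qfact q (int (m + k) - int k) = 1 / qpoch q q m" by (simp add: inv_qfact_def)
      have 4: "qpoch q q (2 * k + m) = qpoch q q (2 * k) * qpoch (a * d) q m"
        unfolding ad by (rule qpoch_add)
      have 5: "nat (int (m + k) + int k) = 2 * k + m" by linarith
      have 6: "inv_qfact q (int (m + k) + int k) = 1 / (qpoch q q (2 * k) * qpoch (a * d) q m)"
        unfolding inv_qfact_def 5 4 by simp
      show "C * (qpoch a q m * (- d) ^ m * r ^ (m * (m - 1)) / (qpoch q q m * qpoch (a * d) q m)) =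
         qpoch (-1) q (m + k) * r ^ ((m + k) * (m + k + 1)) * inv_qfact q (int (m + k) - int k) * inv_qfact q (int (m + k) + int k)"
        unfolding 1 2 3 6 C_def by (simp add: mult_ac)
    qed
    also have "C * (qpoch_inf d q / qpoch_inf (a * d) q) = qpoch_inf (-q) q / qpoch_inf q q * (2 * r ^ (k * (k + 1)) / (1 + q ^ k))"
    proof -
      have 1: "qpoch_inf q q = qpoch q q (2 * k) * qpoch_inf (a * d) q"
        unfolding ad by (rule qpoch_inf_split[OF q(2)])
      have 2: "qpoch (-1) q (Suc k) * qpoch_inf d q = 2 * qpoch_inf (- q) q"
        using qpoch_inf_split[OF q(2), of "-1" "Suc k"] qpoch_inf_rec[OF q(2), of "-1"] by (simp add: d_def)
      then have 3: "qpoch (-1) q k * qpoch_inf d q = 2 * qpoch_inf (- q) q / (1 + q ^ k)"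
        using qk by (simp add: qpoch_Suc field_simps)
      have "C * (qpoch_inf d q / qpoch_inf (a * d) q) = (qpoch (-1) q k * qpoch_inf d q) * r ^ (k * (k + 1)) / qpoch_inf q q"
        unfolding C_def 1 by simp
      then show ?thesis unfolding 3 by (simp add: mult_ac)
    qed
    finally show ?thesis
      by (rule sums_zero_iff_shift[THEN iffD1, rotated]) (auto simp: inv_qfact_def)
  qed
  show ?thesis
  proof (cases "k \<ge> 0")
    case True
    then obtain m where k: "k = int m" using nonneg_int_cases by blast
    have "k * (k + 1) = int (m * (m + 1))" by (simp add: k algebra_simps)
    then have "r powi (k * (k + 1)) = r ^ (m * (m + 1))" by (simp only: power_int_of_nat)
    then show ?thesis using nonneg[of m] by (simp add: k)
  next
    case False
    define m where "m = nat (- k)"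
    have k: "k = - int m" using False by (simp add: m_def)
    have "r powi (k * (k + 1)) / (1 + q powi k) = r ^ (m * (m + 1)) / (1 + q ^ m)"
    proof -
      have "k * (k + 1) = int (m * (m + 1)) - int (2 * m)" by (simp add: k algebra_simps)
      then have "r powi (k * (k + 1)) = r powi (int (m * (m + 1)) - int (2 * m))" by (simp only:)
      also have "\<dots> = r ^ (m * (m + 1)) / r ^ (2 * m)"
        using r power_int_diff[of r "int (m * (m + 1))" "int (2 * m)"] unfolding power_int_of_nat by blast
      finally have e1: "r powi (k * (k + 1)) = r ^ (m * (m + 1)) / q ^ m" by (simp add: q_def flip: power_mult)
      have e2: "q powi k = 1 / q ^ m" by (simp add: k power_int_minus field_simps)
      have cancel: "(X / Q) / (1 + 1 / Q) = X / (1 + Q)" if "Q \<noteq> 0" for X Q :: complex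
      proof -
        have "1 + 1 / Q = (1 + Q) / Q" using that by (simp add: field_simps)
        then show ?thesis using that by simp
      qed
      show ?thesis unfolding e1 e2 by (rule cancel) (use q in simp)
    qed
    then have eq: "2 * r powi (k * (k + 1)) / (1 + q powi k) = 2 * r ^ (m * (m + 1)) / (1 + q ^ m)"
      by (simp only: times_divide_eq_right[symmetric])
    show ?thesis unfolding eq using nonneg[of m] by (simp add: k mult_ac)
  qed
qed

text \<open>The two denominators are kept together rather than split as in the overview: splitting
  divides by 1 + z, whereas this form also covers z = -1, where the denominators become
  squares.\<close>

definition rank_appell :: "complex \<Rightarrow> complex \<Rightarrow> complex" where
  "rank_appell z q = (\<Sum>\<^sub>\<infinity>k::int. 2 * (1 - z) * (-1) powi k * q powi (k\<^sup>2 + k) / ((1 + q powi k) * (1 - z * q powi k)))"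

text \<open>Bailey's lemma as an interchange of summation in the double series
  \<open>f (N, k)\<close>: the rows are summed by \<open>partial_fractions\<close>, the columns by
  \<open>bailey_sum\<close>. The assumptions on z keep all denominators 1 - z q^k away from 0, which
  yields a summable majorant in product form.\<close>

lemma durfee_sum_appell:
  fixes r z :: complex
  assumes r: "r \<noteq> 0" "norm r < 1" and z: "norm z = 1" "z \<noteq> 1"
  defines "q \<equiv> r^2"
  shows "(\<lambda>N. qpoch (-1) q N * r ^ (N * (N + 1)) / (qpoch (z * q) q N * qpoch (q / z) q N))
           sums (qpoch_inf (-q) q / qpoch_inf q q * rank_appell z q)"
proof -
  have q: "q \<noteq> 0" "norm q < 1" using r by (auto simp: q_def norm_power power_less_one_iff)
  have z0: "z \<noteq> 0" using z by auto
  have zq: "z * q powi k \<noteq> 1" for k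
  proof (cases "k = 0")
    case False
    then show ?thesis using norm_one_minus_power_int_ge[OF q(2,1) z(1) False] q by auto
  qed (use z in auto)
  obtain \<delta> where \<delta>: "\<delta> > 0" "\<And>k. norm (1 - z * q powi k) \<ge> \<delta>"
    using norm_one_minus_power_int_bound[OF q(2,1) z] by blast
  obtain B where B: "B > 0" "\<And>N n. norm (jtp_coeff r N n) \<le> B * norm (r powi n\<^sup>2)"
    using jtp_coeff_bound[OF r] by blast
  obtain B1 where B1: "B1 > 0" "\<And>n. norm (qpoch (-1) q n) \<le> B1" using qpoch_bounded[OF q(2)] by blast
  define a where "a = (\<lambda>N. qpoch (-1) q N * r ^ (N * (N + 1)))"
  define c where "c = (\<lambda>N k. jtp_coeff r N k * r powi k / (1 - z * q powi k))"
  define f where "f = (\<lambda>(N, k). a N * c N k)"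
  have a_bound: "norm (a N) \<le> B1 * norm r ^ N" for N
  proof -
    have "norm r ^ (N * (N + 1)) \<le> norm r ^ N" using r by (intro power_decreasing) auto
    then show ?thesis unfolding a_def norm_mult norm_power using B1 by (intro mult_mono) auto
  qed
  have c_bound: "norm (c N k) \<le> B / \<delta> * norm (r powi k\<^sup>2 * r powi k)" for N k
  proof -
    have "norm (jtp_coeff r N k) * norm (r powi k) / norm (1 - z * q powi k) \<le> (B * norm (r powi k\<^sup>2)) * norm (r powi k) / \<delta>"
      using B(2)[of N k] \<delta>(1) \<delta>(2)[of k] B(1) by (intro frac_le mult_mono mult_nonneg_nonneg) auto
    then show ?thesis by (simp add: c_def norm_mult norm_divide)
  qed
  have f_summable: "f summable_on UNIV \<times> UNIV"
  proof -
    have "(\<lambda>k::int. norm (r powi k\<^sup>2 * r powi k)) summable_on UNIV" using gauss_summable[of r r] r by simp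
    then have s2: "(\<lambda>k::int. B / \<delta> * norm (r powi k\<^sup>2 * r powi k)) summable_on UNIV" by (rule summable_on_cmult_right)
    have "summable (\<lambda>N. B1 * norm r ^ N)" using r by (intro summable_mult summable_geometric) auto
    then have s1: "(\<lambda>N. B1 * norm r ^ N) summable_on UNIV"
      using B1 by (subst summable_on_UNIV_nonneg_real_iff) auto
    have "(\<lambda>(N, k). (B1 * norm r ^ N) * (B / \<delta> * norm (r powi k\<^sup>2 * r powi k))) summable_on UNIV \<times> UNIV"
    proof (rule summable_on_SigmaI)
      show "((\<lambda>k. case (N, k) of (N, k) \<Rightarrow> (B1 * norm r ^ N) * (B / \<delta> * norm (r powi k\<^sup>2 * r powi k)))
          has_sum (B1 * norm r ^ N) * (\<Sum>\<^sub>\<infinity>k. B / \<delta> * norm (r powi k\<^sup>2 * r powi k))) UNIV" for N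
        unfolding prod.case by (rule has_sum_cmult_right[OF has_sum_infsum[OF s2]])
      show "(\<lambda>N. B1 * norm r ^ N * (\<Sum>\<^sub>\<infinity>k. B / \<delta> * norm (r powi k\<^sup>2 * r powi k))) summable_on UNIV"
        by (rule summable_on_cmult_left[OF s1])
    qed (use B B1 \<delta> in auto)
    then have "(\<lambda>x. norm (f x)) summable_on UNIV \<times> UNIV"
    proof (rule Infinite_Sum.abs_summable_on_comparison_test')
      fix x :: "nat \<times> int"
      obtain N k where x: "x = (N, k)" by (cases x)
      show "norm (f x) \<le> (case x of (N, k) \<Rightarrow> (B1 * norm r ^ N) * (B / \<delta> * norm (r powi k\<^sup>2 * r powi k)))"
        unfolding x f_def prod.case norm_mult[of "a N"] using B1
        by (intro mult_mono a_bound c_bound) auto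
    qed
    then show ?thesis by (rule abs_summable_summable)
  qed
  have rows: "((\<lambda>k. f (N, k)) has_sum (a N / ((1 - z) * (qpoch (z * q) q N * qpoch (q / z) q N)))) UNIV" for N
    using has_sum_cmult_right[OF partial_fractions[OF r z0, of N], of "a N"] zq
    by (simp add: f_def c_def q_def qpoch_Suc' mult_ac)
  define g where "g = (\<lambda>k. qpoch_inf (-q) q / qpoch_inf q q * (2 * (-1) powi k * q powi (k\<^sup>2 + k) / ((1 + q powi k) * (1 - z * q powi k))))"
  have cols: "((\<lambda>N. f (N, k)) has_sum g k) UNIV" for k
  proof -
    define C where "C = (-1) powi k * r powi k\<^sup>2 * r powi k / (1 - z * q powi k)"
    have "(\<lambda>N. f (N, k)) summable_on UNIV"
    proof (rule summable_on_SigmaD1[where f = "\<lambda>k N. f (N, k)" and A = UNIV and B = "\<lambda>_. UNIV" and x = k])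
      show "(\<lambda>(k, N). f (N, k)) summable_on UNIV \<times> UNIV"
        using f_summable by (simp only: summable_on_swap[of f])
    qed auto
    then have hs: "((\<lambda>N. f (N, k)) has_sum (\<Sum>\<^sub>\<infinity>N. f (N, k))) UNIV" by (rule has_sum_infsum)
    have "(\<lambda>N. C * (qpoch (-1) q N * r ^ (N * (N + 1)) * inv_qfact q (int N - k) * inv_qfact q (int N + k)))
       sums (C * (qpoch_inf (-q) q / qpoch_inf q q * (2 * r powi (k * (k + 1)) / (1 + q powi k))))"
      unfolding q_def by (intro sums_mult bailey_sum r)
    also have "(\<lambda>N. C * (qpoch (-1) q N * r ^ (N * (N + 1)) * inv_qfact q (int N - k) * inv_qfact q (int N + k))) = (\<lambda>N. f (N, k))"
      by (simp add: f_def c_def C_def a_def jtp_coeff_def q_def mult_ac)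
    also have "C * (qpoch_inf (-q) q / qpoch_inf q q * (2 * r powi (k * (k + 1)) / (1 + q powi k))) = g k"
    proof -
      have "r powi k\<^sup>2 * r powi k * r powi (k * (k + 1)) = q powi (k\<^sup>2 + k)"
      proof -
        have "k\<^sup>2 + k + k * (k + 1) = int 2 * (k\<^sup>2 + k)" by (simp add: power2_eq_square algebra_simps)
        then have "r powi (k\<^sup>2 + k + k * (k + 1)) = q powi (k\<^sup>2 + k)" by (simp only: q_def power_int_power)
        then show ?thesis using r by (simp add: power_int_add)
      qed
      then have "C * (2 * r powi (k * (k + 1)) / (1 + q powi k)) = 2 * (-1) powi k * q powi (k\<^sup>2 + k) / ((1 + q powi k) * (1 - z * q powi k))"
        by (simp add: C_def mult_ac)
      then show ?thesis unfolding g_def by (metis mult.left_commute)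
    qed
    finally show ?thesis using has_sum_imp_sums[OF hs] hs sums_unique2 by metis
  qed
  define T where "T = (\<Sum>\<^sub>\<infinity>x\<in>UNIV \<times> UNIV. f x)"
  have T: "(f has_sum T) (UNIV \<times> UNIV)" unfolding T_def using f_summable by (rule has_sum_infsum)
  have "((\<lambda>N. a N / ((1 - z) * (qpoch (z * q) q N * qpoch (q / z) q N))) has_sum T) UNIV"
    by (rule has_sum_SigmaD[OF T]) (use rows in auto)
  then have "(\<lambda>N. a N / ((1 - z) * (qpoch (z * q) q N * qpoch (q / z) q N))) sums T" by (rule has_sum_imp_sums)
  then have "(\<lambda>N. (1 - z) * (a N / ((1 - z) * (qpoch (z * q) q N * qpoch (q / z) q N)))) sums ((1 - z) * T)" by (rule sums_mult)
  then have 1: "(\<lambda>N. a N / (qpoch (z * q) q N * qpoch (q / z) q N)) sums ((1 - z) * T)" using z by simp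
  have "((\<lambda>(k, N). f (N, k)) has_sum T) (UNIV \<times> UNIV)" using T has_sum_swap[where f = f and S = T and A = UNIV and B = UNIV] by simp
  then have "(g has_sum T) UNIV" by (rule has_sum_SigmaD) (use cols in auto)
  then have "((\<lambda>k. (1 - z) * g k) has_sum ((1 - z) * T)) UNIV" by (rule has_sum_cmult_right)
  also have "(\<lambda>k. (1 - z) * g k) = (\<lambda>k. qpoch_inf (-q) q / qpoch_inf q q *
      (2 * (1 - z) * (-1) powi k * q powi (k\<^sup>2 + k) / ((1 + q powi k) * (1 - z * q powi k))))"
  proof -
    have "w * (C * (2 * a * b / D)) = C * (2 * w * a * b / D)" for w C a b D :: complex by simp
    then show ?thesis by (simp only: g_def)
  qed
  finally have "(1 - z) * T = (\<Sum>\<^sub>\<infinity>k. qpoch_inf (-q) q / qpoch_inf q q *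
      (2 * (1 - z) * (-1) powi k * q powi (k\<^sup>2 + k) / ((1 + q powi k) * (1 - z * q powi k))))"
    by (rule infsumI[symmetric])
  also have "\<dots> = qpoch_inf (-q) q / qpoch_inf q q * rank_appell z q"
    unfolding rank_appell_def by (rule infsum_cmult_right')
  finally show ?thesis using 1 by (simp add: a_def)
qed

text \<open>The k-th term, doubled, is the contribution of the overpartitions with largest part k +
  1 (see \<open>rank_weight_row\<close>); the leading 1 belongs to the empty overpartition.\<close>

definition rank_gf :: "complex \<Rightarrow> complex \<Rightarrow> complex" where
  "rank_gf z q = 1 + 2 * (\<Sum>k. z ^ k * q ^ Suc k * qpoch (- q / z) q k / qpoch (q / z) q (Suc k))"

lemma summable_rank_gf:
  fixes q z :: complex
  assumes q: "q \<noteq> 0" "norm q < 1" and z: "norm z = 1"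
  shows "summable (\<lambda>k. z ^ k * q ^ Suc k * qpoch (- q / z) q k / qpoch (q / z) q (Suc k))"
proof -
  obtain B1 where B1: "B1 > 0" "\<And>n. norm (qpoch (- q / z) q n) \<le> B1" using qpoch_bounded[OF q(2)] by blast
  have qz: "norm (q / z) < 1" using q z by (simp add: norm_divide)
  obtain B2 where B2: "B2 > 0" "\<And>n. norm (inverse (qpoch (q / z) q n)) \<le> B2" using inverse_qpoch_bounded[OF q(2) qz] by blast
  show ?thesis
  proof (rule summable_comparison_test'[where N = 0])
    show "summable (\<lambda>k. B1 * B2 * norm q * norm q ^ k)"
      using q by (intro summable_mult summable_geometric) auto
    fix k
    have "norm (z ^ k * q ^ Suc k * qpoch (- q / z) q k / qpoch (q / z) q (Suc k)) =
       norm (qpoch (- q / z) q k) * norm (inverse (qpoch (q / z) q (Suc k))) * (norm q * norm q ^ k)"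
      using z by (simp add: divide_inverse norm_mult norm_power norm_inverse mult_ac)
    also have "\<dots> \<le> B1 * B2 * (norm q * norm q ^ k)"
      by (intro mult_right_mono mult_mono B1 B2) (use B1 B2 in \<open>auto intro: less_imp_le\<close>)
    finally show "norm (z ^ k * q ^ Suc k * qpoch (- q / z) q k / qpoch (q / z) q (Suc k)) \<le> B1 * B2 * norm q * norm q ^ k"
      by (simp add: mult_ac)
  qed
qed

text \<open>With f(k) = (-q;q)_k / (q;q)_k the doubled k-th term is f(k+1) - f(k), so the series
  telescopes. This supplies the value at z = 1, which \<open>rank_gf_appell\<close>
  excludes.\<close>

lemma rank_gf_1:
  fixes q :: complex
  assumes q: "q \<noteq> 0" "norm q < 1"
  shows "rank_gf 1 q = qpoch_inf (- q) q / qpoch_inf q q"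
proof -
  define f where "f = (\<lambda>k. qpoch (- q) q k / qpoch q q k)"
  have nz: "qpoch q q k \<noteq> 0" for k by (rule qpoch_nonzero[OF q(2,2)])
  have "f \<longlonglongrightarrow> qpoch_inf (- q) q / qpoch_inf q q"
    unfolding f_def by (intro tendsto_intros qpoch_tendsto qpoch_inf_nonzero q)
  then have "(\<lambda>k. f (Suc k) - f k) sums (qpoch_inf (- q) q / qpoch_inf q q - f 0)" by (rule telescope_sums)
  also have "(\<lambda>k. f (Suc k) - f k) = (\<lambda>k. 2 * (1 ^ k * q ^ Suc k * qpoch (- q / 1) q k / qpoch (q / 1) q (Suc k)))"
  proof
    fix k
    show "f (Suc k) - f k = 2 * (1 ^ k * q ^ Suc k * qpoch (- q / 1) q k / qpoch (q / 1) q (Suc k))"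
      using nz[of k] nz[of "Suc k"] by (simp add: f_def qpoch_Suc divide_simps) (simp add: algebra_simps)
  qed
  finally have "(\<lambda>k. 2 * (1 ^ k * q ^ Suc k * qpoch (- q / 1) q k / qpoch (q / 1) q (Suc k))) sums (qpoch_inf (- q) q / qpoch_inf q q - f 0)" .
  then have "(\<Sum>k. 2 * (1 ^ k * q ^ Suc k * qpoch (- q / 1) q k / qpoch (q / 1) q (Suc k))) = qpoch_inf (- q) q / qpoch_inf q q - 1"
    by (simp add: sums_iff f_def)
  also have "(\<Sum>k. 2 * (1 ^ k * q ^ Suc k * qpoch (- q / 1) q k / qpoch (q / 1) q (Suc k))) =
     2 * (\<Sum>k. 1 ^ k * q ^ Suc k * qpoch (- q / 1) q k / qpoch (q / 1) q (Suc k))"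
    by (rule suminf_mult) (rule summable_rank_gf[OF q], simp)
  finally show ?thesis by (simp add: rank_gf_def)
qed

text \<open>Iterating Fine's functional equation
  \<open>(1 - t) F(b,c;t) = 1 + (c - b) t / (1 - c) F(b,cq;tq)\<close> for \<open>F(b,c;t) = \<Sum> (b)\<^sub>k t\<^sup>k / (c)\<^sub>k\<close>.\<close>

lemma rank_gf_durfee:
  fixes r z :: complex
  assumes r: "r \<noteq> 0" "norm r < 1" and z: "norm z = 1"
  defines "q \<equiv> r^2"
  shows "(\<lambda>N. qpoch (-1) q N * r ^ (N * (N + 1)) / (qpoch (z * q) q N * qpoch (q / z) q N)) sums rank_gf z q"
proof -
  have q: "q \<noteq> 0" "norm q < 1" using r by (auto simp: q_def norm_power power_less_one_iff)
  have z0: "z \<noteq> 0" using z by auto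
  have qz: "norm (q / z) < 1" "norm (z * q) < 1" using q z by (auto simp: norm_divide norm_mult)
  \<comment> \<open>The k-th term of F(b,c;t) with b = -q/z, c = q^(N+2)/z and t = z q^(N+1); one
    application of the functional equation takes N to N + 1.\<close>
  define u where "u = (\<lambda>N k. qpoch (- q / z) q k / qpoch (q / z * q ^ Suc N) q k * (z * q * q ^ N) ^ k)"
  obtain B1 where B1: "B1 > 0" "\<And>n. norm (qpoch (- q / z) q n) \<le> B1" using qpoch_bounded[OF q(2)] by blast
  obtain B2 where B2: "B2 > 0" "\<And>m n. norm (inverse (qpoch (q / z * q ^ m) q n)) \<le> B2"
    using inverse_qpoch_shift_bounded[OF q(2) qz(1)] by blast
  have u_bound: "norm (u N k) \<le> B1 * B2 * norm q ^ k" for N k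
  proof -
    have "norm (z * q * q ^ N) \<le> norm q"
      using q z by (simp add: norm_mult norm_power mult_left_le power_le_one)
    then have "norm (z * q * q ^ N) ^ k \<le> norm q ^ k" by (intro power_mono) auto
    moreover have "norm (u N k) = norm (qpoch (- q / z) q k) * norm (inverse (qpoch (q / z * q ^ Suc N) q k)) * norm (z * q * q ^ N) ^ k"
      by (simp add: u_def divide_inverse norm_mult norm_power norm_inverse)
    ultimately show ?thesis using B1 B2 by (auto intro!: mult_mono simp del: power_Suc)
  qed
  have u_sum: "summable (\<lambda>k. B1 * B2 * norm q ^ k)" using q by (intro summable_mult summable_geometric) auto
  have summ: "summable (u N)" for N
    using u_sum by (rule summable_comparison_test'[where N = 0]) (use u_bound in auto)
  define F where "F = (\<lambda>N. suminf (u N))"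
  have F_bound: "norm (F N) \<le> (\<Sum>k. B1 * B2 * norm q ^ k)" for N
    unfolding F_def by (rule norm_suminf_le[OF u_bound u_sum])
  have nz1: "qpoch (q / z * q ^ m) q n \<noteq> 0" for m n
    by (rule qpoch_nonzero) (use norm_mult_power_less_one[OF qz(1) q(2)] q in auto)
  have nz2: "qpoch (z * q) q n \<noteq> 0" "qpoch (q / z) q n \<noteq> 0" for n by (rule qpoch_nonzero; use qz q in simp)+
  have nz3: "1 - z * q * q ^ n \<noteq> 0" "1 - q / z * q ^ n \<noteq> 0" for n
    using mult_power_neq_one[OF qz(2) q(2), of n] mult_power_neq_one[OF qz(1) q(2), of n] by auto
  have rec: "(1 - z * q * q ^ N) * F N = 1 + q ^ (N + 2) * (1 + q ^ Suc N) / (1 - q / z * q ^ Suc N) * F (Suc N)" for N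
  proof -
    define t c where "t = z * q * q ^ N" and "c = q / z * q ^ Suc N"
    have uN: "u N = (\<lambda>k. qpoch (- q / z) q k / qpoch c q k * t ^ k)" by (simp add: u_def t_def c_def)
    have uS: "u (Suc N) = (\<lambda>k. qpoch (- q / z) q k / qpoch (c * q) q k * (t * q) ^ k)"
      by (simp add: u_def t_def c_def mult_ac)
    have nz: "qpoch c q k \<noteq> 0" for k unfolding c_def by (rule nz1)
    have c1: "1 - c \<noteq> 0" using nz3(2)[of "Suc N"] by (simp add: c_def)
    have FS: "F N = 1 + (\<Sum>k. u N (Suc k))" unfolding F_def using suminf_split_head[OF summ, of N] by (simp add: uN)
    have tF: "t * F N = (\<Sum>k. t * u N k)" unfolding F_def by (rule suminf_mult[OF summ, symmetric])
    have "(1 - t) * F N = F N - t * F N" by (simp add: algebra_simps)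
    also have "\<dots> = 1 + ((\<Sum>k. u N (Suc k)) - (\<Sum>k. t * u N k))" unfolding tF by (subst FS) simp
    also have "(\<Sum>k. u N (Suc k)) - (\<Sum>k. t * u N k) = (\<Sum>k. u N (Suc k) - t * u N k)"
      by (rule suminf_diff) (use summ in \<open>auto simp: summable_Suc_iff intro: summable_mult\<close>)
    also have "(\<lambda>k. u N (Suc k) - t * u N k) = (\<lambda>k. (c + q / z) * t / (1 - c) * u (Suc N) k)"
    proof
      fix k
      have 1: "qpoch c q (Suc k) = (1 - c) * qpoch (c * q) q k" by (rule qpoch_Suc')
      have 2: "qpoch c q (Suc k) = qpoch c q k * (1 - c * q ^ k)" by (rule qpoch_Suc)
      have f: "1 - c * q ^ k \<noteq> 0" using nz[of "Suc k"] 2 by auto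
      have "u N (Suc k) - t * u N k = t * t ^ k * qpoch (- q / z) q k * ((1 + q / z * q ^ k) / qpoch c q (Suc k) - 1 / qpoch c q k)"
        unfolding uN qpoch_Suc[of "- q / z"] by (simp add: algebra_simps)
      also have "(1 + q / z * q ^ k) / qpoch c q (Suc k) - 1 / qpoch c q k = (c + q / z) * q ^ k / qpoch c q (Suc k)"
        unfolding 2 using nz[of k] f by (simp add: divide_simps) (simp add: algebra_simps)
      finally show "u N (Suc k) - t * u N k = (c + q / z) * t / (1 - c) * u (Suc N) k"
        unfolding 1 uS by (simp add: power_mult_distrib mult_ac)
    qed
    also have "(\<Sum>k. (c + q / z) * t / (1 - c) * u (Suc N) k) = (c + q / z) * t / (1 - c) * F (Suc N)"
      unfolding F_def by (rule suminf_mult[OF summ])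
    also have "(c + q / z) * t = q ^ (N + 2) * (1 + q ^ Suc N)"
      using z0 by (simp add: c_def t_def field_simps)
    finally show ?thesis by (simp add: t_def c_def)
  qed
  \<comment> \<open>The accumulated product of the coefficients in \<open>rec\<close>. The exponents
    n + 2 for n < N add up to N (N + 3) / 2, which is r^(N (N + 3)) in terms of r.\<close>
  define P where "P = (\<lambda>N. qpoch (- q) q N * r ^ (N * (N + 3)) / (qpoch (q / z * q) q N * qpoch (z * q) q N))"
  have iter: "F 0 = (\<Sum>n<N. P n / (1 - z * q * q ^ n)) + P N * F N" for N
  proof (induction N)
    case (Suc N)
    have "Suc N * (Suc N + 3) = N * (N + 3) + 2 * (N + 2)" by (simp add: algebra_simps)
    then have "r ^ (Suc N * (Suc N + 3)) = r ^ (N * (N + 3)) * r ^ (2 * (N + 2))"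
      by (simp only: power_add)
    also have "r ^ (2 * (N + 2)) = q ^ (N + 2)" by (simp only: q_def power_mult)
    finally have rp: "r ^ (Suc N * (Suc N + 3)) = r ^ (N * (N + 3)) * q ^ (N + 2)" .
    have PS: "P (Suc N) = P N * (q ^ (N + 2) * (1 + q ^ Suc N) / ((1 - q / z * q ^ Suc N) * (1 - z * q * q ^ N)))"
      unfolding P_def rp qpoch_Suc by (simp add: mult_ac)
    have "F N = (1 + q ^ (N + 2) * (1 + q ^ Suc N) / (1 - q / z * q ^ Suc N) * F (Suc N)) / (1 - z * q * q ^ N)"
      using rec[of N] nz3(1)[of N] by (simp add: field_simps)
    then have "P N * F N = P N / (1 - z * q * q ^ N) + P (Suc N) * F (Suc N)"
      unfolding PS by (simp add: add_divide_distrib distrib_left mult_ac)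
    then show ?case using Suc.IH by simp
  qed (simp add: P_def)
  have "P \<longlonglongrightarrow> 0"
  proof -
    have "(\<lambda>N. r ^ (N * (N + 3))) \<longlonglongrightarrow> 0"
    proof (rule Lim_null_comparison)
      show "(\<lambda>N. norm r ^ N) \<longlonglongrightarrow> 0" by (rule LIMSEQ_power_zero) (use r in auto)
      have "norm r ^ (N * (N + 3)) \<le> norm r ^ N" for N using r by (intro power_decreasing) auto
      then show "\<forall>\<^sub>F N in sequentially. norm (r ^ (N * (N + 3))) \<le> norm r ^ N" by (simp add: norm_power)
    qed
    moreover have "norm (q / z * q) < 1" using norm_mult_power_less_one[OF qz(1) q(2), of 1] by simp
    ultimately have "P \<longlonglongrightarrow> qpoch_inf (- q) q * 0 / (qpoch_inf (q / z * q) q * qpoch_inf (z * q) q)"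
      unfolding P_def by (intro tendsto_intros qpoch_tendsto) (use q qz in \<open>auto simp: qpoch_inf_nonzero\<close>)
    then show ?thesis by simp
  qed
  then have "(\<lambda>N. P N * F N) \<longlonglongrightarrow> 0"
    by (rule lim_null_mult_right_bounded[OF _ always_eventually]) (use F_bound in auto)
  then have "(\<lambda>N. F 0 - P N * F N) \<longlonglongrightarrow> F 0 - 0" by (intro tendsto_intros)
  moreover have "F 0 - P N * F N = (\<Sum>n<N. P n / (1 - z * q * q ^ n))" for N using iter[of N] by simp
  ultimately have sums1: "(\<lambda>n. P n / (1 - z * q * q ^ n)) sums F 0" by (simp add: sums_def)
  define a where "a = (\<lambda>N. qpoch (-1) q N * r ^ (N * (N + 1)) / (qpoch (z * q) q N * qpoch (q / z) q N))"
  \<comment> \<open>The factor 1 - q/z is missing from \<open>F 0\<close>, and the 2 comes from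
    (-1;q)_{n+1} = 2 (-q;q)_n; with both restored, the series for \<open>F 0\<close> is the target
    series from its second term on.\<close>
  have "(\<lambda>n. 2 * q / (1 - q / z) * (P n / (1 - z * q * q ^ n))) sums (2 * q / (1 - q / z) * F 0)"
    by (rule sums_mult[OF sums1])
  also have "(\<lambda>n. 2 * q / (1 - q / z) * (P n / (1 - z * q * q ^ n))) = (\<lambda>n. a (Suc n))"
  proof
    fix n
    have "Suc n * (Suc n + 1) = n * (n + 3) + 2" by (simp add: algebra_simps)
    then have "r ^ (Suc n * (Suc n + 1)) = r ^ (n * (n + 3)) * r ^ 2" by (simp only: power_add)
    then have 1: "r ^ (Suc n * (Suc n + 1)) = r ^ (n * (n + 3)) * q" by (simp add: q_def)
    have 2: "qpoch (-1) q (Suc n) = 2 * qpoch (- q) q n" by (simp add: qpoch_Suc')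
    have 3: "qpoch (q / z) q (Suc n) = (1 - q / z) * qpoch (q / z * q) q n" by (rule qpoch_Suc')
    show "2 * q / (1 - q / z) * (P n / (1 - z * q * q ^ n)) = a (Suc n)"
      unfolding a_def 1 2 3 P_def qpoch_Suc[of "z * q"] by (simp add: mult_ac)
  qed
  finally have "a sums (2 * q / (1 - q / z) * F 0 + a 0)" by (simp add: sums_Suc_iff)
  moreover have "2 * q / (1 - q / z) * F 0 + a 0 = rank_gf z q"
  proof -
    have "q / (1 - q / z) * F 0 = (\<Sum>k. q / (1 - q / z) * u 0 k)" unfolding F_def by (rule suminf_mult[OF summ, symmetric])
    also have "(\<lambda>k. q / (1 - q / z) * u 0 k) = (\<lambda>k. z ^ k * q ^ Suc k * qpoch (- q / z) q k / qpoch (q / z) q (Suc k))"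
      unfolding qpoch_Suc'[of "q / z"] by (simp add: u_def power_mult_distrib mult_ac)
    finally have "2 * (q / (1 - q / z) * F 0) = 2 * (\<Sum>k. z ^ k * q ^ Suc k * qpoch (- q / z) q k / qpoch (q / z) q (Suc k))"
      by (rule arg_cong)
    moreover have "2 * q / (1 - q / z) * F 0 = 2 * (q / (1 - q / z) * F 0)" by simp
    ultimately show ?thesis unfolding rank_gf_def a_def by simp
  qed
  ultimately show ?thesis by (simp add: a_def)
qed

theorem rank_gf_appell:
  fixes q z :: complex
  assumes q: "q \<noteq> 0" "norm q < 1" and z: "norm z = 1" "z \<noteq> 1"
  shows "rank_gf z q = qpoch_inf (-q) q / qpoch_inf q q * rank_appell z q"
proof -
  define r where "r = csqrt q"
  have r2: "r^2 = q" by (simp add: r_def)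
  have r: "r \<noteq> 0" "norm r < 1" using q by (auto simp: r_def norm_csqrt real_sqrt_lt_1_iff)
  show ?thesis
    using sums_unique2[OF rank_gf_durfee[OF r z(1)] durfee_sum_appell[OF r z]] by (simp add: r2)
qed

section \<open>Overpartitions\<close>

lemma has_sum_product:
  fixes f :: "'a \<Rightarrow> complex" and g :: "'b \<Rightarrow> complex"
  assumes f: "(\<lambda>x. norm (f x)) summable_on A" "(f has_sum S) A"
    and g: "(\<lambda>y. norm (g y)) summable_on B" "(g has_sum T) B"
  shows "(\<lambda>(x, y). norm (f x * g y)) summable_on A \<times> B"
    and "((\<lambda>(x, y). f x * g y) has_sum S * T) (A \<times> B)"
proof -
  show 1: "(\<lambda>(x, y). norm (f x * g y)) summable_on A \<times> B"
  proof (rule summable_on_SigmaI)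
    show "((\<lambda>y. case (x, y) of (x, y) \<Rightarrow> norm (f x * g y)) has_sum norm (f x) * (\<Sum>\<^sub>\<infinity>y\<in>B. norm (g y))) B" for x
      unfolding prod.case norm_mult by (rule has_sum_cmult_right[OF has_sum_infsum[OF g(1)]])
    show "(\<lambda>x. norm (f x) * (\<Sum>\<^sub>\<infinity>y\<in>B. norm (g y))) summable_on A" by (rule summable_on_cmult_left[OF f(1)])
  qed auto
  have "(\<lambda>xy. norm (case xy of (x, y) \<Rightarrow> f x * g y)) summable_on A \<times> B"
    using 1 by (simp add: case_prod_unfold)
  then have 2: "(\<lambda>(x, y). f x * g y) summable_on A \<times> B" by (rule abs_summable_summable)
  show "((\<lambda>(x, y). f x * g y) has_sum S * T) (A \<times> B)"
  proof (rule has_sum_SigmaI[OF _ _ 2])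
    show "((\<lambda>y. case (x, y) of (x, y) \<Rightarrow> f x * g y) has_sum f x * T) B" for x
      unfolding prod.case by (rule has_sum_cmult_right[OF g(2)])
    show "((\<lambda>x. f x * T) has_sum S * T) A" by (rule has_sum_cmult_left[OF f(2)])
  qed
qed

section \<open>Overpartitions classified by their largest part\<close>

definition parts_le :: "nat \<Rightarrow> nat multiset set" where
  "parts_le k = {M. set_mset M \<subseteq> {1..k}}"

text \<open>The power of 2 counts the sets of part sizes that may be overlined. Used with w = 1/z,
  since the number of parts enters the rank negatively.\<close>

definition overline_weight :: "complex \<Rightarrow> complex \<Rightarrow> nat multiset \<Rightarrow> complex" where
  "overline_weight w q M = 2 ^ card (set_mset M) * w ^ size M * q ^ sum_mset M"

definition repeat_weight :: "complex \<Rightarrow> nat \<Rightarrow> complex" where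
  "repeat_weight x c = (if c = 0 then 1 else 2) * x ^ c"

lemma repeat_weight_has_sum:
  assumes "norm x < 1"
  shows "(\<lambda>c. norm (repeat_weight x c)) summable_on UNIV" "(repeat_weight x has_sum (1 + x) / (1 - x)) UNIV"
    and "(\<lambda>c. norm (repeat_weight x c)) summable_on {1..}" "(repeat_weight x has_sum 2 * x / (1 - x)) {1..}"
proof -
  have x: "x \<noteq> 1" using assms by auto
  have s: "summable (\<lambda>c. norm (repeat_weight x c))"
  proof (rule summable_comparison_test'[where N = 0])
    show "summable (\<lambda>c. 2 * norm x ^ c)" using assms by (intro summable_mult summable_geometric) auto
  qed (auto simp: repeat_weight_def norm_mult norm_power)
  then show s1: "(\<lambda>c. norm (repeat_weight x c)) summable_on UNIV" by (simp add: summable_on_UNIV_nonneg_real_iff)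
  then show "(\<lambda>c. norm (repeat_weight x c)) summable_on {1..}" by (rule summable_on_subset) auto
  have "(\<lambda>c. 2 * x * x ^ c) sums (2 * x * (1 / (1 - x)))" by (intro sums_mult geometric_sums assms)
  then have "(\<lambda>c. repeat_weight x (Suc c)) sums (2 * x / (1 - x))" by (simp add: repeat_weight_def mult_ac)
  then have "repeat_weight x sums (2 * x / (1 - x) + repeat_weight x 0)" by (simp add: sums_Suc_iff)
  moreover have "2 * x / (1 - x) + repeat_weight x 0 = (1 + x) / (1 - x)" using x by (simp add: repeat_weight_def field_simps)
  ultimately have "repeat_weight x sums ((1 + x) / (1 - x))" by simp
  with s show h: "(repeat_weight x has_sum (1 + x) / (1 - x)) UNIV" by (rule norm_summable_imp_has_sum)
  have "(repeat_weight x has_sum ((1 + x) / (1 - x) - 1)) (UNIV - {0})"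
    by (rule has_sum_Diff[OF h]) (auto intro!: has_sum_finiteI simp: repeat_weight_def)
  moreover have "UNIV - {0} = {1::nat..}" by auto
  moreover have "(1 + x) / (1 - x) - 1 = 2 * x / (1 - x)" using x by (simp add: field_simps)
  ultimately show "(repeat_weight x has_sum 2 * x / (1 - x)) {1..}" by simp
qed

lemma overline_weight_add:
  assumes "M \<in> parts_le k"
  shows "overline_weight w q (M + replicate_mset c (Suc k)) = overline_weight w q M * repeat_weight (w * q ^ Suc k) c"
proof -
  have "Suc k \<notin> set_mset M" using assms by (auto simp: parts_le_def)
  then have "card (set_mset (M + replicate_mset c (Suc k))) = card (set_mset M) + (if c = 0 then 0 else 1)" by simp
  then show ?thesis
    by (simp add: overline_weight_def repeat_weight_def power_add power_mult_distrib mult_ac flip: power_mult power_Suc)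
qed

lemma parts_le_remove:
  assumes "M \<in> parts_le (Suc k)"
  shows "filter_mset (\<lambda>x. x \<noteq> Suc k) M \<in> parts_le k"
    and "filter_mset (\<lambda>x. x \<noteq> Suc k) M + replicate_mset (count M (Suc k)) (Suc k) = M"
proof -
  show "filter_mset (\<lambda>x. x \<noteq> Suc k) M \<in> parts_le k" using assms by (force simp: parts_le_def)
  show "filter_mset (\<lambda>x. x \<noteq> Suc k) M + replicate_mset (count M (Suc k)) (Suc k) = M"
    by (rule multiset_eqI) auto
qed

lemma parts_le_add:
  assumes "M \<in> parts_le k"
  shows "M + replicate_mset c (Suc k) \<in> parts_le (Suc k)"
    and "filter_mset (\<lambda>x. x \<noteq> Suc k) (M + replicate_mset c (Suc k)) = M"
    and "count (M + replicate_mset c (Suc k)) (Suc k) = c"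
proof -
  have n: "Suc k \<notin># M" using assms by (auto simp: parts_le_def)
  show "M + replicate_mset c (Suc k) \<in> parts_le (Suc k)"
    using assms by (fastforce simp: parts_le_def split: if_splits)
  show "filter_mset (\<lambda>x. x \<noteq> Suc k) (M + replicate_mset c (Suc k)) = M"
    using n by (intro multiset_eqI) (auto simp: not_in_iff)
  show "count (M + replicate_mset c (Suc k)) (Suc k) = c" using n by (simp add: not_in_iff)
qed

lemma has_sum_parts_le_Suc:
  "((\<lambda>(M, c). f (M + replicate_mset c (Suc k))) has_sum S) (parts_le k \<times> UNIV) \<longleftrightarrow> (f has_sum S) (parts_le (Suc k))"
proof (rule has_sum_reindex_bij_witness[where j = "\<lambda>(M, c). M + replicate_mset c (Suc k)"
        and i = "\<lambda>M. (filter_mset (\<lambda>x. x \<noteq> Suc k) M, count M (Suc k))"], goal_cases)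
  case (1 a)
  then obtain M c where "a = (M, c)" "M \<in> parts_le k" by auto
  then show ?case by (simp only: prod.case parts_le_add)
next
  case (2 a)
  then obtain M c where "a = (M, c)" "M \<in> parts_le k" by auto
  then show ?case by (simp only: prod.case parts_le_add)
next
  case (3 M)
  then show ?case by (simp only: prod.case parts_le_remove)
next
  case (4 M)
  then show ?case by (simp only: parts_le_remove mem_Times_iff fst_conv snd_conv) simp
qed auto

lemma overline_weight_has_sum:
  assumes q: "norm q < 1" and w: "norm w = 1"
  shows "(\<lambda>M. norm (overline_weight w q M)) summable_on parts_le k"
    and "(overline_weight w q has_sum (qpoch (- q * w) q k / qpoch (q * w) q k)) (parts_le k)"
proof (induction k)
  have e: "parts_le 0 = {{#}}" by (auto simp: parts_le_def)
  case 0
  show "(\<lambda>M. norm (overline_weight w q M)) summable_on parts_le 0"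
    and "(overline_weight w q has_sum (qpoch (- q * w) q 0 / qpoch (q * w) q 0)) (parts_le 0)"
    unfolding e by (auto intro!: has_sum_finiteI simp: overline_weight_def)
next
  case (Suc k)
  define x where "x = w * q ^ Suc k"
  have x: "norm x < 1" using q w by (simp add: x_def norm_mult norm_power power_less_one_iff del: power_Suc)
  note P = has_sum_product[OF Suc.IH repeat_weight_has_sum(1,2)[OF x]]
  have "((\<lambda>(M, c). norm (overline_weight w q M * repeat_weight x c)) has_sum
     (\<Sum>\<^sub>\<infinity>(M, c)\<in>parts_le k \<times> UNIV. norm (overline_weight w q M * repeat_weight x c))) (parts_le k \<times> UNIV)"
    using P(1) by (rule has_sum_infsum)
  also have "?this \<longleftrightarrow> ((\<lambda>(M, c). norm (overline_weight w q (M + replicate_mset c (Suc k)))) has_sum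
     (\<Sum>\<^sub>\<infinity>(M, c)\<in>parts_le k \<times> UNIV. norm (overline_weight w q M * repeat_weight x c))) (parts_le k \<times> UNIV)"
    by (intro has_sum_cong) (auto simp: overline_weight_add x_def)
  finally show "(\<lambda>M. norm (overline_weight w q M)) summable_on parts_le (Suc k)"
    unfolding has_sum_parts_le_Suc[of "\<lambda>M. norm (overline_weight w q M)"] by (rule has_sum_imp_summable)
  have "((\<lambda>(M, c). overline_weight w q M * repeat_weight x c) has_sum
     (qpoch (- q * w) q k / qpoch (q * w) q k * ((1 + x) / (1 - x)))) (parts_le k \<times> UNIV)"
    by (rule P(2))
  also have "?this \<longleftrightarrow> ((\<lambda>(M, c). overline_weight w q (M + replicate_mset c (Suc k))) has_sum
     (qpoch (- q * w) q k / qpoch (q * w) q k * ((1 + x) / (1 - x)))) (parts_le k \<times> UNIV)"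
    by (intro has_sum_cong) (auto simp: overline_weight_add x_def)
  finally have "(overline_weight w q has_sum (qpoch (- q * w) q k / qpoch (q * w) q k * ((1 + x) / (1 - x)))) (parts_le (Suc k))"
    unfolding has_sum_parts_le_Suc .
  then show "(overline_weight w q has_sum (qpoch (- q * w) q (Suc k) / qpoch (q * w) q (Suc k))) (parts_le (Suc k))"
    by (simp add: qpoch_Suc x_def mult_ac)
qed

definition rank_weight :: "complex \<Rightarrow> complex \<Rightarrow> nat multiset \<Rightarrow> complex" where
  "rank_weight z q M = z powi (overpartition_rank (M, {})) * 2 ^ card (set_mset M) * q ^ sum_mset M"

text \<open>A nonempty multiset of positive parts is encoded by its largest part \<open>k + 1\<close>, the multiset of
  its smaller parts, and the multiplicity of the largest part.\<close>

definition max_encoding :: "(nat \<times> nat multiset \<times> nat) set" where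
  "max_encoding = (SIGMA k:UNIV. parts_le k \<times> {1..})"

lemma has_sum_max_encoding:
  "((\<lambda>(k, M, c). f (M + replicate_mset c (Suc k))) has_sum S) max_encoding \<longleftrightarrow>
     (f has_sum S) {M. 0 \<notin># M \<and> M \<noteq> {#}}"
proof -
  define pre where "pre = (\<lambda>M::nat multiset. Max (set_mset M) - 1)"
  have Mx: "Suc (pre M) = Max (set_mset M)" "M \<in> parts_le (Suc (pre M))" "count M (Suc (pre M)) \<ge> 1"
    if "0 \<notin># M" "M \<noteq> {#}" for M
  proof -
    have in': "Max (set_mset M) \<in># M" using that by (intro Max_in) auto
    then have "Max (set_mset M) \<noteq> 0" using that(1) by (intro notI) (simp only:)
    then show 1: "Suc (pre M) = Max (set_mset M)" by (simp add: pre_def)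
    have "x \<ge> 1" if "x \<in># M" for x using that \<open>0 \<notin># M\<close> by (cases x) auto
    then show "M \<in> parts_le (Suc (pre M))" unfolding 1 by (auto simp: parts_le_def)
    show "count M (Suc (pre M)) \<ge> 1" unfolding 1 using in' by (simp add: Suc_le_eq)
  qed
  have Mx': "pre (M + replicate_mset c (Suc k)) = k" if "M \<in> parts_le k" "c \<ge> 1" for M c k
  proof -
    have "Max (set_mset (M + replicate_mset c (Suc k))) = Suc k"
      using that by (intro Max_eqI) (auto simp: parts_le_def split: if_splits)
    then show ?thesis by (simp add: pre_def)
  qed
  show ?thesis
  proof (rule has_sum_reindex_bij_witness[where j = "\<lambda>(k, M, c). M + replicate_mset c (Suc k)"
        and i = "\<lambda>M. (pre M, filter_mset (\<lambda>x. x \<noteq> Suc (pre M)) M, count M (Suc (pre M)))"], goal_cases)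
    case (1 a)
    then obtain k M c where "a = (k, M, c)" "M \<in> parts_le k" "c \<ge> 1" by (auto simp: max_encoding_def)
    then show ?case by (simp only: prod.case Mx' parts_le_add)
  next
    case (2 a)
    then obtain k M c where "a = (k, M, c)" "M \<in> parts_le k" "c \<ge> 1" by (auto simp: max_encoding_def)
    then show ?case by (auto simp: parts_le_def split: if_splits)
  next
    case (3 M)
    then have "0 \<notin># M" "M \<noteq> {#}" by auto
    then show ?case unfolding prod.case by (rule parts_le_remove(2)[OF Mx(2)])
  next
    case (4 M)
    then have "0 \<notin># M" "M \<noteq> {#}" by auto
    from Mx(2,3)[OF this] show ?case
      unfolding max_encoding_def by (intro SigmaI UNIV_I parts_le_remove(1)) auto
  qed auto
qed

lemma rank_weight_encoding:
  assumes "M \<in> parts_le k" "c \<ge> 1" "z \<noteq> 0"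
  shows "rank_weight z q (M + replicate_mset c (Suc k)) =
    z ^ Suc k * (overline_weight (1 / z) q M * repeat_weight (1 / z * q ^ Suc k) c)"
proof -
  define N where "N = M + replicate_mset c (Suc k)"
  have "Max (set_mset N) = Suc k"
    unfolding N_def using assms by (intro Max_eqI) (auto simp: parts_le_def split: if_splits)
  moreover have "N \<noteq> {#}" using assms by (auto simp: N_def)
  ultimately have "z powi (overpartition_rank (N, {})) = z powi (int (Suc k) - int (size N))"
    by simp
  also have "\<dots> = z ^ Suc k * (1 / z) ^ size N"
    using assms by (simp add: power_int_diff power_one_over del: of_nat_Suc power_Suc)
  finally have "rank_weight z q N = z ^ Suc k * overline_weight (1 / z) q N"
    by (simp add: rank_weight_def overline_weight_def mult_ac)
  then show ?thesis unfolding N_def overline_weight_add[OF assms(1)] .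
qed

text \<open>The smaller parts and the multiplicity of the largest part vary independently. That
  multiplicity is at least 1, so it contributes 2 x / (1 - x) with x = q^(k+1)/z, and x absorbs one
  of the k + 1 powers of z.\<close>

lemma rank_weight_row:
  fixes q z :: complex
  assumes q: "q \<noteq> 0" "norm q < 1" and z: "norm z = 1"
  shows "((\<lambda>(M, c). rank_weight z q (M + replicate_mset c (Suc k))) has_sum
     2 * (z ^ k * q ^ Suc k * qpoch (- q / z) q k / qpoch (q / z) q (Suc k))) (parts_le k \<times> {1..})"
proof -
  define x where "x = 1 / z * q ^ Suc k"
  have z0: "z \<noteq> 0" using z by auto
  have z1: "norm (1 / z) = 1" using z by (simp add: norm_divide)
  have x: "norm x < 1" using q z1 by (simp add: x_def norm_mult norm_power norm_divide z power_less_one_iff del: power_Suc)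
  have "((\<lambda>(M, c). overline_weight (1 / z) q M * repeat_weight x c) has_sum
     (qpoch (- q * (1 / z)) q k / qpoch (q * (1 / z)) q k * (2 * x / (1 - x)))) (parts_le k \<times> {1..})"
    by (rule has_sum_product(2)[OF overline_weight_has_sum[OF q(2) z1] repeat_weight_has_sum(3,4)[OF x]])
  then have "((\<lambda>p. z ^ Suc k * (case p of (M, c) \<Rightarrow> overline_weight (1 / z) q M * repeat_weight x c)) has_sum
     z ^ Suc k * (qpoch (- q * (1 / z)) q k / qpoch (q * (1 / z)) q k * (2 * x / (1 - x)))) (parts_le k \<times> {1..})"
    by (rule has_sum_cmult_right)
  also have "?this \<longleftrightarrow> ((\<lambda>(M, c). rank_weight z q (M + replicate_mset c (Suc k))) has_sum
     z ^ Suc k * (qpoch (- q * (1 / z)) q k / qpoch (q * (1 / z)) q k * (2 * x / (1 - x)))) (parts_le k \<times> {1..})"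
    by (intro has_sum_cong) (auto simp: rank_weight_encoding[OF _ _ z0] x_def)
  also have "z ^ Suc k * (qpoch (- q * (1 / z)) q k / qpoch (q * (1 / z)) q k * (2 * x / (1 - x))) =
     2 * (z ^ k * q ^ Suc k * qpoch (- q / z) q k / qpoch (q / z) q (Suc k))"
    using z0 by (simp add: qpoch_Suc x_def)
  finally show ?thesis .
qed

lemma norm_rank_weight:
  assumes "norm z = 1"
  shows "complex_of_real (norm (rank_weight z q M)) = rank_weight 1 (of_real (norm q)) M"
  using assms by (simp add: rank_weight_def norm_mult norm_power norm_power_int)

lemma rank_weight_has_sum:
  fixes q z :: complex
  assumes q: "q \<noteq> 0" "norm q < 1" and z: "norm z = 1"
  shows "(\<lambda>M. norm (rank_weight z q M)) summable_on {M. 0 \<notin># M}"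
    and "(rank_weight z q has_sum rank_gf z q) {M. 0 \<notin># M}"
proof -
  define f where "f = (\<lambda>(k, M, c). rank_weight z q (M + replicate_mset c (Suc k)))"
  define T where "T = (\<lambda>z q k. 2 * (z ^ k * q ^ Suc k * qpoch (- q / z) q k / qpoch (q / z) q (Suc k)))"
  \<comment> \<open>For |z| = 1 the norms of the weights are the weights for z = 1 and base |q|, so
    absolute summability follows from the row sums already known for these values.\<close>
  define q' where "q' = complex_of_real (norm q)"
  have q': "q' \<noteq> 0" "norm q' < 1" using q by (auto simp: q'_def)
  have T_summable: "(\<lambda>k. T 1 q' k) sums (2 * (\<Sum>k. 1 ^ k * q' ^ Suc k * qpoch (- q' / 1) q' k / qpoch (q' / 1) q' (Suc k)))"
    unfolding T_def by (intro sums_mult summable_sums summable_rank_gf q') simp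
  have T_sums: "T z q sums (rank_gf z q - 1)"
  proof -
    have "T z q sums (2 * (\<Sum>k. z ^ k * q ^ Suc k * qpoch (- q / z) q k / qpoch (q / z) q (Suc k)))"
      unfolding T_def by (intro sums_mult summable_sums summable_rank_gf q z)
    then show ?thesis by (simp add: rank_gf_def)
  qed
  have row: "((\<lambda>p. norm (f (k, p))) has_sum Re (T 1 q' k)) (parts_le k \<times> {1..})" for k
  proof -
    have "((\<lambda>(M, c). rank_weight 1 q' (M + replicate_mset c (Suc k))) has_sum T 1 q' k) (parts_le k \<times> {1..})"
      unfolding T_def by (rule rank_weight_row[OF q']) simp
    from has_sum_Re[OF this]
    have "((\<lambda>p. Re (case p of (M, c) \<Rightarrow> rank_weight 1 q' (M + replicate_mset c (Suc k)))) has_sum Re (T 1 q' k)) (parts_le k \<times> {1..})" .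
    also have "(\<lambda>p. Re (case p of (M, c) \<Rightarrow> rank_weight 1 q' (M + replicate_mset c (Suc k)))) = (\<lambda>p. norm (f (k, p)))"
      by (auto simp: f_def q'_def norm_rank_weight[OF z, symmetric] split: prod.splits)
    finally show ?thesis .
  qed
  have norm_f: "(\<lambda>x. norm (f x)) summable_on max_encoding"
    unfolding max_encoding_def
  proof (rule summable_on_SigmaI[OF row])
    have "summable (\<lambda>k. Re (T 1 q' k))" using T_summable by (intro summable_Re) (auto simp: sums_iff)
    moreover have "Re (T 1 q' k) \<ge> 0" for k using row[of k] by (rule has_sum_nonneg) auto
    ultimately show "(\<lambda>k. Re (T 1 q' k)) summable_on UNIV" by (simp add: summable_on_UNIV_nonneg_real_iff)
  qed auto
  define A where "A = {M::nat multiset. 0 \<notin># M \<and> M \<noteq> {#}}"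
  have A: "{M::nat multiset. 0 \<notin># M} = insert {#} A" "{#} \<notin> A" by (auto simp: A_def)
  have "((\<lambda>x. norm (f x)) has_sum infsum (\<lambda>x. norm (f x)) max_encoding) max_encoding" using norm_f by (rule has_sum_infsum)
  also have "(\<lambda>x. norm (f x)) = (\<lambda>(k, M, c). norm (rank_weight z q (M + replicate_mset c (Suc k))))"
    by (auto simp: f_def)
  finally have nA: "(\<lambda>M. norm (rank_weight z q M)) summable_on A"
    unfolding has_sum_max_encoding[of "\<lambda>M. norm (rank_weight z q M)"] A_def by (rule has_sum_imp_summable)
  then show "(\<lambda>M. norm (rank_weight z q M)) summable_on {M. 0 \<notin># M}" unfolding A by (simp add: summable_on_insert_iff)
  have f_sum: "(f has_sum infsum f max_encoding) max_encoding" by (rule has_sum_infsum[OF abs_summable_summable[OF norm_f]])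
  have "(T z q has_sum infsum f max_encoding) UNIV"
  proof (rule has_sum_SigmaD[where f = f and A = UNIV and B = "\<lambda>k. parts_le k \<times> {1..}"])
    show "(f has_sum infsum f max_encoding) (SIGMA k:UNIV. parts_le k \<times> {1..})"
      using f_sum by (simp add: max_encoding_def)
    show "((\<lambda>y. f (k, y)) has_sum T z q k) (parts_le k \<times> {1..})" for k
      using rank_weight_row[OF q z, of k] by (simp add: f_def T_def case_prod_unfold)
  qed
  then have "T z q sums infsum f max_encoding" by (rule has_sum_imp_sums)
  then have "infsum f max_encoding = rank_gf z q - 1" using T_sums sums_unique2 by blast
  with f_sum have "((\<lambda>(k, M, c). rank_weight z q (M + replicate_mset c (Suc k))) has_sum (rank_gf z q - 1)) max_encoding"
    by (simp add: f_def)
  then have "(rank_weight z q has_sum (rank_gf z q - 1)) A" unfolding has_sum_max_encoding A_def .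
  from has_sum_insert[OF A(2) this] show "(rank_weight z q has_sum rank_gf z q) {M. 0 \<notin># M}"
    unfolding A by (simp add: rank_weight_def)
qed

lemma finite_overpartitions: "finite (overpartitions n)"
proof -
  have "overpartitions n \<subseteq> (mset ` {xs. set xs \<subseteq> {..n} \<and> length xs \<le> n}) \<times> Pow {..n}"
  proof
    fix p assume "p \<in> overpartitions n"
    then obtain M S where p: "p = (M, S)" "0 \<notin># M" "sum_mset M = n" "S \<subseteq> set_mset M" by (auto simp: overpartitions_def)
    obtain xs where xs: "M = mset xs" by (metis ex_mset)
    have sz: "size N \<le> sum_mset N" if "0 \<notin># N" for N :: "nat multiset"
      using that by (induction N) auto
    have le: "x \<le> n" if "x \<in># M" for x using that p(3) by (metis sum_mset.remove le_add1)
    have "set xs \<subseteq> {..n}" "length xs \<le> n" using le sz[OF p(2)] p(3) by (auto simp: xs)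
    then show "p \<in> (mset ` {xs. set xs \<subseteq> {..n} \<and> length xs \<le> n}) \<times> Pow {..n}"
      using p xs le by fastforce
  qed
  moreover have "finite {xs::nat list. set xs \<subseteq> {..n} \<and> length xs \<le> n}" by (rule finite_lists_length_le) simp
  ultimately show ?thesis by (meson finite_Pow_iff finite_SigmaI finite_atMost finite_imageI finite_subset)
qed

lemma overpartition_rank_marks: "overpartition_rank (M, S) = overpartition_rank (M, {})"
  by simp

text \<open>Two iterated sums of one absolutely summable family over the pairs (M, S): summing over
  S first produces \<open>rank_weight\<close>, grouping by the sum of the parts produces the power
  series.\<close>

theorem rank_generating_function:
  fixes q z :: complex
  assumes q: "q \<noteq> 0" "norm q < 1" and z: "norm z = 1"
  shows "(\<lambda>n. (\<Sum>p\<in>overpartitions n. z powi overpartition_rank p) * q ^ n) sums rank_gf z q"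
proof -
  define h where "h = (\<lambda>(M, S::nat set). z powi (overpartition_rank (M, {})) * q ^ sum_mset M)"
  define B where "B = (SIGMA M:{M::nat multiset. 0 \<notin># M}. Pow (set_mset M))"
  have row: "((\<lambda>S. h (M, S)) has_sum rank_weight z q M) (Pow (set_mset M))" for M
    by (rule has_sum_finiteI) (auto simp: h_def rank_weight_def card_Pow mult_ac)
  have row': "((\<lambda>S. norm (h (M, S))) has_sum norm (rank_weight z q M)) (Pow (set_mset M))" for M
    by (rule has_sum_finiteI) (auto simp: h_def rank_weight_def card_Pow norm_mult norm_power mult_ac)
  have "(\<lambda>x. norm (h x)) summable_on B"
    unfolding B_def by (rule summable_on_SigmaI[OF row' rank_weight_has_sum(1)[OF q z]]) auto
  then have "h summable_on B" by (rule abs_summable_summable)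
  then have hB: "(h has_sum rank_gf z q) B"
    unfolding B_def by (intro has_sum_SigmaI[OF row rank_weight_has_sum(2)[OF q z]]) (auto simp: B_def)
  have "((\<lambda>(n, p). h p) has_sum rank_gf z q) (SIGMA n:UNIV. overpartitions n) \<longleftrightarrow> (h has_sum rank_gf z q) B"
    by (rule has_sum_reindex_bij_witness[where j = snd and i = "\<lambda>(M, S). (sum_mset M, (M, S))"])
      (auto simp: overpartitions_def B_def)
  with hB have "((\<lambda>(n, p). h p) has_sum rank_gf z q) (SIGMA n:UNIV. overpartitions n)" by simp
  then have "((\<lambda>n. \<Sum>p\<in>overpartitions n. h p) has_sum rank_gf z q) UNIV"
    by (rule has_sum_SigmaD) (auto intro: has_sum_finite finite_overpartitions)
  then have "(\<lambda>n. \<Sum>p\<in>overpartitions n. h p) sums rank_gf z q" by (rule has_sum_imp_sums)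
  moreover have "(\<Sum>p\<in>overpartitions n. h p) = (\<Sum>p\<in>overpartitions n. z powi overpartition_rank p) * q ^ n" for n
    unfolding sum_distrib_right
    by (intro sum.cong refl) (auto simp: h_def overpartitions_def simp del: overpartition_rank.simps intro!: arg_cong[of _ _ "\<lambda>r. z powi r * _"] overpartition_rank_marks[symmetric])
  ultimately show ?thesis by simp
qed

lemma rank_residue_sum:
  fixes z :: complex
  assumes z: "z ^ 6 = 1"
  shows "(\<Sum>p\<in>overpartitions n. z powi overpartition_rank p) = (\<Sum>s<6. z ^ s * of_nat (Nbar (int s) 6 n))"
proof -
  have z0: "z \<noteq> 0" using z by auto
  define g where "g = (\<lambda>p. nat (overpartition_rank p mod 6))"
  have zg: "z powi overpartition_rank p = z ^ g p" for p
  proof -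
    define m where "m = overpartition_rank p"
    have "z powi m = z powi (6 * (m div 6) + m mod 6)" by simp
    also have "\<dots> = z powi (6 * (m div 6)) * z powi (m mod 6)"
      by (rule power_int_add) (use z0 in simp)
    also have "z powi (6 * (m div 6)) = (z ^ 6) powi (m div 6)"
      using power_int_power[of z 6 "m div 6"] by simp
    finally show ?thesis by (simp add: z g_def m_def power_int_nonneg_exp)
  qed
  have "(\<Sum>p\<in>overpartitions n. z ^ g p) = (\<Sum>s\<in>{..<6}. \<Sum>p\<in>{p \<in> overpartitions n. g p = s}. z ^ g p)"
    by (rule sum.group[symmetric]) (auto simp: finite_overpartitions g_def nat_less_iff)
  also have "\<dots> = (\<Sum>s<6. z ^ s * of_nat (Nbar (int s) 6 n))"
  proof (rule sum.cong[OF refl])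
    fix s :: nat assume s: "s \<in> {..<6}"
    then have e: "{p \<in> overpartitions n. g p = s} = {p \<in> overpartitions n. [overpartition_rank p = int s] (mod int 6)}"
      by (auto simp: g_def cong_def nat_eq_iff)
    have "(\<Sum>p\<in>{p \<in> overpartitions n. g p = s}. z ^ g p) = (\<Sum>p\<in>{p \<in> overpartitions n. g p = s}. z ^ s)"
      by (rule sum.cong) auto
    also have "\<dots> = z ^ s * of_nat (Nbar (int s) 6 n)"
      unfolding Nbar_def e by simp
    finally show "(\<Sum>p\<in>{p \<in> overpartitions n. g p = s}. z ^ g p) = z ^ s * of_nat (Nbar (int s) 6 n)" .
  qed
  finally show ?thesis unfolding zg .
qed

section \<open>Appell sums and elliptic functions\<close>

text \<open>The coefficients are left general because differentiation replaces c n by c n / (1 - w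
  q^n), and because the even part of f has numerators of base p over poles of base p^2.\<close>

definition lerch_sum :: "(int \<Rightarrow> complex) \<Rightarrow> complex \<Rightarrow> complex \<Rightarrow> complex" where
  "lerch_sum c q z = (\<Sum>\<^sub>\<infinity>n. c n / (1 - z * q powi n))"

text \<open>On an annulus only finitely many denominators can be small: z q^n is close to 0 for
  large n and of large modulus for very negative n, uniformly in z.\<close>

lemma one_minus_power_int_far:
  fixes q :: complex
  assumes q: "q \<noteq> 0" "norm q < 1" and R: "0 < \<rho>"
  obtains N :: nat where "\<And>n z. \<bar>n\<bar> > int N \<Longrightarrow> \<rho> \<le> norm z \<Longrightarrow> norm z \<le> R \<Longrightarrow> norm (1 - z * q powi n) \<ge> 1/2"
proof -
  have "(\<lambda>n. norm q ^ n) \<longlonglongrightarrow> 0" using q by (intro LIMSEQ_power_zero) auto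
  then have "\<forall>\<^sub>F n in sequentially. norm q ^ n < min (1 / (2 * (\<bar>R\<bar> + 1))) (\<rho> / 2)"
    by (rule order_tendstoD) (use R in auto)
  then obtain N where N: "\<And>n. n \<ge> N \<Longrightarrow> norm q ^ n < min (1 / (2 * (\<bar>R\<bar> + 1))) (\<rho> / 2)"
    by (auto simp: eventually_sequentially)
  show ?thesis
  proof (rule that[of N])
    fix n :: int and z :: complex assume n: "\<bar>n\<bar> > int N" and z: "\<rho> \<le> norm z" "norm z \<le> R"
    show "norm (1 - z * q powi n) \<ge> 1/2"
    proof (cases "n > 0")
      case True
      then have "norm q ^ nat n < 1 / (2 * (\<bar>R\<bar> + 1))" using N[of "nat n"] n by auto
      then have "norm z * norm q ^ nat n \<le> R * (1 / (2 * (\<bar>R\<bar> + 1)))"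
        using z by (intro mult_mono) (auto intro: order_trans[OF norm_ge_zero])
      also have "\<dots> \<le> (\<bar>R\<bar> + 1) * (1 / (2 * (\<bar>R\<bar> + 1)))" by (intro mult_right_mono) auto
      also have "\<dots> = 1/2" using abs_ge_zero[of R] by (simp add: field_simps)
      finally have "norm (z * q powi n) \<le> 1/2" using True by (simp add: norm_mult norm_power power_int_nonneg_exp)
      then show ?thesis using norm_triangle_ineq2[of 1 "z * q powi n"] by simp
    next
      case False
      define m where "m = nat (- n)"
      have n': "n = - int m" using False by (simp add: m_def)
      have "norm q ^ m < \<rho> / 2" using N[of m] n n' by auto
      then have "2 * norm q ^ m \<le> norm z" using z by linarith
      then have "norm z / norm q ^ m \<ge> 2" using q by (simp add: field_simps)
      then have "norm (z * q powi n) \<ge> 2"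
        unfolding n' power_int_minus power_int_of_nat by (simp add: norm_mult norm_inverse norm_power divide_inverse)
      then show ?thesis using norm_triangle_ineq2[of "z * q powi n" 1] by (simp add: norm_minus_commute)
    qed
  qed
qed

lemma theta_j_nonzero_iff:
  assumes "norm q < 1" "q \<noteq> 0" "z \<noteq> 0"
  shows "theta_j z q \<noteq> 0 \<longleftrightarrow> (\<forall>n::int. z * q powi n \<noteq> 1)"
  using theta_j_eq_0_iff[OF assms] by blast

lemma lerch_sum_summable:
  fixes q z :: complex
  assumes q: "norm q < 1" "q \<noteq> 0" and z: "z \<noteq> 0" "theta_j z q \<noteq> 0"
    and c: "(\<lambda>n. norm (c n)) summable_on UNIV"
  shows "(\<lambda>n. norm (c n / (1 - z * q powi n))) summable_on UNIV"
    and "((\<lambda>n. c n / (1 - z * q powi n)) has_sum lerch_sum c q z) UNIV"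
proof -
  obtain N where N: "\<And>n w. \<bar>n\<bar> > int N \<Longrightarrow> norm z \<le> norm w \<Longrightarrow> norm w \<le> norm z \<Longrightarrow> norm (1 - w * q powi n) \<ge> 1/2"
    using one_minus_power_int_far[OF q(2,1), of "norm z" "norm z"] z by auto
  define d where "d = Min (insert (1/2) ((\<lambda>n. norm (1 - z * q powi n)) ` {- int N..int N}))"
  have nz: "1 - z * q powi n \<noteq> 0" for n using z(2) theta_j_nonzero_iff[OF q z(1)] by simp
  have d0: "d > 0" unfolding d_def by (subst Min_gr_iff) (use nz in auto)
  have d: "norm (1 - z * q powi n) \<ge> d" for n
  proof (cases "\<bar>n\<bar> > int N")
    case True
    then have "norm (1 - z * q powi n) \<ge> 1/2" by (intro N) auto
    moreover have "d \<le> 1/2" unfolding d_def by (intro Min_le) auto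
    ultimately show ?thesis by linarith
  next
    case False
    then show ?thesis unfolding d_def by (intro Min_le insertI2 imageI) auto
  qed
  have "(\<lambda>n. norm (c n) * (1 / d)) summable_on UNIV" by (rule summable_on_cmult_left[OF c])
  then show s: "(\<lambda>n. norm (c n / (1 - z * q powi n))) summable_on UNIV"
  proof (rule Infinite_Sum.abs_summable_on_comparison_test')
    fix n
    show "norm (c n / (1 - z * q powi n)) \<le> norm (c n) * (1 / d)"
      using d[of n] d0 by (auto simp: norm_divide intro!: divide_left_mono mult_pos_pos)
  qed
  show "((\<lambda>n. c n / (1 - z * q powi n)) has_sum lerch_sum c q z) UNIV"
    unfolding lerch_sum_def by (rule has_sum_infsum[OF abs_summable_summable[OF s]])
qed

lemma holomorphic_infsum:
  fixes f :: "'a \<Rightarrow> complex \<Rightarrow> complex"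
  assumes S: "open S" and hol: "\<And>n. f n holomorphic_on S"
    and M: "\<And>z. z \<in> S \<Longrightarrow> \<exists>r M. r > 0 \<and> cball z r \<subseteq> S \<and> M summable_on UNIV \<and> (\<forall>n. \<forall>w\<in>cball z r. norm (f n w) \<le> M n)"
  shows "(\<lambda>z. \<Sum>\<^sub>\<infinity>n. f n z) holomorphic_on S"
proof (subst holomorphic_on_open[OF S], intro ballI)
  fix z assume "z \<in> S"
  then obtain r M where r: "r > 0" "cball z r \<subseteq> S" and M: "M summable_on UNIV" "\<And>n w. w \<in> cball z r \<Longrightarrow> norm (f n w) \<le> M n"
    using M by metis
  have ul: "uniform_limit (cball z r) (\<lambda>X w. \<Sum>n\<in>X. f n w) (\<lambda>w. \<Sum>\<^sub>\<infinity>n\<in>UNIV. f n w) (finite_subsets_at_top UNIV)"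
    by (rule Weierstrass_m_test_general[OF M(2) M(1)])
  have "(\<lambda>w. \<Sum>\<^sub>\<infinity>n. f n w) holomorphic_on ball z r"
  proof (rule holomorphic_uniform_limit[OF _ ul])
    have h: "f n holomorphic_on cball z r" for n by (rule holomorphic_on_subset[OF hol r(2)])
    then have "continuous_on (cball z r) (f n)" "f n holomorphic_on ball z r" for n
      using holomorphic_on_imp_continuous_on holomorphic_on_subset ball_subset_cball by blast+
    then show "\<forall>\<^sub>F X in finite_subsets_at_top UNIV. continuous_on (cball z r) (\<lambda>w. \<Sum>n\<in>X. f n w) \<and>
        (\<lambda>w. \<Sum>n\<in>X. f n w) holomorphic_on ball z r"
      by (intro always_eventually allI conjI continuous_on_sum holomorphic_on_sum)
  qed auto
  then show "\<exists>f'. ((\<lambda>z. \<Sum>\<^sub>\<infinity>n. f n z) has_field_derivative f') (at z)"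
    using r(1) by (subst (asm) holomorphic_on_open) auto
qed

text \<open>The simple poles q^(-n) of the sum are zeros of the theta function, so each summand
  times theta has a removable singularity. At z = 1 all terms but n = 0 vanish, and the remaining
  one is -c 0 times the derivative of theta; this value of \<open>h\<close> plays the role of the
  residue in later arguments.\<close>

lemma lerch_sum_theta_holomorphic:
  fixes q :: complex
  assumes q: "norm q < 1" "q \<noteq> 0" and c: "(\<lambda>n. norm (c n)) summable_on UNIV"
  obtains h where "h holomorphic_on - {0}"
    "\<And>z. z \<noteq> 0 \<Longrightarrow> theta_j z q \<noteq> 0 \<Longrightarrow> h z = lerch_sum c q z * theta_j z q"
    "h 1 = c 0 * qpoch_inf q q ^ 3"
proof -
  define J where "J = (\<lambda>z. theta_j z q)"
  define a where "a = (\<lambda>n::int. q powi (- n))"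
  \<comment> \<open>Since 1 - z q^n = -(z - a n) / a n, this is theta divided by 1 - z q^n with the
    singularity at \<open>a n\<close> filled in.\<close>
  define t where "t = (\<lambda>n z. - a n * (if z = a n then deriv J (a n) else J z / (z - a n)))"
  have a0: "a n \<noteq> 0" for n using q by (simp add: a_def)
  have J: "J holomorphic_on - {0}" unfolding J_def by (intro holomorphic_intros q) auto
  have qn: "q powi n = 1 / a n" for n using q by (simp add: a_def power_int_minus field_simps)
  have Ja: "J (a n) = 0" for n
    unfolding J_def by (subst theta_j_eq_0_iff[OF q a0]) (use a0[of n] qn[of n] in \<open>auto intro!: exI[of _ n]\<close>)
  have t_eq: "t n z = J z / (1 - z * q powi n)" if "z \<noteq> a n" for n z
    using that a0[of n] by (simp add: t_def qn divide_simps) (simp add: algebra_simps)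
  have t_hol: "t n holomorphic_on - {0}" for n
  proof -
    have "(\<lambda>z. if z = a n then deriv J (a n) else J z / (z - a n) - J (a n) / (z - a n)) holomorphic_on - {0}"
      by (rule pole_theorem_open[OF J]) auto
    then have "(\<lambda>z. if z = a n then deriv J (a n) else J z / (z - a n)) holomorphic_on - {0}"
      by (simp add: Ja cong: if_cong)
    then show ?thesis unfolding t_def by (intro holomorphic_on_mult holomorphic_on_const)
  qed
  define h where "h = (\<lambda>z. \<Sum>\<^sub>\<infinity>n. c n * t n z)"
  have "h holomorphic_on - {0}"
    unfolding h_def
  proof (rule holomorphic_infsum)
    fix z :: complex assume z: "z \<in> - {0}"
    define r where "r = norm z / 2"
    define K where "K = cball z r"
    have r: "r > 0" using z by (simp add: r_def)
    have nrm: "r \<le> norm w" "norm w \<le> norm z + r" if "w \<in> K" for w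
      using that norm_triangle_ineq2[of z w] norm_triangle_ineq2[of w z] by (auto simp: K_def r_def dist_norm norm_minus_commute)
    have K: "K \<subseteq> - {0}" using nrm(1)[of 0] r by auto
    have "compact K" by (simp add: K_def)
    note K = K this
    obtain N where N: "\<And>n w. \<bar>n\<bar> > int N \<Longrightarrow> r \<le> norm w \<Longrightarrow> norm w \<le> norm z + r \<Longrightarrow> norm (1 - w * q powi n) \<ge> 1/2"
      using one_minus_power_int_far[OF q(2,1) r, of "norm z + r"] by blast
    have cont: "continuous_on K f" if "f holomorphic_on - {0}" for f
      using holomorphic_on_imp_continuous_on[OF holomorphic_on_subset[OF that K(1)]] .
    have "bounded (J ` K)" by (intro compact_imp_bounded compact_continuous_image cont J K)
    then obtain B where B: "\<And>w. w \<in> K \<Longrightarrow> norm (J w) \<le> B" by (auto simp: bounded_iff)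
    have "bounded (\<Union>n\<in>{- int N..int N}. t n ` K)"
      by (intro bounded_UN ballI compact_imp_bounded compact_continuous_image cont t_hol K) auto
    then obtain B' where B': "\<And>n w. n \<in> {- int N..int N} \<Longrightarrow> w \<in> K \<Longrightarrow> norm (t n w) \<le> B'"
      unfolding bounded_iff by (metis UN_I image_eqI)
    have bnd: "norm (t n w) \<le> max (2 * B) B'" if w: "w \<in> K" for n w
    proof (cases "\<bar>n\<bar> > int N")
      case True
      have ge: "norm (1 - w * q powi n) \<ge> 1/2" by (rule N[OF True nrm[OF w]])
      then have "w \<noteq> a n" using qn[of n] a0[of n] by auto
      then have "norm (t n w) = norm (J w) / norm (1 - w * q powi n)" by (simp add: t_eq norm_divide)
      also have "\<dots> \<le> B / (1/2)" using B[OF w] ge by (intro frac_le) (auto intro: order_trans[OF norm_ge_zero])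
      finally show ?thesis by simp
    next
      case False
      then have "n \<in> {- int N..int N}" by auto
      from B'[OF this w] show ?thesis by linarith
    qed
    show "\<exists>r M. r > 0 \<and> cball z r \<subseteq> - {0} \<and> M summable_on UNIV \<and> (\<forall>n. \<forall>w\<in>cball z r. norm (c n * t n w) \<le> M n)"
    proof (intro exI conjI allI ballI)
      show "r > 0" by (rule r)
      show "cball z r \<subseteq> - {0}" using K by (simp add: K_def)
      show "(\<lambda>n. norm (c n) * max (2 * B) B') summable_on UNIV" by (rule summable_on_cmult_left[OF c])
      fix n w assume "w \<in> cball z r"
      then show "norm (c n * t n w) \<le> norm (c n) * max (2 * B) B'"
        unfolding norm_mult by (intro mult_left_mono bnd) (auto simp: K_def)
    qed
  qed (auto intro!: holomorphic_intros t_hol)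
  moreover have "h z = lerch_sum c q z * theta_j z q" if z: "z \<noteq> 0" "theta_j z q \<noteq> 0" for z
  proof -
    have "z \<noteq> a n" for n using z(2) Ja[of n] by (auto simp: J_def)
    then have "h z = (\<Sum>\<^sub>\<infinity>n. c n / (1 - z * q powi n) * J z)"
      unfolding h_def by (simp add: t_eq)
    also have "\<dots> = lerch_sum c q z * J z"
      unfolding lerch_sum_def by (rule infsum_cmult_left')
    finally show ?thesis by (simp add: J_def)
  qed
  moreover have "h 1 = c 0 * qpoch_inf q q ^ 3"
  proof -
    have "(J has_field_derivative (- theta0 1 q)) (at 1)"
    proof -
      have "(\<lambda>z. theta0 z q) holomorphic_on - {0}" by (intro holomorphic_intros q) auto
      then obtain D where D: "((\<lambda>z. theta0 z q) has_field_derivative D) (at 1)"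
        using holomorphic_derivI[of "\<lambda>z. theta0 z q" "- {0}" 1] by auto
      have "((\<lambda>z. (1 - z) * theta0 z q) has_field_derivative (- theta0 1 q)) (at 1)"
        by (rule derivative_eq_intros D refl)+ simp
      then show ?thesis by (simp add: J_def theta_j_eq_theta0 q)
    qed
    then have d: "deriv J 1 = - (qpoch_inf q q ^ 3)" by (simp add: DERIV_imp_deriv theta0_1)
    have t0: "t 0 1 = qpoch_inf q q ^ 3" using d by (simp add: t_def a_def)
    have tn: "t n 1 = 0" if "n \<noteq> 0" for n
    proof -
      have "a n \<noteq> 1" unfolding a_def using power_int_neq_one[OF q, of "- n"] that by simp
      then show ?thesis by (simp add: t_eq J_def q)
    qed
    have "((\<lambda>n. c n * t n 1) has_sum c 0 * qpoch_inf q q ^ 3) UNIV"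
      by (rule has_sum_finite_neutralI[of "{0}"]) (auto simp: t0 tn)
    then show ?thesis unfolding h_def by (rule infsumI)
  qed
  ultimately show ?thesis using that by blast
qed

lemma open_theta_nonzero:
  assumes "norm q < 1"
  shows "open {z. z \<noteq> 0 \<and> theta_j z q \<noteq> 0}"
proof -
  have "continuous_on (- {0}) (\<lambda>z. theta_j z q)"
    by (intro holomorphic_on_imp_continuous_on holomorphic_intros assms) auto
  then have "open ((\<lambda>z. theta_j z q) -` (- {0}) \<inter> - {0})"
    by (subst (asm) continuous_on_open_vimage) auto
  moreover have "(\<lambda>z. theta_j z q) -` (- {0}) \<inter> - {0} = {z. z \<noteq> 0 \<and> theta_j z q \<noteq> 0}" by auto
  ultimately show ?thesis by simp
qed

lemma isCont_lerch_sum: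
  fixes q w :: complex
  assumes q: "norm q < 1" "q \<noteq> 0" and w: "w \<noteq> 0" "theta_j w q \<noteq> 0"
    and c: "(\<lambda>n. norm (c n)) summable_on UNIV"
  shows "isCont (lerch_sum c q) w"
proof -
  obtain h where h: "h holomorphic_on - {0}" "\<And>z. z \<noteq> 0 \<Longrightarrow> theta_j z q \<noteq> 0 \<Longrightarrow> h z = lerch_sum c q z * theta_j z q"
    using lerch_sum_theta_holomorphic[OF q c] by blast
  have T: "(\<lambda>z. theta_j z q) holomorphic_on - {0}" by (intro holomorphic_intros q) auto
  have "isCont h w" "isCont (\<lambda>z. theta_j z q) w"
    using continuous_on_eq_continuous_at[of "- {0::complex}" h, THEN iffD1, OF _ holomorphic_on_imp_continuous_on[OF h(1)]]
      continuous_on_eq_continuous_at[of "- {0::complex}", THEN iffD1, OF _ holomorphic_on_imp_continuous_on[OF T]] w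
    by (auto simp: open_Compl)
  then have cont: "isCont (\<lambda>z. h z / theta_j z q) w" using w by (intro continuous_intros) auto
  have "\<forall>\<^sub>F z in nhds w. z \<in> {z. z \<noteq> 0 \<and> theta_j z q \<noteq> 0}"
    using w by (intro eventually_nhds_in_open open_theta_nonzero q) auto
  then have "\<forall>\<^sub>F z in nhds w. h z / theta_j z q = lerch_sum c q z"
    by eventually_elim (simp add: h(2))
  with cont show ?thesis by (simp add: isCont_cong)
qed

text \<open>The factor z makes z/(1 - z x) - w/(1 - w x) equal to (z - w) / ((1 - z x)(1 - w x)).
  The difference quotient is therefore itself a \<open>lerch_sum\<close>, with coefficients c n / (1
  - w q^n), and its continuity gives the derivative.\<close>

lemma lerch_sum_has_derivative:
  fixes q w :: complex
  assumes q: "norm q < 1" "q \<noteq> 0" and w: "w \<noteq> 0" "theta_j w q \<noteq> 0"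
    and c: "(\<lambda>n. norm (c n)) summable_on UNIV"
  shows "((\<lambda>z. z * lerch_sum c q z) has_field_derivative (\<Sum>\<^sub>\<infinity>n. c n / (1 - w * q powi n)^2)) (at w)"
proof -
  define c' where "c' = (\<lambda>n. c n / (1 - w * q powi n))"
  have c': "(\<lambda>n. norm (c' n)) summable_on UNIV" unfolding c'_def by (rule lerch_sum_summable(1)[OF q w c])
  have "\<forall>\<^sub>F z in at w. z \<in> {z. z \<noteq> 0 \<and> theta_j z q \<noteq> 0} - {w}"
    using w by (intro eventually_at_in_open open_theta_nonzero q) auto
  then have ev: "\<forall>\<^sub>F z in at w. lerch_sum c' q z = (z * lerch_sum c q z - w * lerch_sum c q w) / (z - w)"
  proof eventually_elim
    case (elim z)
    then have z: "z \<noteq> 0" "theta_j z q \<noteq> 0" "z \<noteq> w" by auto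
    have "((\<lambda>n. 1 / (z - w) * (z * (c n / (1 - z * q powi n)) + - w * (c n / (1 - w * q powi n)))) has_sum
       1 / (z - w) * (z * lerch_sum c q z + - w * lerch_sum c q w)) UNIV"
      by (intro has_sum_cmult_right has_sum_add lerch_sum_summable(2) q w z c)
    also have "(\<lambda>n. 1 / (z - w) * (z * (c n / (1 - z * q powi n)) + - w * (c n / (1 - w * q powi n)))) =
       (\<lambda>n. c' n / (1 - z * q powi n))"
    proof
      fix n
      have nz: "1 - z * q powi n \<noteq> 0" "1 - w * q powi n \<noteq> 0" "z - w \<noteq> 0"
        using theta_j_nonzero_iff[OF q] z w by auto
      have "z * (1 - w * q powi n) - w * (1 - z * q powi n) = z - w" by (simp add: algebra_simps)
      then have "z / (1 - z * q powi n) - w / (1 - w * q powi n) = (z - w) / ((1 - z * q powi n) * (1 - w * q powi n))"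
        using nz(1,2) by (simp add: diff_frac_eq)
      then have "1 / (z - w) * (z / (1 - z * q powi n) - w / (1 - w * q powi n)) * c n = c n / ((1 - z * q powi n) * (1 - w * q powi n))"
        using nz(3) by simp
      then show "1 / (z - w) * (z * (c n / (1 - z * q powi n)) + - w * (c n / (1 - w * q powi n))) = c' n / (1 - z * q powi n)"
        by (simp add: c'_def algebra_simps)
    qed
    finally show ?case unfolding lerch_sum_def[of c'] by (simp add: infsumI)
  qed
  have "(lerch_sum c' q \<longlongrightarrow> lerch_sum c' q w) (at w)"
    using isCont_lerch_sum[OF q w c'] by (simp add: isCont_def)
  then have "((\<lambda>z. (z * lerch_sum c q z - w * lerch_sum c q w) / (z - w)) \<longlongrightarrow> lerch_sum c' q w) (at w)"
    by (rule Lim_transform_eventually[OF _ ev])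
  moreover have "lerch_sum c' q w = (\<Sum>\<^sub>\<infinity>n. c n / (1 - w * q powi n)^2)"
    by (simp add: lerch_sum_def c'_def power2_eq_square)
  ultimately show ?thesis by (simp add: has_field_derivative_iff)
qed

text \<open>By the maximum modulus principle a neighbourhood of a fundamental annulus suffices.\<close>

lemma elliptic_constant:
  fixes q :: complex
  assumes q: "norm q < 1" "q \<noteq> 0"
    and hol: "g holomorphic_on {z. norm q < norm z \<and> norm z < 1 / norm q}"
    and per: "\<And>z. 1 < norm z \<Longrightarrow> norm z < 1 / norm q \<Longrightarrow> g (q * z) = g z"
  obtains C where "\<And>z. norm q < norm z \<Longrightarrow> norm z < 1 / norm q \<Longrightarrow> g z = C"
proof -
  define A where "A = {z::complex. norm q < norm z \<and> norm z < 1 / norm q}"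
  \<comment> \<open>With |q| = s^2 the closed annulus F between radii s and 1/s meets every orbit:
    one multiplication or division by q brings any point of A into F. A maximum over the compact F
    is thus a maximum over the open A.\<close>
  define s where "s = sqrt (norm q)"
  have s: "0 < s" "s < 1" "s * s = norm q" using q by (auto simp: s_def real_sqrt_lt_1_iff)
  have s2: "norm q < s" using s mult_strict_left_mono[of s 1 s] by simp
  then have s3: "1 < 1 / s" "1 / s < 1 / norm q" using s q by (auto simp: field_simps)
  define F where "F = {z::complex. s \<le> norm z \<and> norm z \<le> 1 / s}"
  have FA: "F \<subseteq> A" using s2 s3 by (auto simp: F_def A_def)
  have opA: "open A" unfolding A_def by (intro open_Collect_conj open_Collect_less continuous_intros)
  have conA: "connected A"
    using connected_annulus(1)[of "norm q" "0::complex" "1 / norm q"] by (simp add: A_def)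
  have "F = cball 0 (1 / s) - ball 0 s" by (auto simp: F_def dist_norm)
  then have "compact F" by (simp add: compact_diff)
  moreover have "1 \<in> F" using s s3 by (auto simp: F_def)
  moreover have "continuous_on F (\<lambda>z. norm (g z))"
    using holomorphic_on_imp_continuous_on[OF hol] FA unfolding A_def
    by (intro continuous_on_norm) (rule continuous_on_subset)
  ultimately obtain \<xi> where \<xi>: "\<xi> \<in> F" "\<And>z. z \<in> F \<Longrightarrow> norm (g z) \<le> norm (g \<xi>)"
    using continuous_attains_sup[of F "\<lambda>z. norm (g z)"] by blast
  have "norm (g z) \<le> norm (g \<xi>)" if z: "z \<in> A" for z
  proof -
    consider "z \<in> F" | "norm z < s" | "norm z > 1 / s"
      unfolding F_def mem_Collect_eq by linarith
    then show ?thesis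
    proof cases
      case 2
      have n: "norm (z / q) = norm z / norm q" by (simp add: norm_divide)
      have "norm z / norm q < s / norm q" using 2 q by (intro divide_strict_right_mono) auto
      also have "s / norm q = 1 / s" using s by (simp flip: s(3))
      finally have lt: "norm (z / q) < 1 / s" by (simp add: n)
      moreover have gt: "1 < norm (z / q)" using z q by (simp add: A_def n)
      ultimately have "z / q \<in> F" using s by (auto simp: F_def)
      moreover have "g (q * (z / q)) = g (z / q)" using gt lt s3 by (intro per) auto
      ultimately show ?thesis using \<xi>(2)[of "z / q"] q by simp
    next
      case 3
      have "g (q * z) = g z" using 3 s3 z by (intro per) (auto simp: A_def)
      moreover have "q * z \<in> F"
      proof -
        have "norm q * (1 / s) \<le> norm q * norm z" using 3 q by (intro mult_left_mono) auto
        moreover have "norm q * (1 / s) = s" using s by (simp flip: s(3))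
        moreover have "norm q * norm z \<le> 1" using z q by (simp add: A_def field_simps)
        ultimately show ?thesis using s3 by (auto simp: F_def norm_mult)
      qed
      ultimately show ?thesis using \<xi>(2)[of "q * z"] by simp
    qed (use \<xi> in auto)
  qed
  then have "g constant_on A"
    using maximum_modulus_principle[of g A A \<xi>] hol opA conA \<xi>(1) FA by (auto simp: A_def)
  then show ?thesis using that by (auto simp: constant_on_def A_def)
qed

section \<open>The Appell function f(z;q) and its functional equations\<close>

definition gauss_coeff :: "complex \<Rightarrow> int \<Rightarrow> complex" where
  "gauss_coeff q n = (-1) powi n * q powi (n\<^sup>2 + n)"

definition appell_f :: "complex \<Rightarrow> complex \<Rightarrow> complex" where
  "appell_f q z = lerch_sum (gauss_coeff q) q z"

definition theta_const :: "complex \<Rightarrow> complex" where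
  "theta_const q = theta_j q (q^2)"

lemma gauss_coeff_alt: "q \<noteq> 0 \<Longrightarrow> gauss_coeff q n = (-1) powi n * q powi n\<^sup>2 * q powi n"
  unfolding gauss_coeff_def by (subst power_int_add) auto

lemma gauss_coeff_summable:
  assumes "norm q < 1" "q \<noteq> 0"
  shows "(\<lambda>n. norm (gauss_coeff q n)) summable_on UNIV"
proof -
  have "norm (gauss_coeff q n) = norm (q powi n\<^sup>2 * q powi n)" for n
    unfolding gauss_coeff_alt[OF assms(2)] norm_mult by (simp add: norm_power_int)
  then show ?thesis using gauss_summable[of q q] assms by simp
qed

lemma theta_const_has_sum:
  assumes "norm q < 1" "q \<noteq> 0"
  shows "((\<lambda>n. (-1) powi n * q powi n\<^sup>2) has_sum theta_const q) UNIV"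
  using jacobi_triple_product[of q 1] assms by (simp add: theta_const_def)

text \<open>The terms are (-1)^n q^(n^2 - n), whose sum is j(1;q^2) = 0 by the triple
  product.\<close>

lemma gauss_coeff_reflected_sum:
  assumes "norm q < 1" "q \<noteq> 0"
  shows "((\<lambda>n. gauss_coeff q n * q powi (- (2 * n))) has_sum 0) UNIV"
proof -
  have "norm (q^2) < 1" using assms by (simp add: norm_power power_less_one_iff)
  then have "((\<lambda>n. (-1) powi n * q powi n\<^sup>2 * (1 / q) powi n) has_sum 0) UNIV"
    using jacobi_triple_product[of q "1 / q"] assms by simp
  also have "(\<lambda>n. (-1) powi n * q powi n\<^sup>2 * (1 / q) powi n) = (\<lambda>n. gauss_coeff q n * q powi (- (2 * n)))"
  proof
    fix n :: int
    have "(1 / q) powi n = q powi (- n)" by (simp only: power_int_one_over power_int_minus inverse_eq_divide)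
    then have "q powi n\<^sup>2 * (1 / q) powi n = q powi n\<^sup>2 * q powi (- n)" by simp
    also have "\<dots> = q powi (n\<^sup>2 + - n)" by (rule power_int_add[symmetric]) (use assms in simp)
    also have "n\<^sup>2 + - n = (n\<^sup>2 + n) + - (2 * n)" by simp
    also have "q powi \<dots> = q powi (n\<^sup>2 + n) * q powi (- (2 * n))" by (rule power_int_add) (use assms in simp)
    finally show "(-1) powi n * q powi n\<^sup>2 * (1 / q) powi n = gauss_coeff q n * q powi (- (2 * n))"
      by (simp add: gauss_coeff_def mult.assoc)
  qed
  finally show ?thesis .
qed

lemma gauss_coeff_shift:
  assumes "q \<noteq> 0"
  shows "gauss_coeff q (n - 1) = - (gauss_coeff q n * q powi (- (2 * n)))"
proof -
  have "(n - 1)\<^sup>2 + (n - 1) = (n\<^sup>2 + n) + - (2 * n)" by (simp add: power2_eq_square algebra_simps)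
  then have "q powi ((n - 1)\<^sup>2 + (n - 1)) = q powi ((n\<^sup>2 + n) + - (2 * n))" by (simp only:)
  also have "\<dots> = q powi (n\<^sup>2 + n) * q powi (- (2 * n))" by (rule power_int_add) (use assms in simp)
  finally have "q powi ((n - 1)\<^sup>2 + (n - 1)) = q powi (n\<^sup>2 + n) * q powi (- (2 * n))" .
  then show ?thesis using assms by (simp add: gauss_coeff_def power_int_diff)
qed

lemma theta_j_shift_nonzero:
  assumes "norm q < 1" "q \<noteq> 0" "z \<noteq> 0" "theta_j z q \<noteq> 0"
  shows "theta_j (q * z) q \<noteq> 0"
  using theta_j_shift[OF assms(1-3)] assms by simp

text \<open>Replacing n by n - 1 restores the old denominator and multiplies the coefficient by
  -1/x^2 with x = q^n. Splitting 1/(x^2 (1 - z x)) into 1/x^2 + z/x + z^2/(1 - z x) leaves three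
  sums: the vanishing reflected one, \<open>theta_const\<close>, and \<open>appell_f\<close>
  itself.\<close>

lemma appell_f_shift:
  fixes q z :: complex
  assumes q: "norm q < 1" "q \<noteq> 0" and z: "z \<noteq> 0" "theta_j z q \<noteq> 0"
  shows "appell_f q (q * z) = - (z^2) * appell_f q z - z * theta_const q"
proof -
  define c where "c = gauss_coeff q"
  have cs: "c (n - 1) = - (c n * q powi (- (2 * n)))" for n
    unfolding c_def by (rule gauss_coeff_shift[OF q(2)])
  have nz: "1 - z * q powi n \<noteq> 0" for n using theta_j_nonzero_iff[OF q z(1)] z by simp
  have "((\<lambda>n. - 1 * (c n * q powi (- (2 * n))) + (- z * ((-1) powi n * q powi n\<^sup>2) + - (z^2) * (c n / (1 - z * q powi n)))) has_sum
     (- 1 * 0 + (- z * theta_const q + - (z^2) * appell_f q z))) UNIV"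
    unfolding c_def appell_f_def
    by (intro has_sum_add has_sum_cmult_right gauss_coeff_reflected_sum theta_const_has_sum lerch_sum_summable(2) gauss_coeff_summable q z)
  also have "(\<lambda>n. - 1 * (c n * q powi (- (2 * n))) + (- z * ((-1) powi n * q powi n\<^sup>2) + - (z^2) * (c n / (1 - z * q powi n))))
     = (\<lambda>n. c (n - 1) / (1 - q * z * q powi (n - 1)))"
  proof
    fix n
    define x where "x = q powi n"
    have x: "x \<noteq> 0" "1 - z * x \<noteq> 0" using q nz[of n] by (auto simp: x_def)
    have x2: "q powi (- (2 * n)) = 1 / x^2"
    proof -
      have "q powi (n + n) = x * x" unfolding x_def by (rule power_int_add) (use q in simp)
      then show ?thesis by (simp only: power_int_minus mult_2 power2_eq_square inverse_eq_divide)
    qed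
    have cn: "(-1) powi n * q powi n\<^sup>2 = c n / x" using q by (simp add: c_def gauss_coeff_alt x_def)
    have "1 / x^2 + z / x + z^2 / (1 - z * x) = 1 / (x^2 * (1 - z * x))"
      using x by (simp add: divide_simps power2_eq_square) (simp add: algebra_simps)
    then have m: "c n * (1 / x^2 + z / x + z^2 / (1 - z * x)) = c n / x^2 / (1 - z * x)" by simp
    have e: "1 - q * z * q powi (n - 1) = 1 - z * x" using q by (simp add: x_def power_int_diff)
    have "- 1 * (c n * (1 / x^2)) + (- z * (c n / x) + - (z^2) * (c n / (1 - z * x))) =
        - (c n * (1 / x^2 + z / x + z^2 / (1 - z * x)))" by (simp add: algebra_simps)
    also have "\<dots> = - (c n * (1 / x^2)) / (1 - z * x)" unfolding m by simp
    finally show "- 1 * (c n * q powi (- (2 * n))) + (- z * ((-1) powi n * q powi n\<^sup>2) + - (z^2) * (c n / (1 - z * q powi n))) =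
        c (n - 1) / (1 - q * z * q powi (n - 1))"
      unfolding cs cn x2 e x_def[symmetric] .
  qed
  finally have "((\<lambda>n. c (n + - 1) / (1 - q * z * q powi (n + - 1))) has_sum (- z * theta_const q - (z^2) * appell_f q z)) UNIV"
    by simp
  then have "((\<lambda>n. c n / (1 - q * z * q powi n)) has_sum (- z * theta_const q - (z^2) * appell_f q z)) UNIV"
    unfolding has_sum_int_shift[of "\<lambda>n. c n / (1 - q * z * q powi n)"] .
  then have "appell_f q (q * z) = - z * theta_const q - (z^2) * appell_f q z"
    unfolding appell_f_def lerch_sum_def c_def by (rule infsumI)
  then show ?thesis by (simp only:) simp
qed

text \<open>Reversing the sign of n uses (1/x) / (1 - 1/(z x)) = -z (1 + z x/(1 - z x)), whose first
  part sums to \<open>theta_const\<close>. At the fixed point z = -1 the relation determines the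
  value of f.\<close>

lemma appell_f_inverse:
  fixes q z :: complex
  assumes q: "norm q < 1" "q \<noteq> 0" and z: "z \<noteq> 0" "theta_j z q \<noteq> 0"
  shows "appell_f q (1 / z) = - z * (theta_const q + z * appell_f q z)"
proof -
  define c where "c = gauss_coeff q"
  have nz: "1 - z * q powi n \<noteq> 0" for n using theta_j_nonzero_iff[OF q z(1)] z by simp
  have "((\<lambda>n. - z * ((-1) powi n * q powi n\<^sup>2 + z * (c n / (1 - z * q powi n)))) has_sum
     (- z * (theta_const q + z * appell_f q z))) UNIV"
    unfolding c_def appell_f_def
    by (intro has_sum_add has_sum_cmult_right theta_const_has_sum lerch_sum_summable(2) gauss_coeff_summable q z)
  also have "(\<lambda>n. - z * ((-1) powi n * q powi n\<^sup>2 + z * (c n / (1 - z * q powi n)))) = (\<lambda>n. c (- n) / (1 - 1 / z * q powi (- n)))"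
  proof
    fix n
    define x where "x = q powi n"
    have x: "x \<noteq> 0" "1 - z * x \<noteq> 0" "z * x - 1 \<noteq> 0" using q nz[of n] by (auto simp: x_def)
    define d where "d = (-1) powi n * q powi n\<^sup>2"
    have c1: "c n = d * x" using q by (simp add: c_def gauss_coeff_alt x_def d_def)
    have c2: "c (- n) = d / x"
      unfolding c_def gauss_coeff_alt[OF q(2)] power_int_minus_one_minus
      by (simp add: x_def d_def power_int_minus divide_inverse)
    have "- z * (1 + z * (x / (1 - z * x))) = 1 / x / (1 - 1 / z * (1 / x))"
      using x z by (simp add: divide_simps) (simp add: algebra_simps)
    then have "d * (- z * (1 + z * (x / (1 - z * x)))) = d * (1 / x / (1 - 1 / z * (1 / x)))" by simp
    moreover have "q powi (- n) = 1 / x" by (simp add: x_def power_int_minus divide_inverse)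
    ultimately show "- z * ((-1) powi n * q powi n\<^sup>2 + z * (c n / (1 - z * q powi n))) = c (- n) / (1 - 1 / z * q powi (- n))"
      unfolding c1 c2 d_def[symmetric] x_def[symmetric] by (simp add: algebra_simps)
  qed
  finally have "((\<lambda>n. c n / (1 - 1 / z * q powi n)) has_sum (- z * (theta_const q + z * appell_f q z))) UNIV"
    unfolding has_sum_int_uminus[of "\<lambda>n. c n / (1 - 1 / z * q powi n)"] .
  then show ?thesis unfolding appell_f_def lerch_sum_def c_def by (rule infsumI)
qed

lemma theta_j_nonzero_annulus:
  fixes q z :: complex
  assumes q: "norm q < 1" "q \<noteq> 0" and z: "1 < norm z" "norm z < 1 / norm q"
  shows "theta_j z q \<noteq> 0"
proof
  assume "theta_j z q = 0"
  moreover have "z \<noteq> 0" using z by auto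
  ultimately obtain n :: int where n: "z * q powi n = 1" using theta_j_eq_0_iff[OF q] by blast
  show False
  proof (cases "n > 0")
    case True
    then have "norm z * norm q ^ nat n = 1"
      using arg_cong[OF n, of norm] by (simp add: norm_mult norm_power power_int_nonneg_exp)
    moreover have "norm q ^ nat n \<le> norm q ^ 1" using True q by (intro power_decreasing) auto
    then have "norm z * norm q ^ nat n \<le> norm z * norm q" by (intro mult_left_mono) auto
    moreover have "norm z * norm q < 1" using z q by (simp add: field_simps)
    ultimately show False by linarith
  next
    case False
    have "norm (q powi n) = 1 / norm q ^ nat (- n)"
      using False power_int_minus[of q "- n"] by (simp add: power_int_nonneg_exp norm_inverse norm_power divide_inverse)
    moreover have "norm z * norm (q powi n) = 1"
      using arg_cong[OF n, of norm] by (simp only: norm_mult norm_one)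
    ultimately have "norm z = norm q ^ nat (- n)" using q by simp
    moreover have "norm q ^ nat (- n) \<le> 1" using q by (intro power_le_one) auto
    ultimately show False using z by linarith
  qed
qed

text \<open>The partial fraction series of a reciprocal theta function. With numerators of base p
  and poles of base q = p^2 the shift equation has no inhomogeneous term: the sum is multiplied by
  -z when z becomes q z, and theta by -1/z. Their product is holomorphic and elliptic, hence equal
  to its value at z = 1.\<close>

lemma lerch_sum_level_one:
  fixes p y :: complex
  assumes p: "norm p < 1" "p \<noteq> 0" and y: "norm (p^2) < norm y" "norm y < 1 / norm (p^2)" "theta_j y (p^2) \<noteq> 0"
  shows "lerch_sum (gauss_coeff p) (p^2) y = qpoch_inf (p^2) (p^2) ^ 3 / theta_j y (p^2)"
proof -
  define q where "q = p^2"
  have q: "norm q < 1" "q \<noteq> 0" using p by (auto simp: q_def norm_power power_less_one_iff)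
  define g where "g = lerch_sum (gauss_coeff p) q"
  have shift: "g (q * z) = - z * g z" if z: "z \<noteq> 0" "theta_j z q \<noteq> 0" for z
  proof -
    define c where "c = gauss_coeff p"
    have cs: "c (n - 1) = - (c n * p powi (- (2 * n)))" for n
      unfolding c_def by (rule gauss_coeff_shift[OF p(2)])
    have nz: "1 - z * q powi n \<noteq> 0" for n using theta_j_nonzero_iff[OF q z(1)] z by simp
    have "((\<lambda>n. - 1 * (c n * p powi (- (2 * n))) + - z * (c n / (1 - z * q powi n))) has_sum (- 1 * 0 + - z * g z)) UNIV"
      unfolding c_def g_def
      by (intro has_sum_add has_sum_cmult_right gauss_coeff_reflected_sum lerch_sum_summable(2) gauss_coeff_summable p q z)
    also have "(\<lambda>n. - 1 * (c n * p powi (- (2 * n))) + - z * (c n / (1 - z * q powi n))) = (\<lambda>n. c (n - 1) / (1 - q * z * q powi (n - 1)))"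
    proof
      fix n
      define x where "x = q powi n"
      have x: "x \<noteq> 0" "1 - z * x \<noteq> 0" using q nz[of n] by (auto simp: x_def)
      have x2: "p powi (- (2 * n)) = 1 / x"
      proof -
        have "x = p powi (2 * n)" unfolding x_def q_def using power_int_power[of p 2 n] by (simp only: of_nat_numeral)
        then show ?thesis by (simp only: power_int_minus inverse_eq_divide)
      qed
      have "1 / x + z / (1 - z * x) = 1 / (x * (1 - z * x))"
        using x by (simp add: divide_simps)
      then have "c n * (1 / x + z / (1 - z * x)) = c n / x / (1 - z * x)" by simp
      moreover have "1 - q * z * q powi (n - 1) = 1 - z * x" using q by (simp add: x_def power_int_diff)
      ultimately show "- 1 * (c n * p powi (- (2 * n))) + - z * (c n / (1 - z * q powi n)) = c (n - 1) / (1 - q * z * q powi (n - 1))"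
        unfolding cs x2 x_def[symmetric]
        by (simp add: algebra_simps)
    qed
    finally have "((\<lambda>n. c (n + - 1) / (1 - q * z * q powi (n + - 1))) has_sum (- z * g z)) UNIV" by simp
    then have "((\<lambda>n. c n / (1 - q * z * q powi n)) has_sum (- z * g z)) UNIV"
      unfolding has_sum_int_shift[of "\<lambda>n. c n / (1 - q * z * q powi n)"] .
    then show ?thesis unfolding g_def lerch_sum_def c_def by (rule infsumI)
  qed
  obtain h where h: "h holomorphic_on - {0}"
    "\<And>z. z \<noteq> 0 \<Longrightarrow> theta_j z q \<noteq> 0 \<Longrightarrow> h z = g z * theta_j z q"
    "h 1 = gauss_coeff p 0 * qpoch_inf q q ^ 3"
    using lerch_sum_theta_holomorphic[OF q gauss_coeff_summable[OF p]] unfolding g_def by blast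
  have hol: "h holomorphic_on {z. norm q < norm z \<and> norm z < 1 / norm q}"
    by (rule holomorphic_on_subset[OF h(1)]) auto
  obtain C where C: "\<And>z. norm q < norm z \<Longrightarrow> norm z < 1 / norm q \<Longrightarrow> h z = C"
  proof (rule elliptic_constant[OF q hol])
    fix z :: complex assume z: "1 < norm z" "norm z < 1 / norm q"
    have z0: "z \<noteq> 0" using z by auto
    have t: "theta_j z q \<noteq> 0" by (rule theta_j_nonzero_annulus[OF q z])
    have t': "theta_j (q * z) q \<noteq> 0" by (rule theta_j_shift_nonzero[OF q z0 t])
    show "h (q * z) = h z"
      using z0 q by (simp add: h(2) t t' shift theta_j_shift)
  qed blast
  have "h y = h 1" using C[of y] C[of 1] y q by (simp add: q_def)
  moreover have "y \<noteq> 0" using y(1) by auto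
  ultimately show ?thesis
    using h(2)[of y] h(3) y(3) by (simp add: q_def[symmetric] g_def gauss_coeff_def field_simps)
qed

text \<open>1/(1 - z x) + 1/(1 + z x) = 2/(1 - z^2 x^2) squares the base of the poles but not that
  of the numerators, which is the level-one situation. It later trades f(q;q^3) for f(-q;q^3), the
  sum occurring in the theorem.\<close>

lemma appell_f_even_part:
  fixes p z :: complex
  assumes p: "norm p < 1" "p \<noteq> 0" and z: "norm (p^2) < norm (z^2)" "norm (z^2) < 1 / norm (p^2)" "theta_j (z^2) (p^2) \<noteq> 0"
  shows "appell_f p z + appell_f p (- z) = 2 * qpoch_inf (p^2) (p^2) ^ 3 / theta_j (z^2) (p^2)"
proof -
  have P: "norm (p^2) < 1" "p^2 \<noteq> 0" using p by (auto simp: norm_power power_less_one_iff)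
  have z0: "z \<noteq> 0" using z(1) by auto
  have nz: "1 - (z^2) * (p^2) powi n \<noteq> 0" for n using theta_j_nonzero_iff[OF P, of "z^2"] z0 z(3) by simp
  have sq: "z^2 * (p^2) powi n = (z * p powi n)^2" for n
    by (simp only: power2_eq_square power_int_mult_distrib mult_ac)
  have nz': "1 - z * p powi n \<noteq> 0" "1 + z * p powi n \<noteq> 0" for n
    using nz[of n] unfolding sq by (auto simp: power2_eq_1_iff add_eq_0_iff)
  have "- z * p powi n \<noteq> 1" for n
  proof
    assume "- z * p powi n = 1"
    then have "1 - (- z * p powi n) = 0" by simp
    then show False using nz'(2)[of n] by simp
  qed
  then have t: "theta_j z p \<noteq> 0" "theta_j (- z) p \<noteq> 0"
    using nz'(1) z0 by (auto simp: theta_j_nonzero_iff[OF p])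
  have "((\<lambda>n. gauss_coeff p n / (1 - z * p powi n) + gauss_coeff p n / (1 - (- z) * p powi n)) has_sum
     (appell_f p z + appell_f p (- z))) UNIV"
    unfolding appell_f_def
    by (intro has_sum_add lerch_sum_summable(2) gauss_coeff_summable p z0 t) (use z0 in simp)
  also have "(\<lambda>n. gauss_coeff p n / (1 - z * p powi n) + gauss_coeff p n / (1 - (- z) * p powi n)) =
     (\<lambda>n. 2 * (gauss_coeff p n / (1 - (z^2) * (p^2) powi n)))"
  proof
    fix n
    have "1 / (1 - z * p powi n) + 1 / (1 + z * p powi n) = 2 / (1 - (z * p powi n)^2)"
      using nz'[of n] nz[of n] unfolding sq by (simp add: divide_simps) (simp add: algebra_simps power2_eq_square)
    then have "gauss_coeff p n * (1 / (1 - z * p powi n) + 1 / (1 + z * p powi n)) = gauss_coeff p n * (2 / (1 - (z * p powi n)^2))"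
      by simp
    then show "gauss_coeff p n / (1 - z * p powi n) + gauss_coeff p n / (1 - (- z) * p powi n) = 2 * (gauss_coeff p n / (1 - (z^2) * (p^2) powi n))"
      unfolding sq by (simp add: distrib_left)
  qed
  finally have "((\<lambda>n. 2 * (gauss_coeff p n / (1 - (z^2) * (p^2) powi n))) has_sum (appell_f p z + appell_f p (- z))) UNIV" .
  moreover have "((\<lambda>n. 2 * (gauss_coeff p n / (1 - (z^2) * (p^2) powi n))) has_sum 2 * lerch_sum (gauss_coeff p) (p^2) (z^2)) UNIV"
    by (intro has_sum_cmult_right lerch_sum_summable(2) P z gauss_coeff_summable p) (use z0 in simp)
  ultimately have "appell_f p z + appell_f p (- z) = 2 * lerch_sum (gauss_coeff p) (p^2) (z^2)" by (rule has_sum_unique)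
  then show ?thesis by (simp add: lerch_sum_level_one[OF p z])
qed

section \<open>Product evaluations\<close>

lemma euler_even:
  assumes "norm q < 1"
  shows "qpoch_inf q (q^2) * qpoch_inf (q^2) (q^2) = qpoch_inf q q"
  using qpoch_inf_bisect[OF assms, of q] by (simp add: power2_eq_square)

lemma euler_odd_dist:
  assumes "norm q < 1"
  shows "qpoch_inf (- q) q * qpoch_inf q q = qpoch_inf (q^2) (q^2)"
  using qpoch_inf_uminus[OF assms, of q] by (simp add: mult.commute)

lemma euler_cubic:
  assumes "norm q < 1"
  shows "qpoch_inf q (q^3) * qpoch_inf (q^2) (q^3) * qpoch_inf (q^3) (q^3) = qpoch_inf q q"
proof -
  have "q * q = q^2" "q * q^2 = q^3" by (simp_all add: power2_eq_square power3_eq_cube)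
  then show ?thesis using qpoch_inf_trisect[OF assms, of q] by simp
qed

lemma norm_power_less_one: "norm (q::complex) < 1 \<Longrightarrow> n > 0 \<Longrightarrow> norm (q ^ n) < 1"
  by (simp add: norm_power power_less_one_iff)

lemma euler_nonzero: "norm (q::complex) < 1 \<Longrightarrow> n > 0 \<Longrightarrow> qpoch_inf (q ^ n) (q ^ n) \<noteq> 0"
  by (intro qpoch_inf_nonzero norm_power_less_one)

lemma euler_nonzero_1: "norm (q::complex) < 1 \<Longrightarrow> qpoch_inf q q \<noteq> 0"
  by (intro qpoch_inf_nonzero)

lemma theta_const_eq:
  assumes "norm q < 1" "q \<noteq> 0"
  shows "theta_const q = qpoch_inf q q ^ 2 / qpoch_inf (q^2) (q^2)"
proof -
  have "theta_const q = qpoch_inf q (q^2) ^ 2 * qpoch_inf (q^2) (q^2)"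
    using assms by (simp add: theta_const_def theta_j_def power2_eq_square)
  also have "qpoch_inf q (q^2) = qpoch_inf q q / qpoch_inf (q^2) (q^2)"
    using euler_even[OF assms(1)] euler_nonzero[OF assms(1), of 2] by (simp add: field_simps)
  finally show ?thesis using euler_nonzero[OF assms(1), of 2] by (simp add: power2_eq_square)
qed

lemma theta_const_nonzero: "norm q < 1 \<Longrightarrow> q \<noteq> 0 \<Longrightarrow> theta_const q \<noteq> 0"
  using euler_nonzero[of q 2] euler_nonzero_1[of q] by (simp add: theta_const_eq)

lemma rank_prefactor:
  assumes "norm q < 1" "q \<noteq> 0"
  shows "qpoch_inf (- q) q / qpoch_inf q q = 1 / theta_const q"
  using euler_odd_dist[OF assms(1)] euler_nonzero[OF assms(1), of 2] euler_nonzero_1[OF assms(1)]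
  by (simp add: theta_const_eq[OF assms] power2_eq_square field_simps)

lemma J2_3_6: "J2 3 6 q = theta_const (q^3)"
  by (simp add: J2_def theta_const_def flip: power_mult)

lemma J2_3_6_eq:
  assumes "norm q < 1" "q \<noteq> 0"
  shows "J2 3 6 q = J1 3 q ^ 2 / J1 6 q"
  using theta_const_eq[of "q^3"] assms norm_power_less_one[of q 3]
  by (simp add: J2_3_6 J1_def flip: power_mult)

text \<open>The exponents of (q;q^2) split modulo 6 into the classes 1, 3 and 5; dividing out the
  class 3 leaves the two variable factors of j(q;q^6).\<close>

lemma J2_1_6_eq:
  assumes "norm q < 1" "q \<noteq> 0"
  shows "J2 1 6 q = J1 1 q * J1 6 q ^ 2 / (J1 2 q * J1 3 q)"
proof -
  define X where "X = qpoch_inf q (q^6) * qpoch_inf (q^5) (q^6)"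
  have q2: "norm (q^2) < 1" and q3: "norm (q^3) < 1" using norm_power_less_one[OF assms(1)] by auto
  have nz: "qpoch_inf (q ^ n) (q ^ n) \<noteq> 0" if "n > 0" for n using euler_nonzero[OF assms(1) that] .
  have "qpoch_inf q (q^2) = qpoch_inf q (q^6) * qpoch_inf (q^3) (q^6) * qpoch_inf (q^5) (q^6)"
    using qpoch_inf_trisect[OF q2, of q] by (simp flip: power_mult power_Suc)
  moreover have "qpoch_inf (q^3) (q^6) = qpoch_inf (q^3) (q^3) / qpoch_inf (q^6) (q^6)"
    using euler_even[OF q3] nz[of 6] by (simp add: field_simps flip: power_mult)
  moreover have "qpoch_inf q (q^2) = qpoch_inf q q / qpoch_inf (q^2) (q^2)"
    using euler_even[OF assms(1)] nz[of 2] by (simp add: field_simps)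
  ultimately have X: "X = qpoch_inf q q * qpoch_inf (q^6) (q^6) / (qpoch_inf (q^2) (q^2) * qpoch_inf (q^3) (q^3))"
    using nz[of 2] nz[of 3] nz[of 6] by (simp add: X_def field_simps)
  have "q ^ 6 / q = q ^ 5" using assms by (simp add: eval_nat_numeral)
  then have "J2 1 6 q = X * qpoch_inf (q^6) (q^6)" by (simp add: J2_def theta_j_def X_def)
  then show ?thesis by (simp add: X J1_def power2_eq_square)
qed

section \<open>Trisection of \<phi>(-Q) and of its reciprocal\<close>

lemma has_sum_int_trisect:
  fixes f :: "int \<Rightarrow> complex"
  assumes "((\<lambda>m. f (3 * m)) has_sum S0) UNIV" "((\<lambda>m. f (3 * m + 1)) has_sum S1) UNIV" "((\<lambda>m. f (3 * m - 1)) has_sum S2) UNIV"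
  shows "(f has_sum (S0 + S1 + S2)) UNIV"
proof -
  have r: "(f has_sum S) (range g) \<longleftrightarrow> ((\<lambda>m. f (g m)) has_sum S) UNIV" if "inj g" for g :: "int \<Rightarrow> int" and S
    using has_sum_reindex[OF that, of f S] by (simp add: o_def)
  have h: "(f has_sum S0) (range (\<lambda>m. 3 * m))" "(f has_sum S1) (range (\<lambda>m. 3 * m + 1))" "(f has_sum S2) (range (\<lambda>m. 3 * m - 1))"
    using assms by (subst r; simp add: inj_def)+
  have "(f has_sum (S0 + S1)) (range (\<lambda>m. 3 * m) \<union> range (\<lambda>m. 3 * m + 1))"
    by (rule has_sum_Un_disjoint[OF h(1,2)]) (auto, presburger)
  then have "(f has_sum (S0 + S1 + S2)) (range (\<lambda>m. 3 * m) \<union> range (\<lambda>m. 3 * m + 1) \<union> range (\<lambda>m. 3 * m - 1))"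
    by (rule has_sum_Un_disjoint[OF _ h(3)]) (auto, presburger+)
  moreover have "n \<in> range (\<lambda>m. 3 * m) \<union> range (\<lambda>m. 3 * m + 1) \<union> range (\<lambda>m. 3 * m - 1)" for n :: int
  proof -
    have "n mod 3 = 0 \<or> n mod 3 = 1 \<or> n mod 3 = 2" by presburger
    then consider "n mod 3 = 0" | "n mod 3 = 1" | "n mod 3 = 2" by blast
    then show ?thesis
    proof cases
      case 1 then have "n = 3 * (n div 3)" by presburger
      then show ?thesis by blast
    next
      case 2 then have "n = 3 * (n div 3) + 1" by presburger
      then show ?thesis by blast
    next
      case 3 then have "n = 3 * (n div 3 + 1) - 1" by presburger
      then show ?thesis by blast
    qed
  qed
  ultimately show ?thesis by (metis UNIV_eq_I)
qed

text \<open>The indices n = 3 m give \<phi>(-Q^9). The classes 3 m + 1 and 3 m - 1 are exchanged by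
  the sign of n and give equal triple products, each carrying one factor -Q because (3 m + 1)^2 is 1
  modulo 3.\<close>

lemma theta_const_trisect:
  fixes Q :: complex
  assumes Q: "norm Q < 1" "Q \<noteq> 0"
  shows "theta_const Q = theta_const (Q^9) - 2 * Q * J2 1 6 (Q^3)"
proof -
  define p where "p = Q^9"
  have p: "norm p < 1" "p \<noteq> 0" using norm_power_less_one[OF Q(1), of 9] Q by (auto simp: p_def)
  define f where "f = (\<lambda>n. (-1) powi n * Q powi n\<^sup>2 :: complex)"
  have sgn: "(-1::complex) powi (3 * m) = (-1) powi m" for m :: int
    by (simp add: power_int_minus_left)
  have pow: "Q powi (9 * m) = p powi m" for m :: int
    using power_int_power[of Q 9 m] by (simp add: p_def)
  have "(3 * m)\<^sup>2 = 9 * m\<^sup>2" for m :: int by (simp add: power2_eq_square)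
  then have f0: "f (3 * m) = (-1) powi m * p powi m\<^sup>2" for m by (simp only: f_def sgn pow)
  have f1: "f (3 * m + 1) = - Q * ((-1) powi m * p powi m\<^sup>2 * (Q^6) powi m)" for m
  proof -
    have "(3 * m + 1)\<^sup>2 = 9 * m\<^sup>2 + int 6 * m + 1" by (simp add: power2_eq_square algebra_simps)
    then have "Q powi (3 * m + 1)\<^sup>2 = Q powi (9 * m\<^sup>2 + int 6 * m + 1)" by (simp only:)
    also have "\<dots> = Q powi (9 * m\<^sup>2) * Q powi (int 6 * m) * Q"
      using Q by (simp only: power_int_add simp_thms) simp
    also have "\<dots> = p powi m\<^sup>2 * (Q^6) powi m * Q" by (simp only: pow power_int_power)
    finally have "Q powi (3 * m + 1)\<^sup>2 = p powi m\<^sup>2 * (Q^6) powi m * Q" .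
    moreover have "(-1::complex) powi (3 * m + 1) = - ((-1) powi m)" by (simp add: power_int_add sgn)
    ultimately show ?thesis by (simp add: f_def)
  qed
  have f2: "f (3 * m - 1) = - Q * ((-1) powi m * p powi m\<^sup>2 * (1 / Q^6) powi m)" for m
  proof -
    have "f (3 * m - 1) = f (3 * (- m) + 1)" 
    proof -
      have "(3 * m - 1)\<^sup>2 = (3 * (- m) + 1)\<^sup>2" by (simp add: power2_eq_square algebra_simps)
      moreover have "(-1::complex) powi (3 * m - 1) = (-1) powi (3 * (- m) + 1)"
        by (simp add: power_int_minus_left)
      ultimately show ?thesis unfolding f_def by (simp only:)
    qed
    moreover have "(Q^6) powi (- m) = (1 / Q^6) powi m"
      by (simp only: power_int_one_over power_int_minus inverse_eq_divide)
    ultimately show ?thesis unfolding f1 by (simp only: power_int_minus_one_minus power2_minus)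
  qed
  have q6: "p^2 = (Q^3)^6" by (simp add: p_def flip: power_mult)
  have j1: "theta_j (p * Q^6) (p^2) = J2 1 6 (Q^3)"
  proof -
    have "p * Q^6 = p^2 / Q^3" using Q by (simp add: p_def divide_simps flip: power_mult power_add)
    then show ?thesis unfolding J2_def using theta_j_reflect[of "Q^3" "p^2"] Q p by (simp add: q6)
  qed
  have j2: "theta_j (p * (1 / Q^6)) (p^2) = J2 1 6 (Q^3)"
  proof -
    have "p * (1 / Q^6) = Q^3" using Q by (simp add: p_def divide_simps flip: power_add)
    then show ?thesis by (simp add: J2_def q6)
  qed
  have "(f has_sum (theta_const p + - Q * J2 1 6 (Q^3) + - Q * J2 1 6 (Q^3))) UNIV"
  proof (rule has_sum_int_trisect)
    show "((\<lambda>m. f (3 * m)) has_sum theta_const p) UNIV"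
      unfolding f0 by (rule theta_const_has_sum[OF p])
    show "((\<lambda>m. f (3 * m + 1)) has_sum - Q * J2 1 6 (Q^3)) UNIV"
      unfolding f1 j1[symmetric] by (intro has_sum_cmult_right jacobi_triple_product p) (use Q in simp)
    show "((\<lambda>m. f (3 * m - 1)) has_sum - Q * J2 1 6 (Q^3)) UNIV"
      unfolding f2 j2[symmetric] by (intro has_sum_cmult_right jacobi_triple_product p) (use Q in simp)
  qed
  moreover have "(f has_sum theta_const Q) UNIV" unfolding f_def by (rule theta_const_has_sum[OF Q])
  ultimately have "theta_const Q = theta_const p + - Q * J2 1 6 (Q^3) + - Q * J2 1 6 (Q^3)"
    by (rule has_sum_unique[symmetric])
  then show ?thesis by (simp add: p_def)
qed

lemma euler_product_cubic:
  fixes Q :: complex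
  assumes Q: "norm Q < 1" and \<zeta>: "\<zeta> = \<omega>\<^sub>3 \<or> \<zeta> = \<omega>\<^sub>3 ^ 2"
  shows "qpoch_inf Q Q * qpoch_inf (\<zeta> * Q) (\<zeta> * Q) * qpoch_inf (\<zeta>^2 * Q) (\<zeta>^2 * Q) =
    qpoch_inf (Q^3) (Q^3) ^ 4 / qpoch_inf (Q^9) (Q^9)"
proof -
  define q where "q = Q^3"
  have q: "norm q < 1" unfolding q_def by (intro norm_power_less_one Q) simp
  have z3: "\<zeta>^3 = 1" 
  proof -
    have "(\<omega>\<^sub>3 ^ 2) ^ 3 = 1" using omega3_cube by algebra
    then show ?thesis using \<zeta> by auto
  qed
  have z: "norm \<zeta> = 1" using \<zeta> by (auto simp: norm_power)
  have tri: "qpoch_inf X X = qpoch_inf X q * qpoch_inf (X^2) q * qpoch_inf q q" if "X^3 = q" for X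
  proof -
    have "norm X ^ 3 = norm q" using that by (metis norm_power)
    then have X: "norm X < 1" using q one_le_power[of "norm X" 3] by linarith
    have "X * X = X^2" "X * X^2 = q" using that by (simp_all add: power2_eq_square power3_eq_cube mult.assoc)
    then show ?thesis using qpoch_inf_trisect[OF X, of X] that by simp
  qed
  have 1: "qpoch_inf x q * qpoch_inf (\<zeta> * x) q * qpoch_inf (\<zeta>^2 * x) q = qpoch_inf (x^3) (q^3)" for x
  proof -
    have "(\<omega>\<^sub>3 ^ 2) ^ 2 = \<omega>\<^sub>3" using omega3_cube by algebra
    with \<zeta> show ?thesis
      using qpoch_inf_cubic[OF q, of x] by (elim disjE) (simp_all only: mult_ac)
  qed
  have z4: "(\<zeta>^2)^2 = \<zeta>" using z3 by algebra
  have 2: "qpoch_inf x q * qpoch_inf (\<zeta>^2 * x) q * qpoch_inf (\<zeta> * x) q = qpoch_inf (x^3) (q^3)" for x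
    using 1[of x] by (simp add: mult_ac)
  have "qpoch_inf Q Q * qpoch_inf (\<zeta> * Q) (\<zeta> * Q) * qpoch_inf (\<zeta>^2 * Q) (\<zeta>^2 * Q) =
     (qpoch_inf Q q * qpoch_inf (\<zeta> * Q) q * qpoch_inf (\<zeta>^2 * Q) q) *
     (qpoch_inf (Q^2) q * qpoch_inf (\<zeta>^2 * Q^2) q * qpoch_inf (\<zeta> * Q^2) q) * qpoch_inf q q ^ 3"
  proof -
    have c1: "(\<zeta> * Q)^3 = q" by (simp add: power_mult_distrib z3 q_def)
    have c2: "(\<zeta>^2 * Q)^3 = q"
    proof -
      have "(\<zeta>^2)^3 = (\<zeta>^3)^2" by (simp flip: power_mult)
      then show ?thesis by (simp add: power_mult_distrib z3 q_def)
    qed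
    have "(\<zeta>^2 * Q)^2 = \<zeta> * Q^2" "(\<zeta> * Q)^2 = \<zeta>^2 * Q^2" by (simp_all only: power_mult_distrib z4)
    then have "qpoch_inf Q Q = qpoch_inf Q q * qpoch_inf (Q^2) q * qpoch_inf q q"
      "qpoch_inf (\<zeta> * Q) (\<zeta> * Q) = qpoch_inf (\<zeta> * Q) q * qpoch_inf (\<zeta>^2 * Q^2) q * qpoch_inf q q"
      "qpoch_inf (\<zeta>^2 * Q) (\<zeta>^2 * Q) = qpoch_inf (\<zeta>^2 * Q) q * qpoch_inf (\<zeta> * Q^2) q * qpoch_inf q q"
      using tri[of Q] tri[OF c1] tri[OF c2] by (simp_all add: q_def)
    then show ?thesis by (simp only: power3_eq_cube mult_ac)
  qed
  also have "\<dots> = qpoch_inf q (q^3) * qpoch_inf (q^2) (q^3) * qpoch_inf q q ^ 3"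
    unfolding 1 2 by (simp add: q_def flip: power_mult)
  also have "qpoch_inf q (q^3) * qpoch_inf (q^2) (q^3) = qpoch_inf q q / qpoch_inf (q^3) (q^3)"
    using euler_cubic[OF q] euler_nonzero[OF q, of 3] by (simp add: field_simps)
  also have "qpoch_inf q q / qpoch_inf (q^3) (q^3) * qpoch_inf q q ^ 3 = qpoch_inf q q ^ 4 / qpoch_inf (q^3) (q^3)"
    by (simp add: power3_eq_cube power4_eq_xxxx)
  finally show ?thesis by (simp add: q_def flip: power_mult)
qed

lemma theta_const_product:
  fixes Q :: complex
  assumes Q: "norm Q < 1" "Q \<noteq> 0"
  defines "q \<equiv> Q^3"
  shows "theta_const Q * theta_const (\<omega>\<^sub>3 * Q) * theta_const (\<omega>\<^sub>3^2 * Q) =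
    J1 1 q ^ 8 * J1 6 q / (J1 3 q ^ 2 * J1 2 q ^ 4)"
proof -
  have n: "norm (\<omega>\<^sub>3 * Q) < 1" "norm (\<omega>\<^sub>3^2 * Q) < 1" "norm (Q^2) < 1"
    using Q norm_power_less_one[OF Q(1), of 2] by (auto simp: norm_mult norm_power)
  have A: "qpoch_inf Q Q * qpoch_inf (\<omega>\<^sub>3 * Q) (\<omega>\<^sub>3 * Q) * qpoch_inf (\<omega>\<^sub>3^2 * Q) (\<omega>\<^sub>3^2 * Q) = J1 1 q ^ 4 / J1 3 q"
    using euler_product_cubic[OF Q(1), of \<omega>\<^sub>3] by (simp add: J1_def q_def flip: power_mult)
  have B: "qpoch_inf (Q^2) (Q^2) * qpoch_inf ((\<omega>\<^sub>3 * Q)^2) ((\<omega>\<^sub>3 * Q)^2) * qpoch_inf ((\<omega>\<^sub>3^2 * Q)^2) ((\<omega>\<^sub>3^2 * Q)^2) = J1 2 q ^ 4 / J1 6 q"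
    using euler_product_cubic[OF n(3), of "\<omega>\<^sub>3^2"] by (simp add: J1_def q_def power_mult_distrib flip: power_mult)
  have nz: "J1 m q \<noteq> 0" if "m > 0" for m
    unfolding J1_def q_def using euler_nonzero[of "Q^3" m] norm_power_less_one[OF Q(1), of 3] that by simp
  have "theta_const Q * theta_const (\<omega>\<^sub>3 * Q) * theta_const (\<omega>\<^sub>3^2 * Q) =
    (qpoch_inf Q Q * qpoch_inf (\<omega>\<^sub>3 * Q) (\<omega>\<^sub>3 * Q) * qpoch_inf (\<omega>\<^sub>3^2 * Q) (\<omega>\<^sub>3^2 * Q))^2 /
    (qpoch_inf (Q^2) (Q^2) * qpoch_inf ((\<omega>\<^sub>3 * Q)^2) ((\<omega>\<^sub>3 * Q)^2) * qpoch_inf ((\<omega>\<^sub>3^2 * Q)^2) ((\<omega>\<^sub>3^2 * Q)^2))"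
    using theta_const_eq[OF Q] theta_const_eq[OF n(1)] theta_const_eq[OF n(2)] Q by (simp add: power_mult_distrib)
  also have "\<dots> = (J1 1 q ^ 4 / J1 3 q)^2 / (J1 2 q ^ 4 / J1 6 q)" unfolding A B ..
  also have "\<dots> = J1 1 q ^ 8 * J1 6 q / (J1 3 q ^ 2 * J1 2 q ^ 4)"
    by (simp add: power_divide flip: power_mult)
  finally show ?thesis .
qed

text \<open>The component of \<open>1/\<phi>(-Q) = 1/theta_const Q\<close> with exponents congruent to 2 modulo 3.\<close>

lemma inverse_theta_const_component:
  fixes Q :: complex
  assumes Q: "norm Q < 1" "Q \<noteq> 0"
  defines "q \<equiv> Q^3"
  shows "(\<Sum>i<3. 1 / ((\<omega>\<^sub>3 ^ i * Q)^2 * theta_const (\<omega>\<^sub>3 ^ i * Q))) = 12 * J1 6 q ^ 3 * J1 2 q ^ 2 / J1 1 q ^ 6"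
proof -
  have q: "norm q < 1" "q \<noteq> 0" unfolding q_def using norm_power_less_one[OF Q(1), of 3] Q by auto
  have n: "norm (\<omega>\<^sub>3 * Q) < 1" "norm (\<omega>\<^sub>3^2 * Q) < 1" using Q by (auto simp: norm_mult norm_power)
  define a b D where "a = theta_const (q^3)" and "b = J2 1 6 q"
    and "D = theta_const Q * theta_const (\<omega>\<^sub>3 * Q) * theta_const (\<omega>\<^sub>3^2 * Q)"
  define w where "w = \<omega>\<^sub>3"
  have w: "w^2 = - 1 - w" "w^3 = 1" "w \<noteq> 0" by (auto simp: w_def omega3_square)
  have cubes: "(w * Q)^3 = q" "(w^2 * Q)^3 = q" "(w * Q)^9 = q^3" "(w^2 * Q)^9 = q^3"
    unfolding q_def using w(2) by algebra+
  have "Q^9 = q^3" by (simp add: q_def flip: power_mult)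
  note cubes = cubes this
  have t: "theta_const Q = a - 2 * Q * b" "theta_const (w * Q) = a - 2 * (w * Q) * b"
    "theta_const (w^2 * Q) = a - 2 * (w^2 * Q) * b"
    using theta_const_trisect[OF Q] theta_const_trisect[of "w * Q"] theta_const_trisect[of "w^2 * Q"] n Q cubes
    by (auto simp: a_def b_def w_def q_def[symmetric])
  have nz: "a - 2 * Q * b \<noteq> 0" "a - 2 * (w * Q) * b \<noteq> 0" "a - 2 * (w^2 * Q) * b \<noteq> 0"
    using t theta_const_nonzero Q n by (auto simp: w_def)
  have D: "D = (a - 2 * Q * b) * (a - 2 * (w * Q) * b) * (a - 2 * (w^2 * Q) * b)"
    unfolding D_def w_def[symmetric] t ..
  have D0: "D \<noteq> 0" using nz by (simp add: D)
  \<comment> \<open>D = a^3 - 8 q b^3 is the product over all rotations, so 1/(a - 2 X b) gets the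
    numerator a^2 + 2 a X b + 4 X^2 b^2 over a denominator independent of the rotation.\<close>
  have inverseI: "1 / X = N / D" if "D = X * N" for X N
    using D0 that by (auto simp: field_simps)
  have i1: "1 / (a - 2 * Q * b) = (a^2 + 2 * a * Q * b + 4 * Q^2 * b^2) / D"
    by (rule inverseI) (use w D in algebra)
  have i2: "1 / (a - 2 * (w * Q) * b) = (a^2 + 2 * a * (w * Q) * b + 4 * (w * Q)^2 * b^2) / D"
    by (rule inverseI) (use w D in algebra)
  have i3: "1 / (a - 2 * (w^2 * Q) * b) = (a^2 + 2 * a * (w^2 * Q) * b + 4 * (w^2 * Q)^2 * b^2) / D"
    by (rule inverseI) (use w D in algebra)
  have inv: "1 / (w * Q)^2 = w / Q^2" "1 / (w^2 * Q)^2 = w^2 / Q^2"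
  proof -
    have "w * w^2 = 1" "w^2 * (w^2)^2 = 1" using w(2) by algebra+
    then show "1 / (w * Q)^2 = w / Q^2" "1 / (w^2 * Q)^2 = w^2 / Q^2"
      using Q w(3) by (simp_all add: power_mult_distrib divide_simps)
  qed
  have "(\<Sum>i<3. 1 / ((\<omega>\<^sub>3 ^ i * Q)^2 * theta_const (\<omega>\<^sub>3 ^ i * Q))) =
     1 / Q^2 * (1 / theta_const Q) + 1 / (w * Q)^2 * (1 / theta_const (w * Q)) + 1 / (w^2 * Q)^2 * (1 / theta_const (w^2 * Q))"
    by (simp add: numeral_3_eq_3 w_def) (simp add: power2_eq_square)
  also have "\<dots> = ((a^2 + 2 * a * Q * b + 4 * Q^2 * b^2) + w * (a^2 + 2 * a * (w * Q) * b + 4 * (w * Q)^2 * b^2)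
      + w^2 * (a^2 + 2 * a * (w^2 * Q) * b + 4 * (w^2 * Q)^2 * b^2)) / (Q^2 * D)"
  proof -
    have "1 / Y * (N1 / D) + x / Y * (N2 / D) + x' / Y * (N3 / D) = (N1 + x * N2 + x' * N3) / (Y * D)"
      for Y N1 N2 N3 x x' :: complex
      by (simp add: add_divide_distrib mult_ac)
    then show ?thesis unfolding t i1 i2 i3 inv .
  qed
  \<comment> \<open>The weights 1, \<omega>, \<omega>^2 annihilate the terms in a^2 and in a Q b;
    three copies of 4 Q^2 b^2 remain.\<close>
  also have "(a^2 + 2 * a * Q * b + 4 * Q^2 * b^2) + w * (a^2 + 2 * a * (w * Q) * b + 4 * (w * Q)^2 * b^2)
      + w^2 * (a^2 + 2 * a * (w^2 * Q) * b + 4 * (w^2 * Q)^2 * b^2) = 12 * Q^2 * b^2"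
    using w by algebra
  also have "12 * Q^2 * b^2 / (Q^2 * D) = 12 * b^2 / D" using Q by simp
  also have "\<dots> = 12 * J1 6 q ^ 3 * J1 2 q ^ 2 / J1 1 q ^ 6"
  proof -
    have nzJ: "J1 m q \<noteq> 0" if "m > 0" for m unfolding J1_def using euler_nonzero[OF q(1) that] .
    have D': "D = J1 1 q ^ 8 * J1 6 q / (J1 3 q ^ 2 * J1 2 q ^ 4)" unfolding D_def q_def by (rule theta_const_product[OF Q])
    have e: "12 * (x1 * x6^2 / (x2 * x3))^2 / (x1^8 * x6 / (x3^2 * x2^4)) = 12 * x6^3 * x2^2 / x1^6"
      if "x1 \<noteq> 0" "x2 \<noteq> 0" "x3 \<noteq> 0" "x6 \<noteq> 0" for x1 x2 x3 x6 :: complex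
      using that by (simp add: divide_simps eval_nat_numeral)
    show ?thesis unfolding b_def J2_1_6_eq[OF q] D' by (rule e) (auto intro!: nzJ)
  qed
  finally show ?thesis .
qed

section \<open>The trisected Appell sum\<close>

text \<open>For q = Q^3 its zeros are the q^n and the points \<omega>^i Q^m with 3 not dividing m.
  These include the poles of f(z;Q), f(z;\<omega> Q), f(z;\<omega>^2 Q) and of both terms of
  \<open>appell_dissected\<close>.\<close>

definition theta_triple :: "complex \<Rightarrow> complex \<Rightarrow> complex" where
  "theta_triple q z = theta_j z q * theta_j (q * z^3) (q^3) * theta_j (q^2 * z^3) (q^3)"

text \<open>The quotient of \<open>theta_triple\<close> by j(z;Q), written as the product over the
  rotated zeros so that it is holomorphic on the punctured plane and has a meaning at the zeros of
  j(z;Q) too.\<close>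

definition theta_cofactor :: "complex \<Rightarrow> complex \<Rightarrow> complex" where
  "theta_cofactor Q z =
     (qpoch_inf (\<omega>\<^sub>3 * (Q * z)) (Q^3) * qpoch_inf (\<omega>\<^sub>3^2 * (Q * z)) (Q^3))
   * (qpoch_inf (\<omega>\<^sub>3 * (Q^2 * z)) (Q^3) * qpoch_inf (\<omega>\<^sub>3^2 * (Q^2 * z)) (Q^3))
   * (qpoch_inf (\<omega>\<^sub>3 * (Q / z)) (Q^3) * qpoch_inf (\<omega>\<^sub>3^2 * (Q / z)) (Q^3))
   * (qpoch_inf (\<omega>\<^sub>3 * (Q^2 / z)) (Q^3) * qpoch_inf (\<omega>\<^sub>3^2 * (Q^2 / z)) (Q^3))
   * qpoch_inf (Q^3) (Q^3) * qpoch_inf (Q^9) (Q^9) ^ 2 / qpoch_inf Q Q"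

text \<open>The products of base Q are split modulo 3, and the two rotated factors of the cofactor
  complete each factor in Q or Q^2 to a product of base q^3. The common factor 1 - z is left out
  because the identity is evaluated at z = 1.\<close>

lemma theta0_cofactor:
  fixes Q z :: complex
  assumes Q: "norm Q < 1" "Q \<noteq> 0" and z: "z \<noteq> 0" and q: "q = Q^3"
  shows "theta0 z Q * theta_cofactor Q z = theta0 z q * theta_j (q * z^3) (q^3) * theta_j (q^2 * z^3) (q^3)"
proof -
  have nq: "norm q < 1" unfolding q by (intro norm_power_less_one Q) simp
  have q0: "q \<noteq> 0" using Q q by simp
  have q3: "Q^9 = q^3" by (simp add: q flip: power_mult)
  have 1: "qpoch_inf (z * Q) Q = qpoch_inf (Q * z) q * qpoch_inf (Q^2 * z) q * qpoch_inf (z * q) q"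
    using qpoch_inf_trisect[OF Q(1), of "z * Q"] by (simp add: q power2_eq_square power3_eq_cube mult_ac)
  have 2: "qpoch_inf (Q / z) Q = qpoch_inf (Q / z) q * qpoch_inf (Q^2 / z) q * qpoch_inf (q / z) q"
    using qpoch_inf_trisect[OF Q(1), of "Q / z"] by (simp add: q power2_eq_square power3_eq_cube mult_ac)
  have c: "qpoch_inf x q * qpoch_inf (\<omega>\<^sub>3 * x) q * qpoch_inf (\<omega>\<^sub>3^2 * x) q = qpoch_inf (x^3) (q^3)" for x
    by (rule qpoch_inf_cubic[OF nq])
  have e: "(Q * z)^3 = q * z^3" "(Q^2 * z)^3 = q^2 * z^3" "(Q / z)^3 = q^3 / (q^2 * z^3)" "(Q^2 / z)^3 = q^3 / (q * z^3)"
    using Q z by (simp_all add: q power_mult_distrib power_divide divide_simps flip: power_mult power_add)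
  have t: "theta_j (q * z^3) (q^3) = qpoch_inf ((Q * z)^3) (q^3) * qpoch_inf ((Q^2 / z)^3) (q^3) * qpoch_inf (q^3) (q^3)"
    "theta_j (q^2 * z^3) (q^3) = qpoch_inf ((Q^2 * z)^3) (q^3) * qpoch_inf ((Q / z)^3) (q^3) * qpoch_inf (q^3) (q^3)"
    unfolding e theta_j_def by simp_all
  show ?thesis
    unfolding t c[symmetric] theta0_def 1 2 theta_cofactor_def q3 q[symmetric]
    using euler_nonzero_1[OF Q(1)] by (simp add: power2_eq_square mult_ac)
qed

lemma theta_cofactor:
  fixes Q z :: complex
  assumes Q: "norm Q < 1" "Q \<noteq> 0" and z: "z \<noteq> 0" and q: "q = Q^3"
  shows "theta_j z Q * theta_cofactor Q z = theta_triple q z"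
proof -
  have nq: "norm q < 1" unfolding q by (intro norm_power_less_one Q) simp
  have "(1 - z) * (theta0 z Q * theta_cofactor Q z) = (1 - z) * (theta0 z q * theta_j (q * z^3) (q^3) * theta_j (q^2 * z^3) (q^3))"
    unfolding theta0_cofactor[OF assms] ..
  then show ?thesis by (simp add: theta_triple_def theta_j_eq_theta0[OF Q(1), of z] theta_j_eq_theta0[OF nq, of z] mult.assoc)
qed

lemma holomorphic_theta_cofactor:
  assumes "norm Q < 1"
  shows "theta_cofactor Q holomorphic_on - {0}"
proof -
  have "norm (Q^3) < 1" by (intro norm_power_less_one assms) simp
  then show ?thesis unfolding theta_cofactor_def by (intro holomorphic_intros) (use euler_nonzero_1[OF assms] in auto)
qed

lemma theta_triple_shift:
  assumes q: "norm q < 1" "q \<noteq> 0" and z: "z \<noteq> 0"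
  shows "theta_triple q (q * z) = - theta_triple q z / (q^3 * z^7)"
proof -
  have q3: "norm (q^3) < 1" "q^3 \<noteq> 0" using q by (auto intro: norm_power_less_one)
  have "q * (q * z)^3 = q^3 * (q * z^3)" "q^2 * (q * z)^3 = q^3 * (q^2 * z^3)" by (simp_all add: power_mult_distrib)
  note e = this
  have "theta_j (q * (q * z)^3) (q^3) = - theta_j (q * z^3) (q^3) / (q * z^3)"
    unfolding e(1) by (rule theta_j_shift[OF q3]) (use q z in simp)
  moreover have "theta_j (q^2 * (q * z)^3) (q^3) = - theta_j (q^2 * z^3) (q^3) / (q^2 * z^3)"
    unfolding e(2) by (rule theta_j_shift[OF q3]) (use q z in simp)
  ultimately have "theta_triple q (q * z) = (- theta_j z q / z) * (- theta_j (q * z^3) (q^3) / (q * z^3)) * (- theta_j (q^2 * z^3) (q^3) / (q^2 * z^3))"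
    unfolding theta_triple_def by (simp only: theta_j_shift[OF q z])
  also have "(- A / z) * (- B / (q * z^3)) * (- C / (q^2 * z^3)) = - (A * B * C) / (q^3 * z^7)" for A B C
    using q z by (simp add: field_simps eval_nat_numeral)
  finally show ?thesis unfolding theta_triple_def .
qed

lemma theta_j_nonzero_inner:
  assumes q: "norm q < 1" "q \<noteq> 0" and z: "norm q < norm z" "norm z < 1"
  shows "theta_j z q \<noteq> 0"
proof -
  have z0: "z \<noteq> 0" using z by auto
  have "theta_j (1 / z) q \<noteq> 0"
    using z q z0 by (intro theta_j_nonzero_annulus) (auto simp: norm_divide field_simps)
  then show ?thesis using theta_j_inverse[OF q z0] z0 by auto
qed

lemma theta_j_nonzero_unit:
  assumes q: "norm q < 1" "q \<noteq> 0" and z: "norm z = 1" "z \<noteq> 1"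
  shows "theta_j z q \<noteq> 0"
proof -
  have "norm (z * q) < 1" "norm (q / z) < 1" using q z by (simp_all add: norm_mult norm_divide)
  then have "theta0 z q \<noteq> 0" unfolding theta0_def
    using qpoch_inf_nonzero[of "z * q" q] qpoch_inf_nonzero[of "q / z" q] qpoch_inf_nonzero[of q q] q by simp
  then show ?thesis using z q by (simp add: theta_j_eq_theta0)
qed

text \<open>On the unit circle |q z^3| = |q| and |q^2 z^3| = |q|^2 lie strictly between |q|^3 and 1,
  where the theta function of base q^3 has no zeros.\<close>

lemma theta_triple_nonzero:
  assumes q: "norm q < 1" "q \<noteq> 0" and z: "norm z = 1" "z \<noteq> 1"
  shows "theta_triple q z \<noteq> 0" "theta_j (q * z^3) (q^3) \<noteq> 0" "theta_j (q^2 * z^3) (q^3) \<noteq> 0"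
proof -
  have q3: "norm (q^3) < 1" "q^3 \<noteq> 0" using q by (auto intro: norm_power_less_one)
  have "norm q ^ 3 < norm q ^ 1" "norm q ^ 3 < norm q ^ 2" using q by (intro power_strict_decreasing; simp)+
  moreover have "norm q ^ 2 < 1" using norm_power_less_one[OF q(1), of 2] by (simp add: norm_power)
  moreover have "norm (q * z^3) = norm q" "norm (q^2 * z^3) = norm q ^ 2" "norm (q^3) = norm q ^ 3"
    using z by (simp_all add: norm_mult norm_power)
  ultimately have "norm (q^3) < norm (q * z^3)" "norm (q * z^3) < 1" "norm (q^3) < norm (q^2 * z^3)" "norm (q^2 * z^3) < 1"
    using q by (simp_all only: power_one_right)
  then show 1: "theta_j (q * z^3) (q^3) \<noteq> 0" "theta_j (q^2 * z^3) (q^3) \<noteq> 0"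
    by (simp_all only: theta_j_nonzero_inner[OF q3] not_False_eq_True)
  show "theta_triple q z \<noteq> 0" using 1 theta_j_nonzero_unit[OF q z] by (simp add: theta_triple_def)
qed

text \<open>The W of the overview: averaging over the three rotations of Q with weight 1/Q^2 selects
  the exponents 3 n + 2 and divides by Q^2. The summand 1 of the generating function is left out,
  since \<open>sum_inverse_rotation\<close> annihilates it.\<close>

definition appell_component :: "complex \<Rightarrow> complex \<Rightarrow> complex" where
  "appell_component Q z = (\<Sum>i<3. 2 / (3 * (\<omega>\<^sub>3 ^ i * Q)^2 * theta_const (\<omega>\<^sub>3 ^ i * Q)) * (z * appell_f (\<omega>\<^sub>3 ^ i * Q) z))"

definition appell_dissected :: "complex \<Rightarrow> complex \<Rightarrow> complex" where
  "appell_dissected q z = 2 / theta_const (q^3) * (appell_f (q^3) (q / z^3) / z - z * appell_f (q^3) (q * z^3))"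

lemma omega3_rotation:
  fixes Q :: complex
  assumes Q: "norm Q < 1" "Q \<noteq> 0"
  shows "norm (\<omega>\<^sub>3 ^ i * Q) < 1" "\<omega>\<^sub>3 ^ i * Q \<noteq> 0" "(\<omega>\<^sub>3 ^ i * Q)^3 = Q^3"
proof -
  have "(\<omega>\<^sub>3 ^ i)^3 = (\<omega>\<^sub>3 ^ 3) ^ i" by (simp only: power_mult[symmetric] mult.commute)
  then show "(\<omega>\<^sub>3 ^ i * Q)^3 = Q^3" by (simp add: power_mult_distrib)
qed (use Q in \<open>auto simp: norm_mult norm_power\<close>)

lemma sum_lessThan_3:
  fixes f :: "nat \<Rightarrow> complex"
  shows "(\<Sum>i<3. f i) = f 0 + f 1 + f 2"
  by (simp add: numeral_3_eq_3 numeral_2_eq_2)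

lemma sum_inverse_rotation: "(\<Sum>i<3. 1 / (\<omega>\<^sub>3 ^ i * Q)^2) = 0"
proof (cases "Q = 0")
  case False
  define w where "w = \<omega>\<^sub>3"
  have w: "w^2 = - 1 - w" "w^3 = 1" "w \<noteq> 0" by (auto simp: w_def omega3_square)
  have "w * w^2 = 1" "w^2 * (w^2)^2 = 1" using w(2) by algebra+
  then have "1 / (w * Q)^2 = w / Q^2" "1 / (w^2 * Q)^2 = w^2 / Q^2"
    using False w(3) by (simp_all add: power_mult_distrib divide_simps)
  then have "(\<Sum>i<3. 1 / (\<omega>\<^sub>3 ^ i * Q)^2) = (1 + w + w^2) / Q^2"
    unfolding sum_lessThan_3 w_def[symmetric] by (simp add: add_divide_distrib)
  then show ?thesis using w(1) by simp
qed simp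

text \<open>The shift by Q^3 is three iterations of the shift by Q. The exponents 8 and 5 of Q are 2
  modulo 3, so these two theta terms survive the averaging over rotations, while the one with Q^9 is
  removed by it.\<close>

lemma appell_f_shift_cube:
  fixes Q z :: complex
  assumes Q: "norm Q < 1" "Q \<noteq> 0" and z: "z \<noteq> 0" "theta_j z Q \<noteq> 0"
  defines "t \<equiv> theta_const Q"
  shows "(Q^3 * z) * appell_f Q (Q^3 * z) = - (Q^9 * z^6 * (z * appell_f Q z + t)) + Q^8 * z^4 * t - Q^5 * z^2 * t"
proof -
  have z1: "Q * z \<noteq> 0" "theta_j (Q * z) Q \<noteq> 0" using Q z theta_j_shift_nonzero[OF Q z] by auto
  have z2: "Q * (Q * z) \<noteq> 0" "theta_j (Q * (Q * z)) Q \<noteq> 0" using Q z theta_j_shift_nonzero[OF Q z1] by auto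
  have e: "Q^3 * z = Q * (Q * (Q * z))" by (simp add: power3_eq_cube)
  show ?thesis
    unfolding e appell_f_shift[OF Q z2] appell_f_shift[OF Q z1] appell_f_shift[OF Q z] t_def[symmetric]
    by algebra
qed

lemma appell_component_shift:
  fixes Q z :: complex
  assumes Q: "norm Q < 1" "Q \<noteq> 0" and z: "z \<noteq> 0" and q: "q = Q^3" and t: "theta_triple q z \<noteq> 0"
  shows "appell_component Q (q * z) = - (q^3 * z^6 * appell_component Q z) - 2 * q * z^2 + 2 * q^2 * z^4"
proof -
  define R where "R = (\<lambda>i. \<omega>\<^sub>3 ^ i * Q)"
  define a where "a = (\<lambda>i. 2 / (3 * R i ^ 2 * theta_const (R i)))"
  have R: "norm (R i) < 1" "R i \<noteq> 0" "R i ^ 3 = q" for i using omega3_rotation[OF Q] by (auto simp: R_def q)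
  have "a i * ((q * z) * appell_f (R i) (q * z)) =
      - (q^3 * z^6) * (a i * (z * appell_f (R i) z)) - 2 / 3 * q^3 * z^6 * (1 / R i ^ 2) + (2 * q^2 * z^4 / 3 - 2 * q * z^2 / 3)" for i
  proof -
    have "theta_j z (R i) \<noteq> 0" using theta_cofactor[OF R(1,2) z R(3)[symmetric], of i] t by (metis mult_zero_left)
    note s = appell_f_shift_cube[OF R(1,2) z this, unfolded R(3)]
    have p: "R i ^ 9 = q^3" "R i ^ 8 = q^2 * R i ^ 2" "R i ^ 5 = q * R i ^ 2"
      unfolding R(3)[of i, symmetric] by (simp_all flip: power_mult power_add)
    have at: "a i * theta_const (R i) = 2 / (3 * R i ^ 2)" "a i * theta_const (R i) * R i ^ 2 = 2 / 3"
      using theta_const_nonzero[OF R(1,2)[of i]] R(2)[of i] by (auto simp: a_def)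
    have "a i * ((q * z) * appell_f (R i) (q * z)) =
      - (q^3 * z^6) * (a i * (z * appell_f (R i) z)) - q^3 * z^6 * (a i * theta_const (R i))
      + (q^2 * z^4 - q * z^2) * (a i * theta_const (R i) * R i ^ 2)"
      unfolding s p by (simp add: algebra_simps)
    then show ?thesis unfolding at(2) unfolding at(1) by (simp add: algebra_simps)
  qed
  then have "appell_component Q (q * z) = (\<Sum>i<3. - (q^3 * z^6) * (a i * (z * appell_f (R i) z)) - 2 / 3 * q^3 * z^6 * (1 / R i ^ 2) + (2 * q^2 * z^4 / 3 - 2 * q * z^2 / 3))"
    by (simp add: appell_component_def a_def R_def)
  also have "\<dots> = - (q^3 * z^6) * (\<Sum>i<3. a i * (z * appell_f (R i) z)) - 2 / 3 * q^3 * z^6 * (\<Sum>i<3. 1 / R i ^ 2)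
      + 3 * (2 * q^2 * z^4 / 3 - 2 * q * z^2 / 3)"
    by (simp only: sum.distrib sum_subtractf sum_distrib_left) simp
  also have "(\<Sum>i<3. 1 / R i ^ 2) = 0" unfolding R_def by (rule sum_inverse_rotation)
  also have "(\<Sum>i<3. a i * (z * appell_f (R i) z)) = appell_component Q z" by (simp add: appell_component_def a_def R_def)
  finally show ?thesis by (simp add: algebra_simps)
qed

text \<open>In base p = q^3 the argument q z^3 moves forward by one period and q/z^3 moves back by
  one; the latter is the shift equation at v = q/(q z)^3, solved for f(v). The theta terms cancel
  against the prefactor and leave the inhomogeneity that W has.\<close>

lemma appell_dissected_shift:
  fixes q z :: complex
  assumes q: "norm q < 1" "q \<noteq> 0" and z: "z \<noteq> 0" and t: "theta_triple q z \<noteq> 0"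
  shows "appell_dissected q (q * z) = - (q^3 * z^6 * appell_dissected q z) - 2 * q * z^2 + 2 * q^2 * z^4"
proof -
  define p a where "p = q^3" and "a = theta_const p"
  have p: "norm p < 1" "p \<noteq> 0" using q by (auto simp: p_def intro: norm_power_less_one)
  have a0: "a \<noteq> 0" unfolding a_def by (rule theta_const_nonzero[OF p])
  have t1: "theta_j (q * z^3) p \<noteq> 0" "theta_j (q^2 * z^3) p \<noteq> 0" using t by (auto simp: theta_triple_def p_def)
  define u where "u = q * z^3"
  have u: "u \<noteq> 0" using q z by (simp add: u_def)
  have f1: "appell_f p (q * (q * z)^3) = - (u^2 * appell_f p u) - u * a"
  proof -
    have e: "q * (q * z)^3 = p * u" by (simp add: u_def p_def power_mult_distrib)
    have tu: "theta_j u p \<noteq> 0" using t1 by (simp add: u_def)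
    show ?thesis unfolding e appell_f_shift[OF p u tu] a_def by simp
  qed
  define v where "v = q / (q * z)^3"
  have v: "v \<noteq> 0" "p * v = q / z^3" using q z by (auto simp: v_def p_def power_mult_distrib)
  have "theta_j (p * v) p \<noteq> 0"
  proof -
    have "p / (q^2 * z^3) = q / z^3" using q z by (simp add: p_def divide_simps eval_nat_numeral)
    then have "p / (q^2 * z^3) = p * v" by (simp only: v(2))
    then show ?thesis using theta_j_reflect[of "q^2 * z^3" p] p q z t1 by simp
  qed
  then have tv: "theta_j v p \<noteq> 0" using theta_j_shift[OF p v(1)] by auto
  have f2: "v^2 * appell_f p v = - appell_f p (q / z^3) - v * a"
    using appell_f_shift[OF p v(1) tv] by (simp add: v a_def)
  have v2: "v * (q^2 * z^3) = 1" using q z by (simp add: v_def power_mult_distrib divide_simps eval_nat_numeral)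
  have f2': "appell_f p v = - (q^4 * z^6 * appell_f p (q / z^3)) - q^2 * z^3 * a"
  proof -
    have "appell_f p v = (v * (q^2 * z^3))^2 * appell_f p v" unfolding v2 by simp
    also have "\<dots> = (q^2 * z^3)^2 * (v^2 * appell_f p v)" by (simp add: power_mult_distrib mult_ac)
    also have "\<dots> = - ((q^2 * z^3)^2 * appell_f p (q / z^3)) - (v * (q^2 * z^3)) * (q^2 * z^3) * a"
      unfolding f2 by (simp add: algebra_simps power2_eq_square)
    finally show ?thesis unfolding v2 by (simp add: power_mult_distrib flip: power_mult)
  qed
  define G where "G = appell_f p (q / z^3)"
  define H where "H = appell_f p u"
  have fr: "(- (q^4 * z^6 * G) - q^2 * z^3 * a) / (q * z) = - (q^3 * z^6 * (G / z)) - q * z^2 * a"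
    using q z by (simp add: divide_simps) (simp add: algebra_simps eval_nat_numeral)
  have "appell_dissected q (q * z) = 2 / a * ((- (q^4 * z^6 * G) - q^2 * z^3 * a) / (q * z) - q * z * (- (u^2 * H) - u * a))"
    unfolding appell_dissected_def p_def[symmetric] a_def[symmetric] v_def[symmetric] f1 f2' G_def H_def ..
  also have "\<dots> = - (q^3 * z^6 * (2 / a * (G / z - z * H))) + (2 / a * a) * (- q * z^2 + q^2 * z^4)"
    unfolding fr u_def by (simp add: algebra_simps power2_eq_square eval_nat_numeral)
  also have "2 / a * a = 2" using a0 by simp
  finally show ?thesis
    unfolding appell_dissected_def p_def[symmetric] a_def[symmetric] G_def H_def u_def by (simp add: algebra_simps)
qed

text \<open>f(-1;R) = \<phi>(-R)/2 makes every summand a multiple of 1/R^2, and these sum to zero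
  over the rotations.\<close>

lemma appell_component_minus_one:
  fixes Q :: complex
  assumes Q: "norm Q < 1" "Q \<noteq> 0"
  shows "appell_component Q (-1) = 0"
proof -
  have "2 / (3 * (\<omega>\<^sub>3 ^ i * Q)^2 * theta_const (\<omega>\<^sub>3 ^ i * Q)) * (- 1 * appell_f (\<omega>\<^sub>3 ^ i * Q) (-1)) = - 1 / 3 * (1 / (\<omega>\<^sub>3 ^ i * Q)^2)" for i
  proof -
    define R where "R = \<omega>\<^sub>3 ^ i * Q"
    have R: "norm R < 1" "R \<noteq> 0" using omega3_rotation[OF Q] by (auto simp: R_def)
    have "theta_j (-1) R \<noteq> 0" by (rule theta_j_nonzero_unit[OF R]) auto
    from appell_f_inverse[OF R _ this] have "appell_f R (-1) = theta_const R - appell_f R (-1)" by simp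
    then have "2 * appell_f R (-1) = theta_const R" by (simp add: algebra_simps)
    then have h: "appell_f R (-1) = theta_const R / 2" by (simp add: mult.commute)
    show ?thesis unfolding R_def[symmetric] h using theta_const_nonzero[OF R] by simp
  qed
  then have "appell_component Q (-1) = (\<Sum>i<3. - 1 / 3 * (1 / (\<omega>\<^sub>3 ^ i * Q)^2))"
    unfolding appell_component_def by (simp only:)
  also have "\<dots> = - 1 / 3 * (\<Sum>i<3. 1 / (\<omega>\<^sub>3 ^ i * Q)^2)" by (rule sum_distrib_left[symmetric])
  finally show ?thesis unfolding sum_inverse_rotation by simp
qed

lemma appell_dissected_minus_one: "appell_dissected q (-1) = 0"
  by (simp add: appell_dissected_def)

lemma theta0_nonzero_annulus:
  assumes q: "norm q < 1" "q \<noteq> 0" and z: "norm q < norm z" "norm z < 1 / norm q"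
  shows "theta0 z q \<noteq> 0"
proof -
  have "norm z > 0" using z(1) norm_ge_zero[of q] by linarith
  then have "norm (z * q) < 1" "norm (q / z) < 1" using q z by (auto simp: norm_mult norm_divide field_simps)
  then show ?thesis unfolding theta0_def
    using qpoch_inf_nonzero[of "z * q" q] qpoch_inf_nonzero[of "q / z" q] qpoch_inf_nonzero[of q q] q by simp
qed

text \<open>j(-z;q) obeys the same rule and has in the annulus the single zero -1, where K vanishes
  too; the quotient is therefore holomorphic and elliptic, hence constant. Dividing K by z + 1 and
  theta by 1 + z separately makes the removal of the zero explicit.\<close>

lemma quasiperiodic_eq_theta:
  fixes q :: complex
  assumes q: "norm q < 1" "q \<noteq> 0" and K: "K holomorphic_on - {0}"
    and per: "\<And>z. 1 < norm z \<Longrightarrow> norm z < 1 / norm q \<Longrightarrow> K (q * z) = K z / z" and K1: "K (-1) = 0"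
    and z: "norm q < norm z" "norm z < 1 / norm q"
  shows "K z = K 1 / theta_j (-1) q * theta_j (- z) q"
proof -
  define A where "A = {z::complex. norm q < norm z \<and> norm z < 1 / norm q}"
  define k where "k = (\<lambda>z. if z = -1 then deriv K (-1) else K z / (z - (-1)))"
  define g where "g = (\<lambda>z. k z / theta0 (- z) q)"
  have "(\<lambda>z. if z = -1 then deriv K (-1) else K z / (z - (-1)) - K (-1) / (z - (-1))) holomorphic_on - {0}"
    by (rule pole_theorem_open[OF K]) (auto simp: eq_neg_iff_add_eq_0)
  also have "(\<lambda>z. if z = -1 then deriv K (-1) else K z / (z - (-1)) - K (-1) / (z - (-1))) = k"
    by (rule ext) (simp only: k_def K1 div_0 diff_zero)
  finally have k: "k holomorphic_on - {0}" .
  have A0: "A \<subseteq> - {0}" by (auto simp: A_def)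
  have gh: "g holomorphic_on A"
    unfolding g_def
  proof (intro holomorphic_intros holomorphic_on_subset[OF k A0] q)
    show "theta0 (- z) q \<noteq> 0" if "z \<in> A" for z
      using that by (intro theta0_nonzero_annulus q) (auto simp: A_def)
  qed (use A0 in auto)
  have one_plus: "theta_j (- z) q = (1 + z) * theta0 (- z) q" for z
    by (simp add: theta_j_eq_theta0 q)
  have gK: "g z = K z / theta_j (- z) q" if "z \<noteq> -1" for z
    using that by (simp add: g_def k_def one_plus add.commute)
  obtain C where C: "\<And>z. norm q < norm z \<Longrightarrow> norm z < 1 / norm q \<Longrightarrow> g z = C"
  proof (rule elliptic_constant[OF q gh[unfolded A_def]])
    fix z :: complex assume z: "1 < norm z" "norm z < 1 / norm q"
    then have z0: "z \<noteq> 0" "z \<noteq> -1" by auto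
    have "norm (q * z) < 1" using z q by (simp add: norm_mult field_simps)
    then have "q * z \<noteq> -1" by auto
    moreover have "theta_j (- (q * z)) q = theta_j (- z) q / z"
      using theta_j_shift[OF q, of "- z"] z0 by simp
    ultimately show "g (q * z) = g z" using z0 by (simp add: gK per[OF z])
  qed blast
  have Kz: "K z = C * theta_j (- z) q" if "norm q < norm z" "norm z < 1 / norm q" for z
  proof (cases "z = -1")
    case False
    have "theta_j (- z) q \<noteq> 0"
      unfolding one_plus using theta0_nonzero_annulus[OF q, of "- z"] that False by (auto simp: add_eq_0_iff)
    then show ?thesis using gK[OF False] C[OF that] by (simp add: field_simps)
  qed (simp add: K1 q)
  have "theta_j (-1) q \<noteq> 0" by (rule theta_j_nonzero_unit[OF q]) auto
  moreover have "K 1 = C * theta_j (-1) q" using Kz[of 1] q by simp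
  ultimately show ?thesis using Kz[OF z] by simp
qed

lemma theta_j_minus_one:
  assumes "norm q < 1" "q \<noteq> 0"
  shows "theta_j (-1) q = 2 * J1 2 q ^ 2 / J1 1 q"
proof -
  have "theta_j (-1) q = 2 * qpoch_inf (- q) q ^ 2 * qpoch_inf q q"
    using assms by (simp add: theta_j_eq_theta0 theta0_def power2_eq_square)
  moreover have "qpoch_inf (- q) q = J1 2 q / J1 1 q"
    using euler_odd_dist[OF assms(1)] euler_nonzero_1[OF assms(1)] by (simp add: J1_def field_simps)
  ultimately show ?thesis using euler_nonzero_1[OF assms(1)] by (simp add: J1_def power2_eq_square)
qed

lemma theta_j_cubic_base:
  assumes "norm q < 1" "q \<noteq> 0"
  shows "theta_j q (q^3) = J1 1 q" "theta_j (q^2) (q^3) = J1 1 q"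
proof -
  have "q^3 / q = q^2" "q^3 / q^2 = q" using assms by (simp_all add: eval_nat_numeral)
  then show "theta_j q (q^3) = J1 1 q" "theta_j (q^2) (q^3) = J1 1 q"
    using euler_cubic[OF assms(1)] by (simp_all add: theta_j_def J1_def mult_ac)
qed

theorem appell_component_eq:
  fixes Q z :: complex
  assumes Q: "norm Q < 1" "Q \<noteq> 0" and q: "q = Q^3"
    and z: "norm q < norm z" "norm z < 1 / norm q" and t: "theta_triple q z \<noteq> 0"
  shows "appell_component Q z - appell_dissected q z = 4 * J1 6 q ^ 3 * theta_j (- z) q / theta_triple q z"
proof -
  define p where "p = q^3"
  have nq: "norm q < 1" "q \<noteq> 0" using norm_power_less_one[OF Q(1), of 3] Q by (auto simp: q)
  have np: "norm p < 1" "p \<noteq> 0" using norm_power_less_one[OF nq(1), of 3] nq by (auto simp: p_def)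
  define R where "R = (\<lambda>i. \<omega>\<^sub>3 ^ i * Q)"
  have R: "norm (R i) < 1" "R i \<noteq> 0" "R i ^ 3 = q" for i using omega3_rotation[OF Q] by (auto simp: R_def q)
  define a where "a = (\<lambda>i. 2 / (3 * R i ^ 2 * theta_const (R i)))"
  have lift: "\<exists>h. h holomorphic_on - {0} \<and>
      (\<forall>z. z \<noteq> 0 \<longrightarrow> theta_j z X \<noteq> 0 \<longrightarrow> h z = appell_f X z * theta_j z X) \<and> h 1 = qpoch_inf X X ^ 3"
    if X: "norm X < 1" "X \<noteq> 0" for X
  proof -
    obtain h where "h holomorphic_on - {0}"
      "\<And>z. z \<noteq> 0 \<Longrightarrow> theta_j z X \<noteq> 0 \<Longrightarrow> h z = lerch_sum (gauss_coeff X) X z * theta_j z X"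
      "h 1 = gauss_coeff X 0 * qpoch_inf X X ^ 3"
      by (rule lerch_sum_theta_holomorphic[OF X gauss_coeff_summable[OF X]]) (rule that)
    then show ?thesis by (intro exI[of _ h]) (simp add: appell_f_def gauss_coeff_def)
  qed
  then have "\<forall>i. \<exists>h. h holomorphic_on - {0} \<and>
      (\<forall>z. z \<noteq> 0 \<longrightarrow> theta_j z (R i) \<noteq> 0 \<longrightarrow> h z = appell_f (R i) z * theta_j z (R i)) \<and> h 1 = qpoch_inf (R i) (R i) ^ 3"
    using R(1,2) by (intro allI lift)
  from choice[OF this] obtain h where h: "\<And>i. h i holomorphic_on - {0}"
    "\<And>i z. z \<noteq> 0 \<Longrightarrow> theta_j z (R i) \<noteq> 0 \<Longrightarrow> h i z = appell_f (R i) z * theta_j z (R i)"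
    "\<And>i. h i 1 = qpoch_inf (R i) (R i) ^ 3" by auto
  obtain hp where hp: "hp holomorphic_on - {0}"
    "\<And>z. z \<noteq> 0 \<Longrightarrow> theta_j z p \<noteq> 0 \<Longrightarrow> hp z = appell_f p z * theta_j z p"
    using lift[OF np] by blast
  define U where "U = (\<lambda>z. appell_component Q z - appell_dissected q z)"
  \<comment> \<open>This is (W - V) * \<open>theta_triple\<close> with every product of f and its
    theta function replaced by the holomorphic extension; \<open>KU\<close> confirms it off the
    zeros of \<open>theta_triple\<close>.\<close>
  define K where "K = (\<lambda>z. (\<Sum>i<3. a i * (z * h i z) * theta_cofactor (R i) z) -
     2 / theta_const p * (hp (q / z^3) / z * (theta_j z q * theta_j (q * z^3) p)
       - z * hp (q * z^3) * (theta_j z q * theta_j (q^2 * z^3) p)))"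
  have hol1: "(\<lambda>z. hp (q / z^3)) holomorphic_on - {0}"
  proof -
    have "(hp \<circ> (\<lambda>z. q / z^3)) holomorphic_on - {0}"
      by (rule holomorphic_on_compose_gen[OF _ hp(1)]) (use nq in \<open>auto intro!: holomorphic_intros\<close>)
    then show ?thesis by (simp add: o_def)
  qed
  have hol2: "(\<lambda>z. hp (q * z^3)) holomorphic_on - {0}"
  proof -
    have "(hp \<circ> (\<lambda>z. q * z^3)) holomorphic_on - {0}"
      by (rule holomorphic_on_compose_gen[OF _ hp(1)]) (use nq in \<open>auto intro!: holomorphic_intros\<close>)
    then show ?thesis by (simp add: o_def)
  qed
  have K_hol: "K holomorphic_on - {0}"
    unfolding K_def
    by (intro holomorphic_intros h(1) hol1 hol2 nq np holomorphic_theta_cofactor R) (use nq in auto)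
  have KU: "K z = U z * theta_triple q z" if z: "z \<noteq> 0" "theta_triple q z \<noteq> 0" for z
  proof -
    have t: "theta_j (q * z^3) p \<noteq> 0" "theta_j (q^2 * z^3) p \<noteq> 0" using z by (auto simp: theta_triple_def p_def)
    have "a i * (z * h i z) * theta_cofactor (R i) z = a i * (z * appell_f (R i) z) * theta_triple q z" for i
    proof -
      have c: "theta_j z (R i) * theta_cofactor (R i) z = theta_triple q z"
        by (rule theta_cofactor[OF R(1,2) z(1) R(3)[symmetric]])
      then have "theta_j z (R i) \<noteq> 0" using z by (metis mult_zero_left)
      then show ?thesis using h(2)[OF z(1), of i] c by (simp add: mult.assoc)
    qed
    then have "(\<Sum>i<3. a i * (z * h i z) * theta_cofactor (R i) z) = (\<Sum>i<3. a i * (z * appell_f (R i) z) * theta_triple q z)"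
      by (intro sum.cong refl)
    also have "\<dots> = appell_component Q z * theta_triple q z"
      unfolding appell_component_def a_def R_def by (rule sum_distrib_right[symmetric])
    finally have 1: "(\<Sum>i<3. a i * (z * h i z) * theta_cofactor (R i) z) = appell_component Q z * theta_triple q z" .
    have "p / (q^2 * z^3) = q / z^3" using nq z by (simp add: p_def divide_simps eval_nat_numeral)
    then have r: "theta_j (q / z^3) p = theta_j (q^2 * z^3) p"
      using theta_j_reflect[of "q^2 * z^3" p] nq np z by simp
    have 2: "hp (q / z^3) = appell_f p (q / z^3) * theta_j (q^2 * z^3) p"
      using hp(2)[of "q / z^3"] nq z t unfolding r by simp
    have 3: "hp (q * z^3) = appell_f p (q * z^3) * theta_j (q * z^3) p"
      using hp(2)[of "q * z^3"] nq z t by simp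
    show ?thesis unfolding K_def 1 2 3 U_def appell_dissected_def theta_triple_def p_def[symmetric]
      by (simp add: algebra_simps)
  qed
  have U_shift: "U (q * z) = - (q^3 * z^6 * U z)" if "z \<noteq> 0" "theta_triple q z \<noteq> 0" for z
    unfolding U_def appell_component_shift[OF Q that(1) q that(2)] appell_dissected_shift[OF nq that]
    by (simp add: algebra_simps)
  have per0: "K (q * z) = K z / z" if "z \<noteq> 0" "theta_triple q z \<noteq> 0" for z
  proof -
    have "theta_triple q (q * z) \<noteq> 0" using that nq by (simp add: theta_triple_shift[OF nq])
    then have "K (q * z) = U (q * z) * theta_triple q (q * z)" using that nq by (intro KU) auto
    also have "\<dots> = (- (q^3 * z^6 * U z)) * (- theta_triple q z / (q^3 * z^7))"
      unfolding U_shift[OF that] theta_triple_shift[OF nq that(1)] ..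
    also have "\<dots> = U z * theta_triple q z / z"
      using that nq by (simp add: eval_nat_numeral)
    finally show ?thesis using KU[OF that] by simp
  qed
  \<comment> \<open>The shift rules hold off the zeros of \<open>theta_triple\<close>; both sides
    are holomorphic on the connected punctured plane, so the relation extends to all of it.\<close>
  have per: "K (q * z) = K z / z" if "z \<noteq> 0" for z
  proof (rule analytic_continuation_open[where f = "\<lambda>z. K (q * z)" and g = "\<lambda>z. K z / z" and s' = "- {0}"
        and s = "{z. z \<noteq> 0 \<and> theta_triple q z \<noteq> 0}"])
    have "continuous_on (- {0}) (theta_triple q)"
      unfolding theta_triple_def
      by (intro holomorphic_on_imp_continuous_on holomorphic_intros nq np[unfolded p_def]) (use nq in auto)
    then have "open (theta_triple q -` (- {0}) \<inter> - {0})"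
      by (subst (asm) continuous_on_open_vimage) auto
    moreover have "theta_triple q -` (- {0}) \<inter> - {0} = {z. z \<noteq> 0 \<and> theta_triple q z \<noteq> 0}" by auto
    ultimately show "open {z. z \<noteq> 0 \<and> theta_triple q z \<noteq> 0}" by simp
    have "theta_triple q (-1) \<noteq> 0" by (rule theta_triple_nonzero[OF nq]) auto
    then show "{z. z \<noteq> 0 \<and> theta_triple q z \<noteq> 0} \<noteq> {}" by (auto intro!: exI[of _ "-1"])
    show "connected (- {0::complex})"
      by (rule connected_punctured_universe) simp
    have "(K \<circ> (\<lambda>z. q * z)) holomorphic_on - {0}"
      by (rule holomorphic_on_compose_gen[OF _ K_hol]) (use nq in \<open>auto intro!: holomorphic_intros\<close>)
    then show "(\<lambda>z. K (q * z)) holomorphic_on - {0}" by (simp add: o_def)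
    show "(\<lambda>z. K z / z) holomorphic_on - {0}" by (intro holomorphic_intros K_hol) auto
  qed (use that per0 in auto)
  have Km1: "K (-1) = 0"
  proof -
    have "theta_triple q (-1) \<noteq> 0" by (rule theta_triple_nonzero[OF nq]) auto
    then show ?thesis by (simp add: KU U_def appell_component_minus_one[OF Q] appell_dissected_minus_one)
  qed
  have z0: "z \<noteq> 0" using z by auto
  have Kz: "K z = K 1 / theta_j (-1) q * theta_j (- z) q"
  proof (rule quasiperiodic_eq_theta[OF nq K_hol _ Km1 z])
    show "K (q * z) = K z / z" if "1 < norm z" for z using that by (intro per) auto
  qed
  have E: "J1 m q \<noteq> 0" if "m > 0" for m unfolding J1_def using euler_nonzero[OF nq(1) that] .
  \<comment> \<open>The V part contains the factor j(1;q) = 0. Each extension contributes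
    (R;R)_\<infinity>^3 at 1, and times the cofactor this no longer depends on the rotation.\<close>
  have "K 1 = (\<Sum>i<3. a i * J1 1 q ^ 5)"
  proof -
    have "qpoch_inf (R i) (R i) ^ 3 * theta_cofactor (R i) 1 = J1 1 q ^ 5" for i
    proof -
      have "theta0 1 (R i) * theta_cofactor (R i) 1 = theta0 1 q * theta_j (q * 1^3) (q^3) * theta_j (q^2 * 1^3) (q^3)"
        by (rule theta0_cofactor[OF R(1,2) _ R(3)[symmetric]]) simp
      then show ?thesis by (simp add: theta0_1 theta_j_cubic_base[OF nq]) (simp add: J1_def eval_nat_numeral)
    qed
    then show ?thesis by (simp add: K_def h(3) nq mult.assoc)
  qed
  also have "\<dots> = 2 / 3 * (\<Sum>i<3. 1 / (R i ^ 2 * theta_const (R i))) * J1 1 q ^ 5"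
    unfolding sum_distrib_left sum_distrib_right a_def by (intro sum.cong refl) simp
  also have "(\<Sum>i<3. 1 / (R i ^ 2 * theta_const (R i))) = 12 * J1 6 q ^ 3 * J1 2 q ^ 2 / J1 1 q ^ 6"
    unfolding R_def q by (rule inverse_theta_const_component[OF Q])
  finally have "K 1 / theta_j (-1) q = 4 * J1 6 q ^ 3"
    unfolding theta_j_minus_one[OF nq] using E[of 1] E[of 2] by (simp add: divide_simps) (simp add: eval_nat_numeral)
  then have "U z * theta_triple q z = 4 * J1 6 q ^ 3 * theta_j (- z) q"
    using Kz KU[OF z0 t] by simp
  then show ?thesis using t by (simp add: U_def field_simps)
qed

section \<open>Values at the sixth roots of unity\<close>

text \<open>A roots-of-unity filter: the part of the rank series with exponents 3 n + 2, divided by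
  Q^2, and so a power series in Q^3.\<close>

definition rank_component :: "complex \<Rightarrow> complex \<Rightarrow> complex" where
  "rank_component z Q = (\<Sum>i<3. 1 / (3 * (\<omega>\<^sub>3 ^ i * Q)^2) * rank_gf z (\<omega>\<^sub>3 ^ i * Q))"

lemma appell_f_minus_one:
  assumes "norm q < 1" "q \<noteq> 0"
  shows "((\<lambda>k. gauss_coeff q k / (1 + q powi k)) has_sum theta_const q / 2) UNIV"
proof -
  have t: "theta_j (-1) q \<noteq> 0" by (rule theta_j_nonzero_unit[OF assms]) auto
  from appell_f_inverse[OF assms _ t] have "appell_f q (-1) = theta_const q - appell_f q (-1)" by simp
  then have "2 * appell_f q (-1) = theta_const q" by (simp add: algebra_simps)
  then have h: "appell_f q (-1) = theta_const q / 2" by (simp add: mult.commute)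
  show ?thesis
    using lerch_sum_summable(2)[OF assms _ t gauss_coeff_summable[OF assms]]
    unfolding appell_f_def[symmetric] h by simp
qed

text \<open>The splitting (1 + z) / ((1 + x)(1 - z x)) = 1/(1 + x) + z/(1 - z x) turns the Appell
  sum into f(-1) + z f(z) up to a factor, and f(-1) is half of \<phi>(-q).\<close>

lemma rank_gf_eq_appell_f:
  fixes q z :: complex
  assumes q: "norm q < 1" "q \<noteq> 0" and z: "norm z = 1" "z \<noteq> 1" "z \<noteq> -1"
  shows "rank_gf z q = (1 - z) / (1 + z) * (1 + 2 / theta_const q * (z * appell_f q z))"
proof -
  have z0: "z \<noteq> 0" "1 + z \<noteq> 0" using z by (auto simp: add_eq_0_iff)
  have t: "theta_j z q \<noteq> 0" by (rule theta_j_nonzero_unit[OF q z(1,2)])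
  have t': "theta_j (-1) q \<noteq> 0" by (rule theta_j_nonzero_unit[OF q]) auto
  define D where "D = (1 - z) / (1 + z)"
  define C where "C = 2 * D"
  have "((\<lambda>k. C * (gauss_coeff q k / (1 + q powi k) + z * (gauss_coeff q k / (1 - z * q powi k)))) has_sum
     C * (theta_const q / 2 + z * appell_f q z)) UNIV"
    unfolding appell_f_def
    by (intro has_sum_cmult_right has_sum_add appell_f_minus_one lerch_sum_summable(2) gauss_coeff_summable q z0 t)
  also have "(\<lambda>k. C * (gauss_coeff q k / (1 + q powi k) + z * (gauss_coeff q k / (1 - z * q powi k)))) =
     (\<lambda>k. 2 * (1 - z) * (-1) powi k * q powi (k\<^sup>2 + k) / ((1 + q powi k) * (1 - z * q powi k)))"
  proof
    fix k
    define x where "x = q powi k"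
    have "1 - z * x \<noteq> 0" using theta_j_nonzero_iff[OF q z0(1)] t by (simp add: x_def)
    moreover have "1 + x \<noteq> 0"
    proof -
      have "-1 * x \<noteq> 1" using theta_j_nonzero_iff[OF q, of "-1"] t' by (simp add: x_def)
      then show ?thesis by (auto simp: add_eq_0_iff)
    qed
    ultimately have "C * (1 / (1 + x) + z / (1 - z * x)) = 2 * (1 - z) / ((1 + x) * (1 - z * x))"
      using z0 unfolding C_def D_def by (simp add: divide_simps) (simp add: algebra_simps)
    then have "C * (1 / (1 + x) + z / (1 - z * x)) * gauss_coeff q k = 2 * (1 - z) / ((1 + x) * (1 - z * x)) * gauss_coeff q k" by simp
    then show "C * (gauss_coeff q k / (1 + q powi k) + z * (gauss_coeff q k / (1 - z * q powi k))) =
      2 * (1 - z) * (-1) powi k * q powi (k\<^sup>2 + k) / ((1 + q powi k) * (1 - z * q powi k))"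
      unfolding x_def[symmetric] by (simp add: gauss_coeff_def distrib_left mult_ac)
  qed
  finally have "rank_appell z q = C * (theta_const q / 2 + z * appell_f q z)"
    unfolding rank_appell_def by (rule infsumI)
  then have "rank_gf z q = 1 / theta_const q * (C * (theta_const q / 2 + z * appell_f q z))"
    by (simp add: rank_gf_appell q z rank_prefactor)
  also have "1 / t * (C * (t / 2 + X)) = C / 2 * (1 + 2 / t * X)" if "t \<noteq> 0" for t X
    using that by (simp add: field_simps)
  finally show ?thesis using theta_const_nonzero[OF q] by (simp add: C_def D_def[symmetric])
qed

lemma rank_component_eq:
  fixes Q z :: complex
  assumes Q: "norm Q < 1" "Q \<noteq> 0" and z: "norm z = 1" "z \<noteq> 1" "z \<noteq> -1"
  shows "rank_component z Q = (1 - z) / (1 + z) * appell_component Q z"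
proof -
  have "1 / (3 * (\<omega>\<^sub>3 ^ i * Q)^2) * rank_gf z (\<omega>\<^sub>3 ^ i * Q) = (1 - z) / (1 + z) *
     (1 / 3 * (1 / (\<omega>\<^sub>3 ^ i * Q)^2) + 2 / (3 * (\<omega>\<^sub>3 ^ i * Q)^2 * theta_const (\<omega>\<^sub>3 ^ i * Q)) * (z * appell_f (\<omega>\<^sub>3 ^ i * Q) z))" for i
    unfolding rank_gf_eq_appell_f[OF omega3_rotation(1,2)[OF Q] z] by (simp add: distrib_left mult_ac)
  then have "rank_component z Q = (1 - z) / (1 + z) *
     (1 / 3 * (\<Sum>i<3. 1 / (\<omega>\<^sub>3 ^ i * Q)^2) + appell_component Q z)"
    unfolding rank_component_def appell_component_def by (simp only: sum_distrib_left[symmetric] sum.distrib)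
  then show ?thesis unfolding sum_inverse_rotation by simp
qed

lemma rank_component_1:
  fixes Q :: complex
  assumes Q: "norm Q < 1" "Q \<noteq> 0" and q: "q = Q^3"
  shows "rank_component 1 Q = 4 * J1 6 q ^ 3 * J1 2 q ^ 2 / J1 1 q ^ 6"
proof -
  have "rank_component 1 Q = (\<Sum>i<3. 1 / 3 * (1 / ((\<omega>\<^sub>3 ^ i * Q)^2 * theta_const (\<omega>\<^sub>3 ^ i * Q))))"
    unfolding rank_component_def
    by (intro sum.cong refl) (simp add: rank_gf_1[OF omega3_rotation(2,1)[OF Q]] rank_prefactor[OF omega3_rotation(1,2)[OF Q]])
  also have "\<dots> = 1 / 3 * (12 * J1 6 q ^ 3 * J1 2 q ^ 2 / J1 1 q ^ 6)"
    unfolding sum_distrib_left[symmetric] q inverse_theta_const_component[OF Q] ..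
  finally show ?thesis by simp
qed

definition lerch1 :: "complex \<Rightarrow> complex" where
  "lerch1 q = (\<Sum>\<^sub>\<infinity>n::int. (-1) powi n * q powi (3 * n\<^sup>2 + 3 * n) / (1 + q powi (3 * n + 1)))"

definition lerch2 :: "complex \<Rightarrow> complex" where
  "lerch2 q = (\<Sum>\<^sub>\<infinity>n::int. (-1) powi n * q powi (3 * n\<^sup>2 + 3 * n) / (1 + q powi (3 * n + 1))\<^sup>2)"

lemma lerch_base_cube:
  assumes "q \<noteq> 0"
  shows "gauss_coeff (q^3) n = (-1) powi n * q powi (3 * n\<^sup>2 + 3 * n)" "1 - (- q) * (q^3) powi n = 1 + q powi (3 * n + 1)"
proof -
  have "(q^3) powi m = q powi (3 * m)" for m using power_int_power[of q 3 m] by simp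
  then show "gauss_coeff (q^3) n = (-1) powi n * q powi (3 * n\<^sup>2 + 3 * n)" "1 - (- q) * (q^3) powi n = 1 + q powi (3 * n + 1)"
    using assms by (simp_all add: gauss_coeff_def distrib_left power_int_add_1')
qed

lemma lerch1_eq: "q \<noteq> 0 \<Longrightarrow> lerch1 q = appell_f (q^3) (- q)"
  unfolding lerch1_def appell_f_def lerch_sum_def lerch_base_cube ..

lemma lerch2_eq: "q \<noteq> 0 \<Longrightarrow> lerch2 q = (\<Sum>\<^sub>\<infinity>n. gauss_coeff (q^3) n / (1 - (- q) * (q^3) powi n)^2)"
  unfolding lerch2_def lerch_base_cube ..

lemma J1_nonzero: "norm q < 1 \<Longrightarrow> m > 0 \<Longrightarrow> J1 m q \<noteq> 0"
  unfolding J1_def by (rule euler_nonzero)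

lemma cube_root_unity_cases:
  assumes "w = \<omega>\<^sub>3 \<or> w = \<omega>\<^sub>3 ^ 2"
  shows "w^2 = - 1 - w" "w^3 = 1" "norm w = 1" "w \<noteq> 1" "w \<noteq> -1" "w \<noteq> 0" "1 / w = w^2"
proof -
  have c: "(\<omega>\<^sub>3^2)^2 = - 1 - \<omega>\<^sub>3^2" "(\<omega>\<^sub>3^2)^3 = 1" using omega3_square omega3_cube by algebra+
  show 1: "w^2 = - 1 - w" "w^3 = 1" using assms c omega3_square by auto
  show "norm w = 1" using assms by (auto simp: norm_power)
  show "w \<noteq> 1" "w \<noteq> -1" "w \<noteq> 0" using 1(1,2) by auto
  then show "1 / w = w^2" using 1(2) by (simp add: field_simps power2_eq_square power3_eq_cube)
qed

lemma qpoch_inf_minus_base: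
  assumes "norm q < 1"
  shows "qpoch_inf (- q) q = J1 2 q / J1 1 q" "qpoch_inf (- (q^3)) (q^3) = J1 6 q / J1 3 q"
proof -
  have q3: "norm (q^3) < 1" by (intro norm_power_less_one assms) simp
  show "qpoch_inf (- q) q = J1 2 q / J1 1 q"
    using euler_odd_dist[OF assms] J1_nonzero[OF assms, of 1] by (simp add: J1_def field_simps)
  show "qpoch_inf (- (q^3)) (q^3) = J1 6 q / J1 3 q"
    using euler_odd_dist[OF q3] J1_nonzero[OF assms, of 3] by (simp add: J1_def field_simps flip: power_mult)
qed

text \<open>As 1/w = w^2, the two variable factors belong to w and w^2, and a third one would
  complete them to a product of base q^3. For w that third factor is the (q;q)_\<infinity> of theta
  itself; for -w it is (-q;q)_\<infinity>, which has to be divided out.\<close>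

lemma theta0_cube_root_unity:
  assumes q: "norm q < 1" and w: "w = \<omega>\<^sub>3 \<or> w = \<omega>\<^sub>3 ^ 2"
  shows "theta0 w q = J1 3 q" "theta0 (- w) q = J1 6 q * J1 1 q ^ 2 / (J1 3 q * J1 2 q)"
proof -
  note W = cube_root_unity_cases[OF w]
  have quot: "x / w = w^2 * x" for x using W(7) by (metis mult.commute times_divide_eq_right mult.right_neutral)
  have w4: "(\<omega>\<^sub>3 ^ 2) ^ 2 = \<omega>\<^sub>3" using omega3_cube by algebra
  have c: "qpoch_inf (w * a) q * qpoch_inf (w^2 * a) q * qpoch_inf a q = qpoch_inf (a^3) (q^3)" for a
    using w qpoch_inf_cubic[OF q, of a] by (elim disjE) (simp_all only: w4 mult_ac)
  show "theta0 w q = J1 3 q"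
    unfolding theta0_def quot c by (simp add: J1_def c)
  have "theta0 (- w) q = qpoch_inf (w * (- q)) q * qpoch_inf (w^2 * (- q)) q * qpoch_inf q q"
    unfolding theta0_def using quot[of q] by simp
  also have "qpoch_inf (w * (- q)) q * qpoch_inf (w^2 * (- q)) q = qpoch_inf (- (q^3)) (q^3) / qpoch_inf (- q) q"
    using c[of "- q"] qpoch_inf_nonzero[of "- q" q] q by (simp add: field_simps)
  also have "\<dots> * qpoch_inf q q = J1 6 q * J1 1 q ^ 2 / (J1 3 q * J1 2 q)"
    unfolding qpoch_inf_minus_base[OF q] by (simp add: power2_eq_square) (simp add: J1_def)
  finally show "theta0 (- w) q = J1 6 q * J1 1 q ^ 2 / (J1 3 q * J1 2 q)" .
qed

lemma theta_j_minus_cubic_base: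
  assumes q: "norm q < 1" "q \<noteq> 0"
  shows "theta_j (- q) (q^3) = J1 2 q * J1 3 q ^ 2 / (J1 1 q * J1 6 q)"
    and "theta_j (- (q^2)) (q^3) = J1 2 q * J1 3 q ^ 2 / (J1 1 q * J1 6 q)"
proof -
  have e: "q^3 / (- q) = - (q^2)" "q^3 / (- (q^2)) = - q" using q by (simp_all add: eval_nat_numeral)
  have "- q * q = - (q^2)" "- q * q^2 = - (q^3)" by (simp_all add: eval_nat_numeral)
  then have "qpoch_inf (- q) (q^3) * qpoch_inf (- (q^2)) (q^3) * qpoch_inf (- (q^3)) (q^3) = qpoch_inf (- q) q"
    using qpoch_inf_trisect[OF q(1), of "- q"] by simp
  then have "qpoch_inf (- q) (q^3) * qpoch_inf (- (q^2)) (q^3) * (J1 6 q / J1 3 q) = J1 2 q / J1 1 q"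
    unfolding qpoch_inf_minus_base[OF q(1)] .
  then have p: "qpoch_inf (- q) (q^3) * qpoch_inf (- (q^2)) (q^3) = J1 2 q * J1 3 q / (J1 1 q * J1 6 q)"
    using J1_nonzero[OF q(1)] by (simp add: field_simps)
  show "theta_j (- q) (q^3) = J1 2 q * J1 3 q ^ 2 / (J1 1 q * J1 6 q)"
    unfolding theta_j_def e p by (simp add: power2_eq_square) (simp add: J1_def)
  show "theta_j (- (q^2)) (q^3) = J1 2 q * J1 3 q ^ 2 / (J1 1 q * J1 6 q)"
    unfolding theta_j_def e mult.commute[of "qpoch_inf (- (q^2)) (q^3)"] p by (simp add: power2_eq_square) (simp add: J1_def)
qed

text \<open>The prefactor (1 - z)/(1 + z) cancels against the factors 1 + z of j(-z;q) and 1 - z of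
  j(z;q), leaving \<open>theta0\<close> in both places.\<close>

lemma rank_component_unit:
  fixes Q z :: complex
  assumes Q: "norm Q < 1" "Q \<noteq> 0" and q: "q = Q^3" and z: "norm z = 1" "z \<noteq> 1" "z \<noteq> -1"
  shows "rank_component z Q = (1 - z) / (1 + z) * appell_dissected q z
    + 4 * J1 6 q ^ 3 * theta0 (- z) q / (theta0 z q * theta_j (q * z^3) (q^3) * theta_j (q^2 * z^3) (q^3))"
proof -
  have nq: "norm q < 1" "q \<noteq> 0" using norm_power_less_one[OF Q(1), of 3] Q by (auto simp: q)
  have nz: "theta_triple q z \<noteq> 0" by (rule theta_triple_nonzero[OF nq z(1,2)])
  have "norm q < norm z" "norm z < 1 / norm q" using nq z by auto
  from appell_component_eq[OF Q q this nz]
  have "appell_component Q z = appell_dissected q z + 4 * J1 6 q ^ 3 * theta_j (- z) q / theta_triple q z"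
    by (simp add: algebra_simps)
  then have 1: "rank_component z Q = (1 - z) / (1 + z) * appell_dissected q z
     + (1 - z) / (1 + z) * (4 * J1 6 q ^ 3 * ((1 + z) * theta0 (- z) q) / ((1 - z) * theta0 z q * theta_j (q * z^3) (q^3) * theta_j (q^2 * z^3) (q^3)))"
    unfolding rank_component_eq[OF Q z] by (simp add: distrib_left theta_triple_def theta_j_eq_theta0[OF nq(1)])
  have "1 - z \<noteq> 0" "1 + z \<noteq> 0" using z by (auto simp: add_eq_0_iff)
  then have "(1 - z) / (1 + z) * (X * ((1 + z) * Y) / ((1 - z) * A * B * C)) = X * Y / (A * B * C)" for X Y A B C
    by simp
  then show ?thesis using 1 by simp
qed

text \<open>w^3 = 1 turns both terms of V into f(q;q^3) with the factor 1/w - w, which the prefactor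
  reduces to -3. Passing to f(-q;q^3) by the even part costs -12 J_6^3/(J_2 J_{3,6}), and the theta
  quotient adds 4 of these.\<close>

lemma rank_component_omega:
  fixes Q :: complex
  assumes Q: "norm Q < 1" "Q \<noteq> 0" and q: "q = Q^3" and w: "w = \<omega>\<^sub>3 \<or> w = \<omega>\<^sub>3 ^ 2"
  shows "rank_component w Q = 6 / J2 3 6 q * lerch1 q - 8 * (J1 6 q ^ 3 / (J1 2 q * J2 3 6 q))"
proof -
  note W = cube_root_unity_cases[OF w]
  have nq: "norm q < 1" "q \<noteq> 0" using norm_power_less_one[OF Q(1), of 3] Q by (auto simp: q)
  have np: "norm (q^3) < 1" "q^3 \<noteq> 0" using norm_power_less_one[OF nq(1), of 3] nq by auto
  define f where "f = appell_f (q^3) q"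
  have V: "(1 - w) / (1 + w) * appell_dissected q w = - 6 / J2 3 6 q * f"
  proof -
    have "1 + w \<noteq> 0" using W by (auto simp: add_eq_0_iff)
    have "(1 - w) * (w^2 - w) = - 3 * (1 + w)" using W(1) by algebra
    then have "(1 - w) / (1 + w) * (w^2 - w) = - 3" using \<open>1 + w \<noteq> 0\<close> by (simp add: field_simps)
    moreover have "appell_dissected q w = 2 / J2 3 6 q * ((w^2 - w) * f)"
    proof -
      have "f / w = 1 / w * f" by simp
      then have "f / w = w^2 * f" unfolding W(7) .
      then show ?thesis by (simp add: appell_dissected_def W(2) f_def J2_3_6 left_diff_distrib)
    qed
    moreover have "X * (c * (Y * f)) = (X * Y) * (c * f)" for X Y c :: complex by (simp add: mult_ac)
    ultimately have "(1 - w) / (1 + w) * appell_dissected q w = - 3 * (2 / J2 3 6 q * f)" by (simp only:)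
    then show ?thesis by simp
  qed
  have even: "f + lerch1 q = 2 * J1 6 q ^ 3 / J1 2 q"
  proof -
    have n6: "norm q ^ 6 < norm q ^ 2" using nq by (intro power_strict_decreasing) auto
    have l2: "norm q ^ 2 < 1" using norm_power_less_one[OF nq(1), of 2] by (simp add: norm_power)
    have "(q^3)^2 = q^6" "(q^2)^3 = q^6" by (simp_all flip: power_mult)
    note e = this
    have q2: "norm (q^2) < 1" "q^2 \<noteq> 0" using norm_power_less_one[OF nq(1), of 2] nq by auto
    have t: "theta_j (q^2) (q^6) = J1 2 q"
      using theta_j_cubic_base(1)[OF q2] unfolding e(2) by (simp add: J1_def)
    have "appell_f (q^3) q + appell_f (q^3) (- q) = 2 * qpoch_inf ((q^3)^2) ((q^3)^2) ^ 3 / theta_j (q^2) ((q^3)^2)"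
    proof (rule appell_f_even_part[OF np])
      show "norm ((q^3)^2) < norm (q^2)" using n6 by (simp add: e norm_power)
      have "norm q ^ 6 < 1" using l2 n6 by linarith
      then have "norm q ^ 2 * norm q ^ 6 < 1 * 1"
        by (intro mult_strict_mono) (use l2 nq in auto)
      then show "norm (q^2) < 1 / norm ((q^3)^2)" using nq by (simp add: e norm_power field_simps)
      show "theta_j (q^2) ((q^3)^2) \<noteq> 0" unfolding e t using J1_nonzero[OF nq(1), of 2] by simp
    qed
    then show ?thesis unfolding e t by (simp add: f_def lerch1_eq nq J1_def)
  qed
  have U: "4 * J1 6 q ^ 3 * theta0 (- w) q / (theta0 w q * theta_j (q * w^3) (q^3) * theta_j (q^2 * w^3) (q^3))
     = 4 * (J1 6 q ^ 3 / (J1 2 q * J2 3 6 q))"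
  proof -
    have "4 * x6^3 * (x6 * x1^2 / (x3 * x2)) / (x3 * x1 * x1) = 4 * (x6^3 / (x2 * (x3^2 / x6)))"
      if "x1 \<noteq> 0" "x2 \<noteq> 0" "x3 \<noteq> 0" "x6 \<noteq> 0" for x1 x2 x3 x6 :: complex
      using that by (simp add: divide_simps eval_nat_numeral)
    then show ?thesis
      unfolding W(2) mult_1_right theta_j_cubic_base[OF nq] theta0_cube_root_unity[OF nq(1) w] J2_3_6_eq[OF nq]
      using J1_nonzero[OF nq(1)] by simp
  qed
  have f: "f = 2 * J1 6 q ^ 3 / J1 2 q - lerch1 q" using even by (simp add: algebra_simps)
  show ?thesis
    unfolding rank_component_unit[OF Q q W(3,4,5)] V U f by (simp add: algebra_simps)
qed

text \<open>Here (-w)^3 = -1, so both terms of V are multiples of f(-q;q^3) directly, and the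
  prefactor times w - w^2 is -1.\<close>

lemma rank_component_minus_omega:
  fixes Q :: complex
  assumes Q: "norm Q < 1" "Q \<noteq> 0" and q: "q = Q^3" and w: "w = \<omega>\<^sub>3 \<or> w = \<omega>\<^sub>3 ^ 2"
  shows "rank_component (- w) Q = 4 * (J1 6 q ^ 3 / (J1 2 q * J2 3 6 q)) - 2 / J2 3 6 q * lerch1 q"
proof -
  note W = cube_root_unity_cases[OF w]
  have nq: "norm q < 1" "q \<noteq> 0" using norm_power_less_one[OF Q(1), of 3] Q by (auto simp: q)
  define f where "f = lerch1 q"
  have w3: "(- w)^3 = -1" using W(2) by simp
  have V: "(1 - (- w)) / (1 + - w) * appell_dissected q (- w) = - 2 / J2 3 6 q * f"
  proof -
    have nz: "1 - w \<noteq> 0" using W by auto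
    have "(1 + w) * (w - w^2) = - (1 - w)" using W(1) by algebra
    then have "(1 + w) / (1 - w) * (w - w^2) = - 1" using nz by (simp add: field_simps)
    moreover have "appell_dissected q (- w) = 2 / J2 3 6 q * ((w - w^2) * f)"
    proof -
      have "f / w = 1 / w * f" by simp
      then have "f / w = w^2 * f" unfolding W(7) .
      then show ?thesis
        unfolding appell_dissected_def w3 by (simp add: f_def lerch1_eq[OF nq(2)] J2_3_6 left_diff_distrib)
    qed
    moreover have "X * (c * (Y * f)) = (X * Y) * (c * f)" for X Y c :: complex by (simp add: mult_ac)
    ultimately have "(1 + w) / (1 - w) * appell_dissected q (- w) = - 1 * (2 / J2 3 6 q * f)" by (simp only:)
    then show ?thesis by simp
  qed
  have U: "4 * J1 6 q ^ 3 * theta0 (- (- w)) q / (theta0 (- w) q * theta_j (q * (- w)^3) (q^3) * theta_j (q^2 * (- w)^3) (q^3))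
     = 4 * (J1 6 q ^ 3 / (J1 2 q * J2 3 6 q))"
  proof -
    have "4 * x6^3 * x3 / (x6 * x1^2 / (x3 * x2) * (x2 * x3^2 / (x1 * x6)) * (x2 * x3^2 / (x1 * x6))) = 4 * (x6^3 / (x2 * (x3^2 / x6)))"
      if "x1 \<noteq> 0" "x2 \<noteq> 0" "x3 \<noteq> 0" "x6 \<noteq> 0" for x1 x2 x3 x6 :: complex
      using that by (simp add: divide_simps eval_nat_numeral)
    note this[OF J1_nonzero[OF nq(1)] J1_nonzero[OF nq(1)] J1_nonzero[OF nq(1)] J1_nonzero[OF nq(1)], of 1 2 3 6]
    then show ?thesis
      unfolding w3 mult_minus1_right minus_minus theta_j_minus_cubic_base[OF nq] theta0_cube_root_unity[OF nq(1) w] J2_3_6_eq[OF nq]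
      by simp
  qed
  have "- w \<noteq> 1" using W(5) by (metis minus_minus)
  moreover have "norm (- w) = 1" "- w \<noteq> -1" using W(3,4) by simp_all
  ultimately show ?thesis
    unfolding rank_component_unit[OF Q q \<open>norm (- w) = 1\<close> \<open>- w \<noteq> 1\<close> \<open>- w \<noteq> -1\<close>] V U by (simp add: f_def)
qed

text \<open>Differentiating z f(z) squares the denominators, and the unsplit Appell sum at z = -1
  has the same squares with the constant 2 (1 - z) = 4. Compared with the 2 in W this gives the
  factor 1/2.\<close>

lemma appell_component_derivative:
  fixes Q :: complex
  assumes Q: "norm Q < 1" "Q \<noteq> 0"
  shows "(appell_component Q has_field_derivative rank_component (-1) Q / 2) (at (-1))"
proof -
  define R where "R = (\<lambda>i. \<omega>\<^sub>3 ^ i * Q)"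
  have R: "norm (R i) < 1" "R i \<noteq> 0" for i using omega3_rotation[OF Q] by (auto simp: R_def)
  have Ri: "\<omega>\<^sub>3 ^ i * Q = R i" for i by (simp add: R_def)
  define S where "S = (\<lambda>i. \<Sum>\<^sub>\<infinity>n. gauss_coeff (R i) n / (1 - (-1) * R i powi n)^2)"
  have "((\<lambda>z. \<Sum>i<3. 2 / (3 * R i ^ 2 * theta_const (R i)) * (z * lerch_sum (gauss_coeff (R i)) (R i) z)) has_field_derivative
     (\<Sum>i<3. 2 / (3 * R i ^ 2 * theta_const (R i)) * S i)) (at (-1))"
    unfolding S_def
    by (intro DERIV_sum DERIV_cmult lerch_sum_has_derivative R gauss_coeff_summable theta_j_nonzero_unit) auto
  moreover have "(\<Sum>i<3. 2 / (3 * R i ^ 2 * theta_const (R i)) * S i) = rank_component (-1) Q / 2"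
  proof -
    have "rank_gf (-1) (R i) = 1 / theta_const (R i) * (4 * S i)" for i
    proof -
      have "rank_appell (-1) (R i) = (\<Sum>\<^sub>\<infinity>n. 4 * (gauss_coeff (R i) n / (1 - (-1) * R i powi n)^2))"
        unfolding rank_appell_def by (simp add: gauss_coeff_def power2_eq_square mult_ac)
      also have "\<dots> = 4 * S i" unfolding S_def by (rule infsum_cmult_right')
      finally show ?thesis by (simp add: rank_gf_appell[OF R(2,1)] rank_prefactor[OF R])
    qed
    then have "rank_component (-1) Q = (\<Sum>i<3. 2 * (2 / (3 * R i ^ 2 * theta_const (R i)) * S i))"
      unfolding rank_component_def Ri by (intro sum.cong refl) simp
    then show ?thesis unfolding sum_distrib_left[symmetric] by simp
  qed
  moreover have "(\<lambda>z. \<Sum>i<3. 2 / (3 * R i ^ 2 * theta_const (R i)) * (z * lerch_sum (gauss_coeff (R i)) (R i) z)) = appell_component Q"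
    by (simp add: appell_component_def appell_f_def R_def fun_eq_iff)
  ultimately show ?thesis by (simp only:)
qed

text \<open>V is rewritten as 2/(a q) times z^2 G(q/z^3) - G(q z^3)/z^2 with G(u) = u f(u), since
  the derivative rule is for u f(u). Both arguments of G equal -q at z = -1.\<close>

lemma appell_dissected_derivative:
  assumes q: "norm q < 1" "q \<noteq> 0"
  shows "(appell_dissected q has_field_derivative (8 * lerch1 q - 12 * lerch2 q) / J2 3 6 q) (at (-1))"
proof -
  define p a where "p = q^3" and "a = J2 3 6 q"
  have p: "norm p < 1" "p \<noteq> 0" using norm_power_less_one[OF q(1), of 3] q by (auto simp: p_def)
  define G where "G = (\<lambda>u. u * appell_f p u)"
  have "theta_j (- q) p \<noteq> 0"
    unfolding p_def theta_j_minus_cubic_base[OF q] using J1_nonzero[OF q(1)] by simp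
  then have "((\<lambda>u. u * lerch_sum (gauss_coeff p) p u) has_field_derivative lerch2 q) (at (- q))"
    using lerch_sum_has_derivative[OF p _ _ gauss_coeff_summable[OF p], of "- q"] q
    by (simp add: lerch2_eq p_def)
  then have dG: "(G has_field_derivative lerch2 q) (at (- q))" by (simp add: G_def appell_f_def)
  have Gq: "G (- q) = - q * lerch1 q" by (simp add: G_def lerch1_eq q p_def)
  have d1: "((\<lambda>z. G (q / z^3)) has_field_derivative lerch2 q * (- 3 * q)) (at (-1))"
  proof (rule DERIV_chain2[where f = G and g = "\<lambda>z. q / z^3"])
    show "(G has_field_derivative lerch2 q) (at (q / (-1)^3))" using dG by simp
    show "((\<lambda>z. q / z^3) has_field_derivative - 3 * q) (at (-1))"
      by (auto intro!: derivative_eq_intros)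
  qed
  have d2: "((\<lambda>z. G (q * z^3)) has_field_derivative lerch2 q * (3 * q)) (at (-1))"
  proof (rule DERIV_chain2[where f = G and g = "\<lambda>z. q * z^3"])
    show "(G has_field_derivative lerch2 q) (at (q * (-1)^3))" using dG by simp
    show "((\<lambda>z. q * z^3) has_field_derivative 3 * q) (at (-1))"
      by (auto intro!: derivative_eq_intros)
  qed
  have A: "((\<lambda>z::complex. z^2) has_field_derivative - 2) (at (-1))"
    by (auto intro!: derivative_eq_intros)
  have B: "((\<lambda>z::complex. 1 / z^2) has_field_derivative 2) (at (-1))"
    by (auto intro!: derivative_eq_intros)
  note D0 = DERIV_cmult[OF DERIV_diff[OF DERIV_mult[OF A d1] DERIV_mult[OF d2 B]], of "2 / (a * q)"]
  have "2 / (a * q) * ((- 2 * G (q / (-1)^3) + lerch2 q * (- 3 * q) * (-1)^2) - (lerch2 q * (3 * q) * (1 / (-1)^2) + 2 * G (q * (-1)^3)))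
     = (8 * lerch1 q - 12 * lerch2 q) / a"
  proof -
    have "(- 2 * G (q / (-1)^3) + lerch2 q * (- 3 * q) * (-1)^2) - (lerch2 q * (3 * q) * (1 / (-1)^2) + 2 * G (q * (-1)^3)) = q * (4 * lerch1 q - 6 * lerch2 q)"
      by (simp add: Gq algebra_simps)
    moreover have "2 / (a * q) * (q * (4 * x - 6 * y)) = (8 * x - 12 * y) / a" for x y
      using q(2) by (simp add: right_diff_distrib diff_divide_distrib)
    ultimately show ?thesis by (simp only:)
  qed
  with D0 have D: "((\<lambda>z. 2 / (a * q) * (z^2 * G (q / z^3) - G (q * z^3) * (1 / z^2))) has_field_derivative (8 * lerch1 q - 12 * lerch2 q) / a) (at (-1))"
    by (simp only:)
  have "(appell_dissected q has_field_derivative (8 * lerch1 q - 12 * lerch2 q) / a) (at (-1))"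
  proof (rule has_field_derivative_transform_within_open[OF D])
    show "open (- {0::complex})" by (simp add: open_Compl)
    show "-1 \<in> - {0::complex}" by simp
    fix z :: complex assume "z \<in> - {0}"
    then have z: "z \<noteq> 0" by simp
    have "z^2 * G (q / z^3) = q * (appell_f p (q / z^3) / z)" "G (q * z^3) * (1 / z^2) = q * (z * appell_f p (q * z^3))"
      using z by (simp_all add: G_def eval_nat_numeral)
    then have "2 / (a * q) * (z^2 * G (q / z^3) - G (q * z^3) * (1 / z^2)) = 2 / (a * q) * (q * (appell_f p (q / z^3) / z - z * appell_f p (q * z^3)))"
      by (simp only: right_diff_distrib)
    also have "\<dots> = appell_dissected q z"
      using q(2) by (simp add: appell_dissected_def p_def a_def J2_3_6)
    finally show "2 / (a * q) * (z^2 * G (q / z^3) - G (q * z^3) * (1 / z^2)) = appell_dissected q z" .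
  qed
  then show ?thesis by (simp add: a_def)
qed

text \<open>Near -1 the theta quotient is (1 + z) G(z) with G holomorphic, so its derivative at -1
  is G(-1). Comparing it with the derivatives of W and V and doubling gives the claim.\<close>

lemma rank_component_minus_one:
  fixes Q :: complex
  assumes Q: "norm Q < 1" "Q \<noteq> 0" and q: "q = Q^3"
  shows "rank_component (-1) Q = 4 * J2 1 6 q ^ 6 * J1 2 q ^ 2 * J2 3 6 q / J1 6 q ^ 6
    + 16 / J2 3 6 q * lerch1 q - 24 / J2 3 6 q * lerch2 q"
proof -
  have nq: "norm q < 1" "q \<noteq> 0" using norm_power_less_one[OF Q(1), of 3] Q by (auto simp: q)
  define G where "G = (\<lambda>z. 4 * J1 6 q ^ 3 * theta0 (- z) q / theta_triple q z)"
  have q3: "norm (q^3) < 1" "q^3 \<noteq> 0" using norm_power_less_one[OF nq(1), of 3] nq by auto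
  have th: "theta_triple q holomorphic_on - {0}"
    unfolding theta_triple_def by (intro holomorphic_intros nq q3) (use nq in auto)
  define Z where "Z = {z. z \<noteq> 0 \<and> theta_triple q z \<noteq> 0} \<inter> {z. norm q < norm z \<and> norm z < 1 / norm q}"
  have "open (theta_triple q -` (- {0}) \<inter> - {0})"
    using holomorphic_on_imp_continuous_on[OF th] by (subst (asm) continuous_on_open_vimage) auto
  moreover have "theta_triple q -` (- {0}) \<inter> - {0} = {z. z \<noteq> 0 \<and> theta_triple q z \<noteq> 0}" by auto
  ultimately have "open {z. z \<noteq> 0 \<and> theta_triple q z \<noteq> 0}" by simp
  moreover have "open {z. norm q < norm z \<and> norm z < 1 / norm q}"
    by (intro open_Collect_conj open_Collect_less continuous_intros)
  ultimately have opZ: "open Z" unfolding Z_def by (rule open_Int)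
  have t1: "theta_triple q (-1) \<noteq> 0" by (rule theta_triple_nonzero[OF nq]) auto
  have Z1: "-1 \<in> Z" using nq t1 by (auto simp: Z_def)
  have "G holomorphic_on Z"
    unfolding G_def by (intro holomorphic_intros holomorphic_on_subset[OF th] nq) (auto simp: Z_def)
  then obtain D where D: "(G has_field_derivative D) (at (-1))"
    using holomorphic_derivI[OF _ opZ Z1] by blast
  have "((\<lambda>z. (1 + z) * G z) has_field_derivative G (-1)) (at (-1))"
    by (rule derivative_eq_intros D refl)+ simp
  moreover have "((\<lambda>z. appell_component Q z - appell_dissected q z) has_field_derivative
     rank_component (-1) Q / 2 - (8 * lerch1 q - 12 * lerch2 q) / J2 3 6 q) (at (-1))"
    by (intro DERIV_diff appell_component_derivative appell_dissected_derivative Q nq)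
  then have "((\<lambda>z. (1 + z) * G z) has_field_derivative
     rank_component (-1) Q / 2 - (8 * lerch1 q - 12 * lerch2 q) / J2 3 6 q) (at (-1))"
  proof (rule has_field_derivative_transform_within_open[OF _ opZ Z1])
    fix z assume "z \<in> Z"
    then show "appell_component Q z - appell_dissected q z = (1 + z) * G z"
      using appell_component_eq[OF Q q, of z] by (simp add: Z_def G_def theta_j_eq_theta0[OF nq(1), of "- z"])
  qed
  ultimately have "rank_component (-1) Q / 2 - (8 * lerch1 q - 12 * lerch2 q) / J2 3 6 q = G (-1)"
    by (rule DERIV_unique[rotated])
  moreover have "X = 2 * g + 16 / a * x - 24 / a * y" if "X / 2 - (8 * x - 12 * y) / a = g" for X g a x y :: complex
    unfolding that[symmetric] by (simp add: diff_divide_distrib right_diff_distrib)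
  ultimately have "rank_component (-1) Q = 2 * G (-1) + 16 / J2 3 6 q * lerch1 q - 24 / J2 3 6 q * lerch2 q"
    by blast
  also have "2 * G (-1) = 4 * J2 1 6 q ^ 6 * J1 2 q ^ 2 * J2 3 6 q / J1 6 q ^ 6"
  proof -
    have e: "2 * (4 * x6^3 * x1^3 / (2 * x2^2 / x1 * (x2 * x3^2 / (x1 * x6)) * (x2 * x3^2 / (x1 * x6)))) =
        4 * (x1 * x6^2 / (x2 * x3))^6 * x2^2 * (x3^2 / x6) / x6^6"
      if "x1 \<noteq> 0" "x2 \<noteq> 0" "x3 \<noteq> 0" "x6 \<noteq> 0" for x1 x2 x3 x6 :: complex
    proof -
      have "2 * (4 * x6^3 * x1^3 / (2 * x2^2 / x1 * (x2 * x3^2 / (x1 * x6)) * (x2 * x3^2 / (x1 * x6)))) = 4 * x1^6 * x6^5 / (x2^4 * x3^4)"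
        using that by (simp add: divide_simps eval_nat_numeral)
      moreover have e: "x6^12 = x6^5 * (x6 * x6^6)" "x2^6 = x2^4 * x2^2" "x3^6 = x3^4 * x3^2"
        by (simp_all flip: power_add power_Suc)
      have "4 * A * u / (B * C) = 4 * (A * (u * (w * v)) / ((B * b) * (C * c))) * b * (c / w) / v"
        if "b \<noteq> 0" "c \<noteq> 0" "w \<noteq> 0" "v \<noteq> 0" for A B C b c u v w :: complex
        using that by simp
      from this[of "x2^2" "x3^2" x6 "x6^6" "x1^6" "x6^5" "x2^4" "x3^4"]
      have "4 * x1^6 * x6^5 / (x2^4 * x3^4) = 4 * (x1^6 * x6^12 / (x2^6 * x3^6)) * x2^2 * (x3^2 / x6) / x6^6"
        unfolding e using that by (simp only: power_not_zero not_False_eq_True simp_thms)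
      moreover have "(x1 * x6^2 / (x2 * x3))^6 = x1^6 * x6^12 / (x2^6 * x3^6)"
        by (simp add: power_divide power_mult_distrib flip: power_mult)
      ultimately show ?thesis by (simp only:)
    qed
    have "theta0 1 q = J1 1 q ^ 3" by (simp add: theta0_1 J1_def)
    then have "2 * G (-1) = 2 * (4 * J1 6 q ^ 3 * J1 1 q ^ 3 / (2 * J1 2 q ^ 2 / J1 1 q * (J1 2 q * J1 3 q ^ 2 / (J1 1 q * J1 6 q)) * (J1 2 q * J1 3 q ^ 2 / (J1 1 q * J1 6 q))))"
      by (simp add: G_def theta_triple_def theta_j_minus_one[OF nq] theta_j_minus_cubic_base[OF nq])
    also have "\<dots> = 4 * J2 1 6 q ^ 6 * J1 2 q ^ 2 * J2 3 6 q / J1 6 q ^ 6"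
      unfolding J2_1_6_eq[OF nq] J2_3_6_eq[OF nq] by (rule e; rule J1_nonzero[OF nq(1)]) simp_all
    finally show ?thesis .
  qed
  finally show ?thesis .
qed

section \<open>Extraction of the residue class and Fourier inversion\<close>

lemma sums_residue_two:
  fixes Q z :: complex
  assumes Q: "norm Q < 1" "Q \<noteq> 0" and q: "q = Q^3" and z: "z ^ 6 = 1"
  shows "(\<lambda>n. (\<Sum>s<6. z ^ s * of_nat (Nbar (int s) 6 (3 * n + 2))) * q ^ n) sums rank_component z Q"
proof -
  define c where "c = (\<lambda>n. \<Sum>s<6. z ^ s * of_nat (Nbar (int s) 6 n) :: complex)"
  have "norm z ^ 6 = 1" using z by (metis norm_power norm_one)
  then have nz: "norm z = 1" using power_eq_1_iff[of "norm z" 6] by simp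
  define w where "w = \<omega>\<^sub>3"
  have w: "w^2 = - 1 - w" "w^3 = 1" "w \<noteq> 0" by (auto simp: w_def omega3_square)
  define R where "R = (\<lambda>i. w ^ i * Q)"
  have R: "norm (R i) < 1" "R i \<noteq> 0" for i using omega3_rotation[OF Q] by (auto simp: R_def w_def)
  have "(\<lambda>n. \<Sum>i<3. 1 / (3 * R i ^ 2) * (c n * R i ^ n)) sums (\<Sum>i<3. 1 / (3 * R i ^ 2) * rank_gf z (R i))"
    unfolding c_def rank_residue_sum[OF z, symmetric]
    by (intro sums_sum sums_mult rank_generating_function R nz)
  also have "(\<lambda>n. \<Sum>i<3. 1 / (3 * R i ^ 2) * (c n * R i ^ n)) = (\<lambda>n. if n mod 3 = 2 then c n * q ^ (n div 3) else 0)"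
  proof
    fix n :: nat
    define m k where "m = n div 3" and "k = n mod 3"
    have n: "n = 3 * m + k" "k < 3" by (simp_all add: m_def k_def)
    have Rn: "R i ^ n = q ^ m * R i ^ k" for i
    proof -
      have "R i ^ 3 = q" using omega3_rotation(3)[OF Q] by (simp add: R_def w_def q)
      then show ?thesis by (simp add: n(1) power_add power_mult)
    qed
    have "(\<Sum>i<3. 1 / (3 * R i ^ 2) * (c n * R i ^ n)) = c n * q ^ m / 3 * (\<Sum>i<3. R i ^ k / R i ^ 2)"
      unfolding Rn sum_distrib_left by (intro sum.cong refl) simp
    \<comment> \<open>Orthogonality of the cube roots of unity: for k < 3 the powers R^(k-2) sum to
      zero over the rotations unless k = 2.\<close>
    also have "(\<Sum>i<3. R i ^ k / R i ^ 2) = (if k = 2 then 3 else 0)"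
    proof -
      have "k = 0 \<or> k = 1 \<or> k = 2" using n(2) by linarith
      then consider "k = 0" | "k = 1" | "k = 2" by blast
      then show ?thesis
      proof cases
        case 1
        then show ?thesis using sum_inverse_rotation[of Q] by (simp add: R_def w_def)
      next
        case 2
        have "R i ^ k / R i ^ 2 = 1 / R i" for i using R(2)[of i] 2 by (simp add: power2_eq_square)
        then have "(\<Sum>i<3. R i ^ k / R i ^ 2) = 1 / Q + 1 / (w * Q) + 1 / (w^2 * Q)"
          by (simp add: sum_lessThan_3 R_def)
        also have "1 / (w * Q) = w^2 / Q"
        proof -
          have "w * w^2 = 1" using w(2) by algebra
          then have "1 / (w * Q) = (w * w^2) / (w * Q)" by (simp only:)
          then show ?thesis using w(3) by simp
        qed
        also have "1 / (w^2 * Q) = w / Q"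
        proof -
          have "w^2 * w = 1" using w(2) by algebra
          then have "1 / (w^2 * Q) = (w^2 * w) / (w^2 * Q)" by (simp only:)
          then show ?thesis using w(3) by simp
        qed
        also have "1 / Q + w^2 / Q + w / Q = (1 + w^2 + w) / Q" by (simp add: add_divide_distrib)
        finally show ?thesis using w(1) 2 by simp
      next
        case 3
        then show ?thesis using R(2) by simp
      qed
    qed
    finally have fin: "(\<Sum>i<3. 1 / (3 * R i ^ 2) * (c n * R i ^ n)) = c n * q ^ m / 3 * (if k = 2 then 3 else 0)" .
    show "(\<Sum>i<3. 1 / (3 * R i ^ 2) * (c n * R i ^ n)) = (if n mod 3 = 2 then c n * q ^ (n div 3) else 0)"
      unfolding fin by (simp add: m_def k_def)
  qed
  also have "(\<Sum>i<3. 1 / (3 * R i ^ 2) * rank_gf z (R i)) = rank_component z Q"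
    by (simp add: rank_component_def R_def w_def)
  finally have s: "(\<lambda>n. if n mod 3 = 2 then c n * q ^ (n div 3) else 0) sums rank_component z Q" .
  have "(\<lambda>n. (if (3 * n + 2) mod 3 = 2 then c (3 * n + 2) * q ^ ((3 * n + 2) div 3) else 0)) sums rank_component z Q"
  proof (subst sums_mono_reindex[of "\<lambda>n. 3 * n + 2"])
    show "strict_mono (\<lambda>n::nat. 3 * n + 2)" by (simp add: strict_mono_def)
    fix n :: nat assume "n \<notin> range (\<lambda>n. 3 * n + 2)"
    then have "n mod 3 \<noteq> 2" by (metis mult_div_mod_eq rangeI)
    then show "(if n mod 3 = 2 then c n * q ^ (n div 3) else 0) = 0" by simp
  qed (rule s)
  moreover have "(3 * n + 2) mod 3 = 2" "(3 * n + 2) div 3 = n" for n :: nat by presburger+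
  ultimately show ?thesis by (simp add: c_def)
qed

text \<open>Inversion on the group of sixth roots of unity: \<open>rbar s\<close> is 1/6 of the sum
  of z^(-s) P(z), where w and w^2 are inverse to each other.\<close>

lemma rbar_eq_components:
  fixes Q :: complex
  assumes Q: "norm Q < 1" "Q \<noteq> 0" and q: "q = Q^3"
  defines "w \<equiv> \<omega>\<^sub>3" and "P \<equiv> (\<lambda>z. rank_component z Q)"
  shows "rbar 0 2 q = (P 1 + P (-1) + P w + P (w^2) + P (-w) + P (-(w^2))) / 6"
    and "rbar 1 2 q = (P 1 - P (-1) + w^2 * P w + w * P (w^2) - w^2 * P (-w) - w * P (-(w^2))) / 6"
    and "rbar 2 2 q = (P 1 + P (-1) + w * P w + w^2 * P (w^2) + w * P (-w) + w^2 * P (-(w^2))) / 6"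
    and "rbar 3 2 q = (P 1 - P (-1) + P w + P (w^2) - P (-w) - P (-(w^2))) / 6"
proof -
  have w: "w^2 = - 1 - w" "w^3 = 1" by (simp_all add: w_def omega3_square)
  define N where "N = (\<lambda>s n. of_nat (Nbar s 6 (3 * n + 2)) :: complex)"
  define S where "S = (\<lambda>z n. N 0 n + z * N 1 n + z^2 * N 2 n + z^3 * N 3 n + z^4 * N 4 n + z^5 * N 5 n)"
  have S: "(\<lambda>n. S z n * q ^ n) sums P z" if "z^6 = 1" for z
  proof -
    have "(\<Sum>s<6. z ^ s * of_nat (Nbar (int s) 6 (3 * n + 2))) = S z n" for n
      by (simp add: S_def N_def eval_nat_numeral)
    then show ?thesis using sums_residue_two[OF Q q that] by (simp add: P_def)
  qed
  have w6: "w^6 = 1" using w(2) by algebra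
  moreover have "(w^2)^6 = 1" using w(2) by algebra
  ultimately have u: "(1::complex)^6 = 1" "(-1::complex)^6 = 1" "w^6 = 1" "(w^2)^6 = 1" "(-w)^6 = 1" "(-(w^2))^6 = 1"
    by (simp_all add: power_minus_even)
  have "w^4 = w" "w^5 = w^2" "w^8 = w^2" "w^10 = w"
    using w(2) by (algebra, algebra, algebra, algebra)
  note pw = w6 this
  have Sval: "S 1 n = N 0 n + N 1 n + N 2 n + N 3 n + N 4 n + N 5 n"
    "S (-1) n = N 0 n - N 1 n + N 2 n - N 3 n + N 4 n - N 5 n"
    "S w n = N 0 n + w * N 1 n + (- 1 - w) * N 2 n + N 3 n + w * N 4 n + (- 1 - w) * N 5 n"
    "S (w^2) n = N 0 n + (- 1 - w) * N 1 n + w * N 2 n + N 3 n + (- 1 - w) * N 4 n + w * N 5 n"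
    "S (-w) n = N 0 n - w * N 1 n + (- 1 - w) * N 2 n - N 3 n + w * N 4 n - (- 1 - w) * N 5 n"
    "S (-(w^2)) n = N 0 n - (- 1 - w) * N 1 n + w * N 2 n - N 3 n + (- 1 - w) * N 4 n - w * N 5 n" for n
    by (simp_all add: S_def w(2) pw power_minus_odd) (simp_all add: w(1))
  have ww: "w * w = - 1 - w" using w(1) by (simp add: power2_eq_square)
  then have ww': "w * (w * X) = - X - w * X" for X by (metis (no_types) left_diff_distrib mult.assoc mult_minus1)
  note D = S[OF u(1)] S[OF u(2)] S[OF u(3)] S[OF u(4)] S[OF u(5)] S[OF u(6)]
  have comb: "(\<lambda>n. (c1 * S 1 n + c2 * S (-1) n + c3 * S w n + c4 * S (w^2) n + c5 * S (-w) n + c6 * S (-(w^2)) n) / 6 * q ^ n) sums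
     ((c1 * P 1 + c2 * P (-1) + c3 * P w + c4 * P (w^2) + c5 * P (-w) + c6 * P (-(w^2))) / 6)" for c1 c2 c3 c4 c5 c6
  proof -
    have "(\<lambda>n. (c1 * (S 1 n * q ^ n) + c2 * (S (-1) n * q ^ n) + c3 * (S w n * q ^ n) + c4 * (S (w^2) n * q ^ n) + c5 * (S (-w) n * q ^ n) + c6 * (S (-(w^2)) n * q ^ n)) / 6) sums
     ((c1 * P 1 + c2 * P (-1) + c3 * P w + c4 * P (w^2) + c5 * P (-w) + c6 * P (-(w^2))) / 6)"
      by (intro sums_divide sums_add sums_mult D)
    then show ?thesis by (simp add: distrib_right mult.assoc)
  qed
  have rb: "rbar s 2 q = (\<Sum>n. N s n * q ^ n)" for s by (simp add: rbar_def N_def)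
  have "(1 * S 1 n + 1 * S (-1) n + 1 * S w n + 1 * S (w^2) n + 1 * S (-w) n + 1 * S (-(w^2)) n) / 6 = N 0 n" for n
  proof -
    have "1 * S 1 n + 1 * S (-1) n + 1 * S w n + 1 * S (w^2) n + 1 * S (-w) n + 1 * S (-(w^2)) n = 6 * N 0 n"
      unfolding Sval unfolding w(1) by (simp add: algebra_simps ww ww')
    then show ?thesis by simp
  qed
  with comb[of 1 1 1 1 1 1] show "rbar 0 2 q = (P 1 + P (-1) + P w + P (w^2) + P (-w) + P (-(w^2))) / 6"
    unfolding rb by (simp add: sums_iff)
  have "(1 * S 1 n + - 1 * S (-1) n + w^2 * S w n + w * S (w^2) n + - (w^2) * S (-w) n + - w * S (-(w^2)) n) / 6 = N 1 n" for n
  proof -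
    have "1 * S 1 n + - 1 * S (-1) n + w^2 * S w n + w * S (w^2) n + - (w^2) * S (-w) n + - w * S (-(w^2)) n = 6 * N 1 n"
      unfolding Sval unfolding w(1) by (simp add: algebra_simps ww ww')
    then show ?thesis by simp
  qed
  with comb[of 1 "-1" "w^2" w "-(w^2)" "-w"] show "rbar 1 2 q = (P 1 - P (-1) + w^2 * P w + w * P (w^2) - w^2 * P (-w) - w * P (-(w^2))) / 6"
    unfolding rb by (simp add: sums_iff)
  have "(1 * S 1 n + 1 * S (-1) n + w * S w n + w^2 * S (w^2) n + w * S (-w) n + w^2 * S (-(w^2)) n) / 6 = N 2 n" for n
  proof -
    have "1 * S 1 n + 1 * S (-1) n + w * S w n + w^2 * S (w^2) n + w * S (-w) n + w^2 * S (-(w^2)) n = 6 * N 2 n"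
      unfolding Sval unfolding w(1) by (simp add: algebra_simps ww ww')
    then show ?thesis by simp
  qed
  with comb[of 1 1 w "w^2" w "w^2"] show "rbar 2 2 q = (P 1 + P (-1) + w * P w + w^2 * P (w^2) + w * P (-w) + w^2 * P (-(w^2))) / 6"
    unfolding rb by (simp add: sums_iff)
  have "(1 * S 1 n + - 1 * S (-1) n + 1 * S w n + 1 * S (w^2) n + - 1 * S (-w) n + - 1 * S (-(w^2)) n) / 6 = N 3 n" for n
  proof -
    have "1 * S 1 n + - 1 * S (-1) n + 1 * S w n + 1 * S (w^2) n + - 1 * S (-w) n + - 1 * S (-(w^2)) n = 6 * N 3 n"
      unfolding Sval unfolding w(1) by (simp add: algebra_simps ww ww')
    then show ?thesis by simp
  qed
  with comb[of 1 "-1" 1 1 "-1" "-1"] show "rbar 3 2 q = (P 1 - P (-1) + P w + P (w^2) - P (-w) - P (-(w^2))) / 6"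
    unfolding rb by (simp add: sums_iff)
qed

text \<open>Brings the product found at z = 1 into the form used in the theorem: x_m stands for J_m,
  and J_{1,6} and J_{3,6} are replaced by their product formulas.\<close>

lemma total_product_identity:
  fixes x1 x2 x3 x6 :: complex
  assumes "x1 \<noteq> 0" "x2 \<noteq> 0" "x3 \<noteq> 0" "x6 \<noteq> 0"
  shows "4 * x6 ^ 3 * x2 ^ 2 / x1 ^ 6 = 6 * (2 * x6 ^ 12 / (3 * (x1 * x6 ^ 2 / (x2 * x3)) ^ 6 * x2 ^ 4 * (x3 ^ 2 / x6) ^ 3))"
proof -
  have "6 * (2 * y / (3 * (A * y / ((B * b) * C)) * B * (C / u))) = 4 * u * b / A"
    if "A \<noteq> 0" "B \<noteq> 0" "C \<noteq> 0" "y \<noteq> 0" "u \<noteq> 0" for A B C b u y :: complex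
    using that by simp
  from this[of "x1^6" "x2^4" "x3^6" "x6^12" "x6^3" "x2^2"]
  have "4 * x6 ^ 3 * x2 ^ 2 / x1 ^ 6 = 6 * (2 * x6^12 / (3 * (x1^6 * x6^12 / ((x2^4 * x2^2) * x3^6)) * x2^4 * (x3^6 / x6^3)))"
    using assms by (simp only: power_not_zero not_False_eq_True simp_thms)
  moreover have "x2^4 * x2^2 = x2^6" by (simp flip: power_add)
  ultimately show ?thesis
    by (simp only: power_divide power_mult_distrib power_mult[symmetric]) simp
qed

theorem theorem1p3:
  fixes q :: complex
  assumes "0 < norm q" and "norm q < 1"
  shows "rbar 0 2 q =
             2 * J1 6 q ^ 12 / (3 * J2 1 6 q ^ 6 * J1 2 q ^ 4 * J2 3 6 q ^ 3)
           - 4 * J1 6 q ^ 3 / (3 * J1 2 q * J2 3 6 q)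
           + 2 * J2 1 6 q ^ 6 * J1 2 q ^ 2 * J2 3 6 q / (3 * J1 6 q ^ 6)
           - 4 / J2 3 6 q * (\<Sum>\<^sub>\<infinity>n::int. (-1) powi n * q powi (3 * n\<^sup>2 + 3 * n) / (1 + q powi (3 * n + 1))\<^sup>2)
           + 4 / J2 3 6 q * (\<Sum>\<^sub>\<infinity>n::int. (-1) powi n * q powi (3 * n\<^sup>2 + 3 * n) / (1 + q powi (3 * n + 1)))
    \<and> rbar 1 2 q =
             2 * J1 6 q ^ 12 / (3 * J2 1 6 q ^ 6 * J1 2 q ^ 4 * J2 3 6 q ^ 3)
           + 2 * J1 6 q ^ 3 / (J1 2 q * J2 3 6 q)
           - 2 * J2 1 6 q ^ 6 * J1 2 q ^ 2 * J2 3 6 q / (3 * J1 6 q ^ 6)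
           + 4 / J2 3 6 q * (\<Sum>\<^sub>\<infinity>n::int. (-1) powi n * q powi (3 * n\<^sup>2 + 3 * n) / (1 + q powi (3 * n + 1))\<^sup>2)
           - 4 / J2 3 6 q * (\<Sum>\<^sub>\<infinity>n::int. (-1) powi n * q powi (3 * n\<^sup>2 + 3 * n) / (1 + q powi (3 * n + 1)))
    \<and> rbar 2 2 q =
             2 * J1 6 q ^ 12 / (3 * J2 1 6 q ^ 6 * J1 2 q ^ 4 * J2 3 6 q ^ 3)
           + 2 * J1 6 q ^ 3 / (3 * J1 2 q * J2 3 6 q)
           + 2 * J2 1 6 q ^ 6 * J1 2 q ^ 2 * J2 3 6 q / (3 * J1 6 q ^ 6)
           - 4 / J2 3 6 q * (\<Sum>\<^sub>\<infinity>n::int. (-1) powi n * q powi (3 * n\<^sup>2 + 3 * n) / (1 + q powi (3 * n + 1))\<^sup>2)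
           + 2 / J2 3 6 q * (\<Sum>\<^sub>\<infinity>n::int. (-1) powi n * q powi (3 * n\<^sup>2 + 3 * n) / (1 + q powi (3 * n + 1)))
    \<and> rbar 3 2 q =
             2 * J1 6 q ^ 12 / (3 * J2 1 6 q ^ 6 * J1 2 q ^ 4 * J2 3 6 q ^ 3)
           - 4 * J1 6 q ^ 3 / (J1 2 q * J2 3 6 q)
           - 2 * J2 1 6 q ^ 6 * J1 2 q ^ 2 * J2 3 6 q / (3 * J1 6 q ^ 6)
           + 4 / J2 3 6 q * (\<Sum>\<^sub>\<infinity>n::int. (-1) powi n * q powi (3 * n\<^sup>2 + 3 * n) / (1 + q powi (3 * n + 1))\<^sup>2)"
proof -
  have nq: "norm q < 1" "q \<noteq> 0" using assms by auto
  \<comment> \<open>Any cube root of q would do, since \<open>rbar\<close> involves only q =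
    Q^3.\<close>
  define Q where "Q = exp (Ln q / 3)"
  have Q3: "q = Q^3" using nq by (simp add: Q_def exp_of_nat_mult[symmetric])
  have Q0: "Q \<noteq> 0" by (simp add: Q_def)
  have Q1: "norm Q < 1"
  proof (rule ccontr)
    assume "\<not> norm Q < 1"
    then have "norm Q ^ 3 \<ge> 1" by (intro one_le_power) simp
    then show False using nq by (simp add: Q3 norm_power)
  qed
  \<comment> \<open>A, B and C are the three theta terms of the theorem up to rational factors, l1
    and l2 its two sums divided by J_{3,6}.\<close>
  define A B C a l1 l2 where "A = 2 * J1 6 q ^ 12 / (3 * J2 1 6 q ^ 6 * J1 2 q ^ 4 * J2 3 6 q ^ 3)"
    and "B = J1 6 q ^ 3 / (J1 2 q * J2 3 6 q)"
    and "C = 2 * J2 1 6 q ^ 6 * J1 2 q ^ 2 * J2 3 6 q / (3 * J1 6 q ^ 6)"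
    and "a = J2 3 6 q" and "l1 = 1 / a * lerch1 q" and "l2 = 1 / a * lerch2 q"
  define w where "w = \<omega>\<^sub>3"
  have w: "w^2 = - 1 - w" by (simp add: w_def omega3_square)
  have P1: "rank_component 1 Q = 6 * A"
    unfolding rank_component_1[OF Q1 Q0 Q3] A_def J2_1_6_eq[OF nq] J2_3_6_eq[OF nq]
    by (rule total_product_identity; rule J1_nonzero[OF nq(1)]) simp_all
  have P2: "rank_component (-1) Q = 6 * C + 16 * l1 - 24 * l2"
    unfolding rank_component_minus_one[OF Q1 Q0 Q3] by (simp add: C_def l1_def l2_def a_def)
  have P3: "rank_component w Q = 6 * l1 - 8 * B" "rank_component (w^2) Q = 6 * l1 - 8 * B"
    using rank_component_omega[OF Q1 Q0 Q3] by (simp_all add: w_def B_def l1_def a_def)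
  have P4: "rank_component (-w) Q = 4 * B - 2 * l1" "rank_component (-(w^2)) Q = 4 * B - 2 * l1"
    using rank_component_minus_omega[OF Q1 Q0 Q3] by (simp_all add: w_def B_def l1_def a_def)
  note r = rbar_eq_components[OF Q1 Q0 Q3, folded w_def, unfolded P1 P2 P3 P4]
  have r0: "rbar 0 2 q = A - 4 / 3 * B + C - 4 * l2 + 4 * l1"
    unfolding r(1) by (simp add: field_simps)
  have r1: "rbar 1 2 q = A + 2 * B - C + 4 * l2 - 4 * l1"
  proof -
    have e: "6 * A - (6 * C + 16 * l1 - 24 * l2) + w^2 * (6 * l1 - 8 * B) + w * (6 * l1 - 8 * B) - w^2 * (4 * B - 2 * l1) - w * (4 * B - 2 * l1)
      = 6 * (A + 2 * B - C + 4 * l2 - 4 * l1)" using w by algebra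
    show ?thesis unfolding r(2) e by simp
  qed
  have r2: "rbar 2 2 q = A + 2 / 3 * B + C - 4 * l2 + 2 * l1"
  proof -
    have e: "6 * A + (6 * C + 16 * l1 - 24 * l2) + w * (6 * l1 - 8 * B) + w^2 * (6 * l1 - 8 * B) + w * (4 * B - 2 * l1) + w^2 * (4 * B - 2 * l1)
      = 6 * A + 4 * B + 6 * C - 24 * l2 + 12 * l1" using w by algebra
    show ?thesis unfolding r(3) e by (simp add: field_simps)
  qed
  have r3: "rbar 3 2 q = A - 4 * B - C + 4 * l2"
    unfolding r(4) by (simp add: field_simps)
  have e: "4 * J1 6 q ^ 3 / (3 * J1 2 q * J2 3 6 q) = 4 / 3 * B" "2 * J1 6 q ^ 3 / (J1 2 q * J2 3 6 q) = 2 * B"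
    "2 * J1 6 q ^ 3 / (3 * J1 2 q * J2 3 6 q) = 2 / 3 * B" "4 * J1 6 q ^ 3 / (J1 2 q * J2 3 6 q) = 4 * B"
    "k / J2 3 6 q * lerch1 q = k * l1" "k / J2 3 6 q * lerch2 q = k * l2" for k
    by (simp_all add: B_def l1_def l2_def a_def)
  show ?thesis
    unfolding lerch1_def[symmetric] lerch2_def[symmetric] e A_def[symmetric] C_def[symmetric]
    using r0 r1 r2 r3 by blast
qed

end
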